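(* Let $d\ge1$, $c>0$, and let $A\subset\mathbb{S}^{d-1}$ be a measurable subset. Then for $\mu$-almost every unimodular lattice $\Lambda\in X_{d+1}$, $$\lim_{T\to\infty}\frac{N(\Lambda,T,A)}{N(\Lambda,T)}=\operatorname{vol}(A).$$
   Context: $X_{d+1}=\operatorname{SL}_{d+1}(\mathbb{R})/\operatorname{SL}_{d+1}(\mathbb{Z})$ is identified with the space of unimodular lattices in $\mathbb{R}^{d+1}$ via $g\operatorname{SL}_{d+1}(\mathbb{Z})\mapsto g\mathbb{Z}^{d+1}$, and $\mu$ is the probability measure on it induced by Haar measure on $\operatorname{SL}_{d+1}(\mathbb{R})$. Write vectors of $\mathbb{R}^{d+1}=\mathbb{R}^d\times\mathbb{R}$ as $\mathbf{v}=(\mathbf{v}_1,v_2)$, with $\|\cdot\|$ the Euclidean norm on $\mathbb{R}^d$. For $T>1$ let $P_T=\{\mathbf{v}: \|\mathbf{v}_1\|^d v_2\le c,\ 1<v_2\le T\}$ and $P_{A,T}=\{\mathbf{v}\in P_T: \mathbf{v}_1/\|\mathbf{v}_1\|\in A\}$. Set $N(\Lambda,T)=\#(\Lambda\cap P_T)$ and $N(\Lambda,T,A)=\#(\Lambda\cap P_{A,T})$. $\operatorname{vol}$ is the rotation-invariant probability measure on $\mathbb{S}^{d-1}$. *)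

theory Defs
  imports "HOL-Analysis.Analysis" "HOL-Probability.Probability"
begin

definition SL_real :: "(real^'n^'n) set" where
  "SL_real = {g. det g = 1}"

definition SL_int :: "(real^'n^'n) set" where
  "SL_int = {g. det g = 1 \<and> (\<forall>i j. g $ i $ j \<in> \<int>)}"

definition int_vectors :: "(real^'n) set" where
  "int_vectors = {v. \<forall>i. v $ i \<in> \<int>}"

definition lattice_of :: "real^'n^'n \<Rightarrow> (real^'n) set" where
  "lattice_of g = (\<lambda>v. g *v v) ` int_vectors"

definition unimodular_lattices :: "(real^'n) set set" where
  "unimodular_lattices = lattice_of ` SL_real"

text \<open>Local finiteness suffices for a Radon measure here, since the group is second countable and
  locally compact. Left-invariance is the defining property; no right-invariance is assumed.\<close>

definition haar_measure_SL :: "(real^'n^'n) measure \<Rightarrow> bool" where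
  "haar_measure_SL m \<longleftrightarrow>
     sets m = sets (restrict_space borel SL_real) \<and>
     (\<forall>g\<in>SL_real. \<forall>E\<in>sets m. emeasure m ((\<lambda>h. g ** h) ` E) = emeasure m E) \<and>
     (\<forall>K. compact K \<and> K \<subseteq> SL_real \<longrightarrow> emeasure m K < \<infinity>) \<and>
     emeasure m SL_real \<noteq> 0"

definition fundamental_domain_SL :: "(real^'n^'n) set \<Rightarrow> bool" where
  "fundamental_domain_SL F \<longleftrightarrow>
     F \<in> sets (restrict_space borel SL_real) \<and>
     (\<forall>g\<in>SL_real. \<exists>!\<gamma>. \<gamma> \<in> SL_int \<and> g ** \<gamma> \<in> F)"

text \<open>The quotient of the real by the integral special linear group is identified with the set of
  unimodular lattices through \<^const>\<open>lattice_of\<close> and carries the quotient sigma-algebra.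
  The normalisation is absorbed in the choice of the Haar measure, which is unique up to a
  positive scalar; the result does not depend on the fundamental domain.\<close>

definition haar_prob_on_lattices :: "(real^'n) set measure \<Rightarrow> bool" where
  "haar_prob_on_lattices \<mu> \<longleftrightarrow>
     prob_space \<mu> \<and>
     space \<mu> = unimodular_lattices \<and>
     sets \<mu> = {U. U \<subseteq> unimodular_lattices \<and>
                 SL_real \<inter> lattice_of -` U \<in> sets (restrict_space borel SL_real)} \<and>
     (\<exists>m F. haar_measure_SL m \<and> fundamental_domain_SL F \<and>
        (\<forall>U\<in>sets \<mu>. emeasure \<mu> U = emeasure m (F \<inter> lattice_of -` U)))"

text \<open>Invariance is under the full orthogonal group: on the two-point sphere in dimension one
  there are no nontrivial rotations of determinant one, and in higher dimension both kinds of
  invariance determine the same probability measure.\<close>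

definition rotation_invariant_prob_on_sphere :: "(real^'d) measure \<Rightarrow> bool" where
  "rotation_invariant_prob_on_sphere \<sigma> \<longleftrightarrow>
     prob_space \<sigma> \<and>
     sets \<sigma> = sets (restrict_space borel (sphere 0 1)) \<and>
     (\<forall>R. orthogonal_transformation R \<longrightarrow>
        (\<forall>E\<in>sets \<sigma>. emeasure \<sigma> (R ` E) = emeasure \<sigma> E))"

text \<open>The space of dimension one more than that of \<^typ>\<open>real^'d\<close> is modelled as
  \<^typ>\<open>real^('d option)\<close>, the index \<^const>\<open>None\<close> being the last coordinate.\<close>

definition first_part :: "real^(('d::finite) option) \<Rightarrow> real^'d" where
  "first_part v = (\<chi> i. v $ Some i)"

definition last_coord :: "real^(('d::finite) option) \<Rightarrow> real" where
  "last_coord v = v $ None"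

definition P_set :: "real \<Rightarrow> real \<Rightarrow> (real^(('d::finite) option)) set" where
  "P_set c T = {v :: real^(('d::finite) option).
     norm (first_part v) ^ CARD('d) * last_coord v \<le> c \<and> 1 < last_coord v \<and> last_coord v \<le> T}"

text \<open>If the first part vanishes, its normalisation below is \<open>0\<close>, which lies in no subset of the
  sphere, so such vectors are excluded.\<close>

definition P_dir_set :: "real \<Rightarrow> (real^'d) set \<Rightarrow> real \<Rightarrow> (real^(('d::finite) option)) set" where
  "P_dir_set c A T =
     {v \<in> P_set c T. first_part v /\<^sub>R norm (first_part v) \<in> A}"

definition N_count :: "real \<Rightarrow> (real^(('d::finite) option)) set \<Rightarrow> real \<Rightarrow> nat" where
  "N_count c \<Lambda> T = card (\<Lambda> \<inter> P_set c T)"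

definition N_dir_count ::
  "real \<Rightarrow> (real^(('d::finite) option)) set \<Rightarrow> real \<Rightarrow> (real^'d) set \<Rightarrow> nat" where
  "N_dir_count c \<Lambda> T A = card (\<Lambda> \<inter> P_dir_set c A T)"

end

theory Submission
  imports Defs
begin

text \<open>
  Let \<open>a = diag(2^(1/d), \<dots>, 2^(1/d), 1/2)\<close> and let \<open>f\<^sub>A(\<Lambda>)\<close> be the number of points of \<open>\<Lambda>\<close> in the part
  \<open>v\<^sub>2 \<le> 2\<close> of the region with directions in \<open>A\<close>. Then \<open>N(\<Lambda>, 2^k, A)\<close> is the Birkhoff sum of \<open>f\<^sub>A\<close>
  along \<open>\<Lambda>, a\<Lambda>, \<dots>, a^(k-1)\<Lambda>\<close>, so Birkhoff's theorem for the ergodic action of \<open>a\<close> gives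
  \<open>N(\<Lambda>, 2^k, A) / k \<rightarrow> \<integral> f\<^sub>A\<close> almost surely. As a function of \<open>A\<close> the integral is a
  rotation-invariant measure, hence a multiple of \<open>vol\<close>, and the quotient of two such limits is
  \<open>vol A\<close>.

  Ergodicity is the Mautner phenomenon: an \<open>a\<close>-invariant set is invariant under the transvections
  contracted or expanded by \<open>a\<close>, and these generate the special linear group. Siegel's formula is
  replaced by a softer argument for the integrability of \<open>f\<^sub>A\<close>: near the identity of the group,
  the integrals of \<open>f\<^sub>A(a^j g \<int>^(d+1))\<close> over \<open>g\<close> are bounded uniformly in \<open>j\<close> by a direct count,
  while the averages of the truncations \<open>min f\<^sub>A M\<close> over \<open>j\<close> converge to their integrals.
\<close>

section \<open>Generation of the special linear group\<close>

text \<open>\<open>\<mu>\<close> is known only through some left-invariant measure and some Borel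
  fundamental domain, so the work is done in one concrete model: \<open>SL_haar\<close>, Lebesgue
  measure on matrices with determinant near 1, rescaled to determinant 1. Multiplication by a
  transvection is a shear of the space of matrices, so generation by transvections serves twice: it
  makes the model invariant on both sides, and it turns invariance under transvections into
  ergodicity. Null sets of lattices correspond to null sets of matrices
  (\<open>AE_lattice_map_iff\<close>), which is how Lebesgue estimates near the identity matrix give
  information about \<open>\<mu>\<close>.

  Rotation invariance includes maps of determinant -1, since for d = 1 the only nontrivial isometry
  of the sphere is a reflection; multiplying by an integral reflection on the right repairs the
  determinant without changing the lattice.

  The mean of f_A is never computed. It has to be finite, a rotation-invariant measure in A that
  ignores the vectors with vanishing first part, and positive for the full set of directions.
  Passing from T = 2^k to real T costs nothing because the counts grow linearly in k.\<close>

definition transvection :: "'n \<Rightarrow> 'n \<Rightarrow> real \<Rightarrow> real^'n^'n" where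
  "transvection i j x = (\<chi> r s. (if r = s then 1 else 0) + (if r = i \<and> s = j then x else 0))"

lemma transvection_mult:
  "transvection i j x ** A = (\<chi> r. if r = i then row i A + x *\<^sub>R row j A else row r A)"
  by (simp add: vec_eq_iff transvection_def matrix_matrix_mult_def row_def distrib_right
      sum.distrib if_distrib[where f="\<lambda>y. y * _"] sum.delta' cong: if_cong)

lemma mult_transvection:
  "A ** transvection i j x = (\<chi> r s. A $ r $ s + (if s = j then x * A $ r $ i else 0))"
  by (simp add: vec_eq_iff transvection_def matrix_matrix_mult_def distrib_left
      sum.distrib if_distrib[where f="\<lambda>y. _ * y"] sum.delta' mult.commute cong: if_cong)

lemma det_transvection:
  fixes i j :: "'n::finite"
  assumes "i \<noteq> j"
  shows "det (transvection i j x) = 1"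
  using det_row_operation[OF assms, of "mat 1 :: real^'n^'n" x] transvection_mult[of i j x "mat 1"]
  by (simp flip: scalar_mult_eq_scaleR cong: if_cong)

inductive transvection_product :: "real^'n^'n \<Rightarrow> bool" where
  one: "transvection_product (mat 1)"
| step: "i \<noteq> j \<Longrightarrow> transvection_product g \<Longrightarrow> transvection_product (transvection i j x ** g)"

lemma transvection_product_mult:
  assumes "transvection_product g" "transvection_product h"
  shows "transvection_product (g ** h)"
  using assms(1)
proof induction
  case one
  then show ?case using assms(2) by simp
next
  case (step i j g x)
  then show ?case
    by (metis matrix_mul_assoc transvection_product.step)
qed

lemma transvection_product_transvection: "i \<noteq> j \<Longrightarrow> transvection_product (transvection i j x)"
  using transvection_product.step[OF _ transvection_product.one, of i j x] by simp

definition diag_matrix :: "('n \<Rightarrow> real) \<Rightarrow> real^'n^'n" where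
  "diag_matrix v = (\<chi> r s. if r = s then v s else 0)"

lemma mult_diag_matrix: "A ** diag_matrix v = (\<chi> r s. A $ r $ s * v s)"
  by (simp add: vec_eq_iff diag_matrix_def matrix_matrix_mult_def
      if_distrib[where f="\<lambda>y. _ * y"] sum.delta' cong: if_cong)

lemma diag_matrix_mult: "diag_matrix v ** A = (\<chi> r s. v r * A $ r $ s)"
  by (simp add: vec_eq_iff diag_matrix_def matrix_matrix_mult_def
      if_distrib[where f="\<lambda>y. y * _"] sum.delta cong: if_cong)

lemma det_diag_matrix: "det (diag_matrix v) = (\<Prod>i\<in>UNIV. v i)"
  by (subst det_diagonal) (auto simp: diag_matrix_def)

text \<open>With w(t) = E_mn(t) E_nm(-1/t) E_mn(t), the product w(t) w(-1) is diagonal with t at m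
  and 1/t at n. The conclusion describes the effect on the columns of an arbitrary \<open>A\<close>,
  so that later uses reduce to comparing entries.\<close>

lemma column_scaling_transvection_product:
  assumes "m \<noteq> n" "t \<noteq> 0"
  obtains h :: "real^'n^'n" where "transvection_product h"
    "\<And>A :: real^'n^'n. A ** h = (\<chi> r s. if s = m then t * A $ r $ m else if s = n then A $ r $ n / t else A $ r $ s)"
proof
  let ?w = "\<lambda>t. transvection m n t ** transvection n m (-1/t) ** transvection m n t"
  show "transvection_product (?w t ** ?w (-1))"
    using assms by (intro transvection_product_mult transvection_product_transvection) auto
  fix A :: "real^'n^'n"
  have "A ** (?w t ** ?w (-1)) =
     A ** transvection m n t ** transvection n m (-1/t) ** transvection m n t **
     transvection m n (-1) ** transvection n m 1 ** transvection m n (-1)"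
    by (simp add: matrix_mul_assoc)
  also have "\<dots> = (\<chi> r s. if s = m then t * A $ r $ m else if s = n then A $ r $ n / t else A $ r $ s)"
    using assms by (simp add: mult_transvection vec_eq_iff field_simps)
  finally show "A ** (?w t ** ?w (-1)) =
      (\<chi> r s. if s = m then t * A $ r $ m else if s = n then A $ r $ n / t else A $ r $ s)" .
qed

text \<open>The element w(1) of the preceding construction. A plain swap has determinant -1, hence
  the sign.\<close>

lemma signed_column_swap_transvection_product:
  assumes "m \<noteq> n"
  obtains h :: "real^'n^'n" where "transvection_product h"
    "\<And>A :: real^'n^'n. A ** h = (\<chi> r s. if s = n then A $ r $ m else if s = m then - A $ r $ n else A $ r $ s)"
proof
  let ?w = "transvection m n 1 ** transvection n m (-1) ** transvection m n 1"
  show "transvection_product ?w"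
    using assms by (intro transvection_product_mult transvection_product_transvection) auto
  fix A :: "real^'n^'n"
  have "A ** ?w = A ** transvection m n 1 ** transvection n m (-1) ** transvection m n 1"
    by (simp add: matrix_mul_assoc)
  also have "\<dots> = (\<chi> r s. if s = n then A $ r $ m else if s = m then - A $ r $ n else A $ r $ s)"
    using assms by (simp add: mult_transvection vec_eq_iff field_simps)
  finally show "A ** ?w =
      (\<chi> r s. if s = n then A $ r $ m else if s = m then - A $ r $ n else A $ r $ s)" .
qed

lemma transvection_product_diag_matrix:
  fixes v :: "'n::finite \<Rightarrow> real"
  assumes "(\<Prod>i\<in>UNIV. v i) = 1"
  shows "transvection_product (diag_matrix v)"
  using assms
proof (induction "card {i. v i \<noteq> 1}" arbitrary: v rule: less_induct)
  case less
  show ?case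
  proof (cases "\<exists>i. v i \<noteq> 1")
    case False
    then have "diag_matrix v = mat 1"
      by (simp add: diag_matrix_def mat_def vec_eq_iff)
    then show ?thesis by (simp add: transvection_product.one)
  next
    case True
    then obtain i where i: "v i \<noteq> 1" by auto
    have "\<exists>j. j \<noteq> i \<and> v j \<noteq> 1"
    proof (rule ccontr)
      assume "\<not> ?thesis"
      then have "(\<Prod>k\<in>UNIV-{i}. v k) = 1" by (intro prod.neutral) auto
      then show False
        using less.prems i prod.remove[of UNIV i v] by simp
    qed
    then obtain j where j: "j \<noteq> i" "v j \<noteq> 1" by auto
    have vi: "v i \<noteq> 0" using less.prems prod_zero[of UNIV v] by fastforce
    \<comment> \<open>The entry at \<open>i\<close> is absorbed into the entry at \<open>j\<close>.
      This keeps the product and makes fewer entries differ from 1.\<close>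
    define w where "w = v(i := 1, j := v j * v i)"
    obtain h :: "real^'n^'n" where h: "transvection_product h"
      "\<And>A :: real^'n^'n. A ** h = (\<chi> r s. if s = i then v i * A $ r $ i else if s = j then A $ r $ j / v i else A $ r $ s)"
      by (rule column_scaling_transvection_product[OF j(1)[symmetric] vi]) (rule that)
    have "diag_matrix v = diag_matrix w ** h"
      using j vi by (simp add: h(2) diag_matrix_def w_def vec_eq_iff)
    moreover have "transvection_product (diag_matrix w)"
    proof (rule less.hyps)
      have "{k. w k \<noteq> 1} \<subseteq> {k. v k \<noteq> 1} - {i}" using j by (auto simp: w_def split: if_splits)
      then have "card {k. w k \<noteq> 1} \<le> card ({k. v k \<noteq> 1} - {i})" by (intro card_mono) auto
      also have "\<dots> < card {k. v k \<noteq> 1}" using i by (intro psubset_card_mono) auto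
      finally show "card {k. w k \<noteq> 1} < card {k. v k \<noteq> 1}" .
      have "(\<Prod>k\<in>UNIV. w k) = w i * (w j * (\<Prod>k\<in>UNIV-{i}-{j}. w k))"
        using j prod.remove[of UNIV i w] prod.remove[of "UNIV-{i}" j w] by simp
      also have "(\<Prod>k\<in>UNIV-{i}-{j}. w k) = (\<Prod>k\<in>UNIV-{i}-{j}. v k)"
        by (intro prod.cong) (auto simp: w_def)
      also have "w i * (w j * \<dots>) = v i * (v j * \<dots>)" using j by (simp add: w_def)
      also have "\<dots> = (\<Prod>k\<in>UNIV. v k)"
        using j prod.remove[of UNIV i v] prod.remove[of "UNIV-{i}" j v] by simp
      finally show "(\<Prod>k\<in>UNIV. w k) = 1" using less.prems by simp
    qed
    ultimately show ?thesis using transvection_product_mult[OF _ h(1)] by simp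
  qed
qed

lemma det_transvection_product: "transvection_product g \<Longrightarrow> det g = 1"
  by (induction rule: transvection_product.induct) (auto simp: det_mul det_transvection)

text \<open>Gaussian elimination by induction over row operations. The induction runs through all
  matrices, singular ones included, so invertibility is a premise inside the claim. A column swap
  would act to the right of the diagonal factor; the signed swap is moved to its left, which
  permutes the diagonal entries and leaves the sign in one of them.\<close>

lemma transvection_product_times_diagonal:
  fixes A :: "real^'n^'n"
  shows "det A \<noteq> 0 \<longrightarrow> (\<exists>B v. transvection_product B \<and> A = B ** diag_matrix v)"
proof (induction A rule: induct_matrix_row_operations)
  case (1 A i)
  then show ?case using det_zero_row by blast
next
  case (2 A)
  then have "A = mat 1 ** diag_matrix (\<lambda>i. A $ i $ i)"
    by (auto simp: diag_matrix_def vec_eq_iff)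
  then show ?case using transvection_product.one by blast
next
  case (3 A m n)
  show ?case
  proof
    assume d: "det (\<chi> i j. A $ i $ Transposition.transpose m n j) \<noteq> 0"
    have "(\<chi> i j. A $ i $ Transposition.transpose m n j) = transpose (\<chi> i. transpose A $ Transposition.transpose m n i)"
      by (simp add: vec_eq_iff transpose_def)
    with d have "det A \<noteq> 0"
      using det_permute_rows[OF permutes_swap_id[of m UNIV n], of "transpose A"] by (simp add: det_transpose)
    with 3 obtain B v where Bv: "transvection_product B" "A = B ** diag_matrix v" by auto
    obtain h :: "real^'n^'n" where h: "transvection_product h"
      "\<And>A :: real^'n^'n. A ** h = (\<chi> r s. if s = n then A $ r $ m else if s = m then - A $ r $ n else A $ r $ s)"
      by (rule signed_column_swap_transvection_product[OF 3(2)]) (rule that)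
    have "(\<chi> i j. A $ i $ Transposition.transpose m n j) = (B ** h) ** diag_matrix (v(n := v m, m := - v n))"
      using 3(2) by (simp add: mult_diag_matrix h(2) Bv(2) vec_eq_iff Transposition.transpose_def)
    then show "\<exists>B v. transvection_product B \<and> (\<chi> i j. A $ i $ Transposition.transpose m n j) = B ** diag_matrix v"
      using transvection_product_mult Bv(1) h(1) by blast
  qed
next
  case (4 A m n c)
  have eq: "(\<chi> i. if i = m then row m A + c *\<^sub>R row n A else row i A) = transvection m n c ** A"
    by (simp add: transvection_mult)
  show ?case
    unfolding eq
  proof
    assume "det (transvection m n c ** A) \<noteq> 0"
    then have "det A \<noteq> 0" by (simp add: det_mul)
    with 4 obtain B v where Bv: "transvection_product B" "A = B ** diag_matrix v" by auto
    then have "transvection m n c ** A = (transvection m n c ** B) ** diag_matrix v"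
      by (simp add: matrix_mul_assoc)
    then show "\<exists>B v. transvection_product B \<and> transvection m n c ** A = B ** diag_matrix v"
      using transvection_product.step[OF 4(2) Bv(1)] by blast
  qed
qed

theorem transvection_product_iff_det_1:
  fixes A :: "real^'n^'n"
  shows "transvection_product A \<longleftrightarrow> det A = 1"
proof
  assume d: "det A = 1"
  then obtain B v where Bv: "transvection_product B" "A = B ** diag_matrix v"
    using transvection_product_times_diagonal[of A] by auto
  with d have "(\<Prod>i\<in>UNIV. v i) = 1"
    by (simp add: det_mul det_transvection_product det_diag_matrix)
  then show "transvection_product A"
    using Bv transvection_product_diag_matrix transvection_product_mult by blast
qed (rule det_transvection_product)

section \<open>Invariance of Lebesgue measure on matrices\<close>

lemma nn_integral_lborel_insert:
  fixes f :: "'a::euclidean_space \<Rightarrow> ennreal"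
  assumes b: "b \<in> Basis" and [measurable]: "f \<in> borel_measurable borel"
  shows "(\<integral>\<^sup>+v. f v \<partial>lborel) =
    (\<integral>\<^sup>+\<omega>. (\<integral>\<^sup>+y. f ((\<Sum>a\<in>Basis-{b}. \<omega> a *\<^sub>R a) + y *\<^sub>R b) \<partial>lborel) \<partial>(\<Pi>\<^sub>M a\<in>Basis-{b}. lborel))"
proof -
  interpret product_sigma_finite "\<lambda>_::'a. lborel :: real measure" ..
  have ins: "insert b (Basis - {b}) = Basis" using b by auto
  have "(\<integral>\<^sup>+v. f v \<partial>lborel) = (\<integral>\<^sup>+\<omega>. f (\<Sum>a\<in>Basis. \<omega> a *\<^sub>R a) \<partial>(\<Pi>\<^sub>M a\<in>Basis. lborel))"
    by (subst lborel_eq, subst nn_integral_distr) auto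
  also have "\<dots> = (\<integral>\<^sup>+\<omega>. f (\<Sum>a\<in>Basis. \<omega> a *\<^sub>R a) \<partial>(\<Pi>\<^sub>M a\<in>insert b (Basis - {b}). lborel))"
    by (simp only: ins)
  also have "\<dots> = (\<integral>\<^sup>+\<omega>. (\<integral>\<^sup>+y. f (\<Sum>a\<in>Basis. (fun_upd \<omega> b y) a *\<^sub>R a) \<partial>lborel) \<partial>(\<Pi>\<^sub>M a\<in>Basis-{b}. lborel))"
    by (rule product_nn_integral_insert) (auto simp: ins)
  also have "(\<lambda>\<omega> y. f (\<Sum>a\<in>Basis. (fun_upd \<omega> b y) a *\<^sub>R a)) =
      (\<lambda>\<omega> y. f ((\<Sum>a\<in>Basis-{b}. \<omega> a *\<^sub>R a) + y *\<^sub>R b))"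
    using b by (intro ext arg_cong[where f=f]) (simp add: sum.remove add.commute)
  finally show ?thesis .
qed

text \<open>Once all coordinates but the one along \<open>b'\<close> are fixed,
  \<open>v \<bullet> b\<close> is a constant, so the shear is a translation of the remaining
  coordinate.\<close>

lemma lborel_shear:
  fixes b b' :: "'a::euclidean_space"
  assumes b: "b \<in> Basis" "b' \<in> Basis" "b \<noteq> b'"
  shows "distr lborel borel (\<lambda>v. v + (x * (v \<bullet> b)) *\<^sub>R b') = lborel"
proof (rule measure_eqI)
  fix E assume "E \<in> sets (distr lborel borel (\<lambda>v. v + (x * (v \<bullet> b)) *\<^sub>R b'))"
  then have E[measurable]: "E \<in> sets borel" by simp
  let ?s = "\<lambda>v. v + (x * (v \<bullet> b)) *\<^sub>R b'"
  have "emeasure (distr lborel borel ?s) E = (\<integral>\<^sup>+v. indicator E (?s v) \<partial>lborel)"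
    by (subst nn_integral_distr[symmetric, where M'=borel]) (auto simp: nn_integral_indicator)
  also have "\<dots> = (\<integral>\<^sup>+\<omega>. (\<integral>\<^sup>+y. indicator E (?s ((\<Sum>a\<in>Basis-{b'}. \<omega> a *\<^sub>R a) + y *\<^sub>R b')) \<partial>lborel)
       \<partial>(\<Pi>\<^sub>M a\<in>Basis-{b'}. lborel))"
    by (rule nn_integral_lborel_insert) (use b in auto)
  also have "\<dots> = (\<integral>\<^sup>+\<omega>. (\<integral>\<^sup>+y. indicator E ((\<Sum>a\<in>Basis-{b'}. \<omega> a *\<^sub>R a) + y *\<^sub>R b') \<partial>lborel)
       \<partial>(\<Pi>\<^sub>M a\<in>Basis-{b'}. lborel))"
  proof (rule nn_integral_cong)
    fix \<omega> :: "'a \<Rightarrow> real"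
    let ?u = "\<Sum>a\<in>Basis-{b'}. \<omega> a *\<^sub>R a"
    have "(\<integral>\<^sup>+y. indicator E (?u + y *\<^sub>R b') \<partial>lborel) =
        (\<integral>\<^sup>+y. indicator E (?u + (x * (?u \<bullet> b) + 1 * y) *\<^sub>R b') \<partial>lborel)"
      by (subst nn_integral_real_affine[where c=1 and t="x * (?u \<bullet> b)"]) auto
    moreover have "?s (?u + y *\<^sub>R b') = ?u + (x * (?u \<bullet> b) + 1 * y) *\<^sub>R b'" for y
      using b by (simp add: inner_add_left inner_Basis algebra_simps)
    ultimately show "(\<integral>\<^sup>+y. indicator E (?s (?u + y *\<^sub>R b')) \<partial>lborel) = (\<integral>\<^sup>+y. indicator E (?u + y *\<^sub>R b') \<partial>lborel)"
      by (simp only:)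
  qed
  also have "\<dots> = (\<integral>\<^sup>+v. indicator E v \<partial>lborel)"
    by (rule nn_integral_lborel_insert[symmetric]) (use b in auto)
  finally show "emeasure (distr lborel borel ?s) E = emeasure lborel E" by simp
qed simp

text \<open>No coordinate that is read is ever written, so the sum is a composition of single
  shears. Adding a multiple of a row or a column of a matrix to another one has this form, with one
  shear for each entry.\<close>

lemma lborel_multi_shear:
  fixes b b' :: "'k \<Rightarrow> 'a::euclidean_space"
  assumes "finite S" "\<And>k l. k \<in> S \<Longrightarrow> l \<in> S \<Longrightarrow> b k \<noteq> b' l" "b ` S \<subseteq> Basis" "b' ` S \<subseteq> Basis"
  shows "distr lborel borel (\<lambda>v. v + x *\<^sub>R (\<Sum>k\<in>S. (v \<bullet> b k) *\<^sub>R b' k)) = lborel"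
  using assms
proof (induction S rule: finite_induct)
  case empty
  then show ?case using distr_id2[of "borel :: 'a measure" lborel] by (simp add: id_def)
next
  case (insert l S)
  let ?f = "\<lambda>S v. v + x *\<^sub>R (\<Sum>k\<in>S. (v \<bullet> b k) *\<^sub>R b' k)"
  let ?s = "\<lambda>v. v + (x * (v \<bullet> b l)) *\<^sub>R b' l"
  have "(\<Sum>k\<in>S. (v \<bullet> b k) * (b' k \<bullet> b l)) = 0" for v
    using insert.prems by (intro sum.neutral ballI) (simp add: inner_Basis image_subset_iff, metis)
  then have "?f S v \<bullet> b l = v \<bullet> b l" for v
    by (simp add: inner_add_left inner_sum_left)
  then have "?f (insert l S) = ?s \<circ> ?f S"
    using insert by (auto simp: fun_eq_iff algebra_simps)
  then have "distr lborel borel (?f (insert l S)) = distr (distr lborel borel (?f S)) borel ?s"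
    by (subst distr_distr) auto
  also have "\<dots> = distr lborel borel ?s" using insert by simp
  also have "\<dots> = lborel" using insert by (intro lborel_shear) auto
  finally show ?case .
qed

lemma lborel_sign_change:
  fixes c :: "'a::euclidean_space \<Rightarrow> real"
  assumes "\<And>j. j \<in> Basis \<Longrightarrow> \<bar>c j\<bar> = 1"
  shows "distr lborel borel (\<lambda>v. \<Sum>j\<in>Basis. (c j * (v \<bullet> j)) *\<^sub>R j) = (lborel :: 'a measure)"
proof -
  have "c j \<noteq> 0" if "j \<in> Basis" for j using assms[OF that] by auto
  then have "(lborel :: 'a measure) = density (distr lborel borel (\<lambda>x. 0 + (\<Sum>j\<in>Basis. (c j * (x \<bullet> j)) *\<^sub>R j))) (\<lambda>_. \<Prod>j\<in>Basis. \<bar>c j\<bar>)"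
    by (rule lborel_affine_euclidean)
  then show ?thesis using assms by (simp add: density_1)
qed

section \<open>Continuity and measurability of matrix operations\<close>

lemma continuous_on_matrix_mult [continuous_intros]:
  fixes f :: "'a::topological_space \<Rightarrow> real^'n^'m" and g :: "'a \<Rightarrow> real^'k^'n"
  assumes "continuous_on S f" "continuous_on S g"
  shows "continuous_on S (\<lambda>x. f x ** g x)"
  unfolding matrix_matrix_mult_def
  by (intro continuous_on_vec_lambda continuous_intros assms)

lemma continuous_on_matrix_vector_mult_fun [continuous_intros]:
  fixes f :: "'a::topological_space \<Rightarrow> real^'n^'m" and g :: "'a \<Rightarrow> real^'n"
  assumes "continuous_on S f" "continuous_on S g"
  shows "continuous_on S (\<lambda>x. f x *v g x)"
  unfolding matrix_vector_mult_def
  by (intro continuous_on_vec_lambda continuous_intros assms)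

lemma continuous_on_det [continuous_intros]:
  fixes f :: "'a::topological_space \<Rightarrow> real^'n^'n"
  assumes "continuous_on S f"
  shows "continuous_on S (\<lambda>x. det (f x))"
  unfolding det_def by (intro continuous_intros assms)

lemma borel_measurable_matrix_mult [measurable]:
  fixes f :: "'a \<Rightarrow> real^'n^'m" and g :: "'a \<Rightarrow> real^'k^'n"
  assumes "f \<in> borel_measurable M" "g \<in> borel_measurable M"
  shows "(\<lambda>x. f x ** g x) \<in> borel_measurable M"
  using assms by (rule borel_measurable_continuous_Pair) (intro continuous_intros)

lemma borel_measurable_matrix_vector_mult [measurable]:
  fixes f :: "'a \<Rightarrow> real^'n^'m" and g :: "'a \<Rightarrow> real^'n"
  assumes "f \<in> borel_measurable M" "g \<in> borel_measurable M"
  shows "(\<lambda>x. f x *v g x) \<in> borel_measurable M"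
  using assms by (rule borel_measurable_continuous_Pair) (intro continuous_intros)

lemma borel_measurable_det [measurable]:
  fixes f :: "'a \<Rightarrow> real^'n^'n"
  assumes "f \<in> borel_measurable M"
  shows "(\<lambda>x. det (f x)) \<in> borel_measurable M"
  by (rule borel_measurable_continuous_on[OF _ assms]) (intro continuous_intros)

lemma axis_axis_in_Basis [simp]: "axis i (axis k 1) \<in> (Basis :: (real^'n^'m) set)"
  by (auto simp: Basis_vec_def)

lemma inner_axis_axis_matrix [simp]: "(g :: real^'n^'m) \<bullet> axis i (axis k 1) = g $ i $ k"
  by (simp add: inner_axis)

lemma sum_axis_axis_nth: 
  "(\<Sum>k\<in>UNIV. c k *\<^sub>R (axis i (axis k 1) :: real^'n^'m)) $ r $ s = (if r = i then c s else 0)"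
  "(\<Sum>k\<in>UNIV. c' k *\<^sub>R (axis k (axis j 1) :: real^'n^'m)) $ r $ s = (if s = j then c' r else 0)"
  by (auto simp: axis_def if_distrib[where f="\<lambda>y. _ * y"] if_distrib[where f="\<lambda>y. y $ _"] sum.delta' cong: if_cong)

lemma lborel_left_transvection:
  fixes i j :: "'n::finite"
  assumes "i \<noteq> j"
  shows "distr lborel borel (\<lambda>g. transvection i j x ** g) = (lborel :: (real^'n^'n) measure)"
proof -
  have "(\<lambda>g. transvection i j x ** g) =
    (\<lambda>g :: real^'n^'n. g + x *\<^sub>R (\<Sum>k\<in>UNIV. (g \<bullet> axis j (axis k 1)) *\<^sub>R axis i (axis k 1)))"
    unfolding fun_eq_iff vec_eq_iff vector_add_component vector_scaleR_component sum_axis_axis_nth transvection_mult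
    by (auto simp: row_def)
  then show ?thesis
    using lborel_multi_shear[of UNIV "\<lambda>k. axis j (axis k 1) :: real^'n^'n" "\<lambda>k. axis i (axis k 1)" x] assms
    by (auto simp: axis_eq_axis image_subset_iff)
qed

lemma lborel_right_transvection:
  fixes i j :: "'n::finite"
  assumes "i \<noteq> j"
  shows "distr lborel borel (\<lambda>g. g ** transvection i j x) = (lborel :: (real^'n^'n) measure)"
proof -
  have "(\<lambda>g. g ** transvection i j x) =
    (\<lambda>g :: real^'n^'n. g + x *\<^sub>R (\<Sum>k\<in>UNIV. (g \<bullet> axis k (axis i 1)) *\<^sub>R axis k (axis j 1)))"
    unfolding fun_eq_iff vec_eq_iff vector_add_component vector_scaleR_component sum_axis_axis_nth mult_transvection
    by auto
  then show ?thesis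
    using lborel_multi_shear[of UNIV "\<lambda>k. axis k (axis i 1) :: real^'n^'n" "\<lambda>k. axis k (axis j 1)" x] assms
    by (auto simp: axis_eq_axis image_subset_iff)
qed

definition reflection_matrix :: "'n \<Rightarrow> real^'n^'n" where
  "reflection_matrix i = diag_matrix (\<lambda>r. if r = i then -1 else 1)"

lemma det_reflection_matrix [simp]: "det (reflection_matrix i) = -1"
  by (simp add: reflection_matrix_def det_diag_matrix prod.delta)

lemma reflection_matrix_squared [simp]: "reflection_matrix i ** reflection_matrix i = mat 1"
  by (simp add: reflection_matrix_def mult_diag_matrix) (simp add: diag_matrix_def mat_def vec_eq_iff)

lemma lborel_mult_reflection:
  fixes i :: "'n::finite"
  shows "distr lborel borel (\<lambda>g. reflection_matrix i ** g) = (lborel :: (real^'n^'n) measure)"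
    and "distr lborel borel (\<lambda>g. g ** reflection_matrix i) = (lborel :: (real^'n^'n) measure)"
proof -
  let ?c = "\<lambda>b :: real^'n^'n. if \<exists>k. b = axis i (axis k 1) then -1 else 1 :: real"
  have "(\<lambda>g. reflection_matrix i ** g) = (\<lambda>g. \<Sum>b\<in>Basis. (?c b * (g \<bullet> b)) *\<^sub>R b)"
    by (rule ext, rule euclidean_eqI)
      (auto simp: inner_sum_left inner_Basis sum.delta' if_distrib[where f="\<lambda>y. _ * y"] Basis_vec_def
        reflection_matrix_def diag_matrix_mult axis_eq_axis  cong: if_cong)
  then show "distr lborel borel (\<lambda>g. reflection_matrix i ** g) = (lborel :: (real^'n^'n) measure)"
    using lborel_sign_change[of ?c] by simp
  let ?c = "\<lambda>b :: real^'n^'n. if \<exists>k. b = axis k (axis i 1) then -1 else 1 :: real"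
  have "(\<lambda>g. g ** reflection_matrix i) = (\<lambda>g. \<Sum>b\<in>Basis. (?c b * (g \<bullet> b)) *\<^sub>R b)"
    by (rule ext, rule euclidean_eqI)
      (auto simp: inner_sum_left inner_Basis sum.delta' if_distrib[where f="\<lambda>y. _ * y"] Basis_vec_def
        reflection_matrix_def mult_diag_matrix axis_eq_axis  cong: if_cong)
  then show "distr lborel borel (\<lambda>g. g ** reflection_matrix i) = (lborel :: (real^'n^'n) measure)"
    using lborel_sign_change[of ?c] by simp
qed

lemma lborel_left_mult_SL:
  fixes h :: "real^'n^'n"
  assumes "det h = 1"
  shows "distr lborel borel (\<lambda>g. h ** g) = (lborel :: (real^'n^'n) measure)"
proof -
  have "transvection_product h" using assms by (simp add: transvection_product_iff_det_1)
  then show ?thesis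
  proof induction
    case one
    then show ?case using distr_id2[of "borel :: (real^'n^'n) measure" lborel] by (simp add: id_def)
  next
    case (step i j h x)
    have "distr lborel borel (\<lambda>g :: real^'n^'n. transvection i j x ** h ** g) =
       distr (distr lborel borel (\<lambda>g. h ** g)) borel (\<lambda>g. transvection i j x ** g)"
      by (subst distr_distr) (auto simp: o_def matrix_mul_assoc)
    then show ?case using step lborel_left_transvection[of i j x] by simp
  qed
qed

lemma lborel_right_mult_SL:
  fixes h :: "real^'n^'n"
  assumes "det h = 1"
  shows "distr lborel borel (\<lambda>g. g ** h) = (lborel :: (real^'n^'n) measure)"
proof -
  have "transvection_product h" using assms by (simp add: transvection_product_iff_det_1)
  then show ?thesis
  proof induction
    case one
    then show ?case using distr_id2[of "borel :: (real^'n^'n) measure" lborel] by (simp add: id_def)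
  next
    case (step i j h x)
    have "distr lborel borel (\<lambda>g :: real^'n^'n. g ** (transvection i j x ** h)) =
       distr (distr lborel borel (\<lambda>g. g ** transvection i j x)) borel (\<lambda>g. g ** h)"
      by (subst distr_distr) (auto simp: o_def matrix_mul_assoc)
    then show ?case using step lborel_right_transvection[of i j x] by simp
  qed
qed

text \<open>Determinant -1 is wanted for orthogonal maps that reverse orientation; a reflection
  reduces it to determinant 1.\<close>

lemma lborel_left_mult:
  fixes h :: "real^'n^'n"
  assumes "\<bar>det h\<bar> = 1"
  shows "distr lborel borel (\<lambda>g. h ** g) = (lborel :: (real^'n^'n) measure)"
proof (cases "det h = 1")
  case False
  fix i :: 'n
  have "distr lborel borel (\<lambda>g :: real^'n^'n. h ** g) =
      distr (distr lborel borel (\<lambda>g. reflection_matrix i ** h ** g)) borel (\<lambda>g. reflection_matrix i ** g)"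
    by (subst distr_distr) (auto simp: o_def matrix_mul_assoc)
  also have "\<dots> = lborel"
    using False assms by (subst lborel_left_mult_SL) (auto simp: det_mul lborel_mult_reflection)
  finally show ?thesis .
qed (simp add: lborel_left_mult_SL)

section \<open>Haar measure on the special linear group\<close>

lemma lborel_right_mult:
  fixes h :: "real^'n^'n"
  assumes "\<bar>det h\<bar> = 1"
  shows "distr lborel borel (\<lambda>g. g ** h) = (lborel :: (real^'n^'n) measure)"
proof (cases "det h = 1")
  case False
  fix i :: 'n
  have "distr lborel borel (\<lambda>g :: real^'n^'n. g ** h) =
      distr (distr lborel borel (\<lambda>g. g ** (h ** reflection_matrix i))) borel (\<lambda>g. g ** reflection_matrix i)"
    by (subst distr_distr) (auto simp: o_def simp flip: matrix_mul_assoc)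
  also have "\<dots> = lborel"
    using False assms by (subst lborel_right_mult_SL) (auto simp: det_mul lborel_mult_reflection)
  finally show ?thesis .
qed (simp add: lborel_right_mult_SL)

text \<open>Entry (k, l) is coordinate k of the solution of A x = e_l by Cramer's rule. For
  determinant 1 this is the inverse, given by polynomials in the entries: it is continuous on all
  matrices and integral on integral ones.\<close>

definition adjugate :: "real^'n^'n \<Rightarrow> real^'n^'n" where
  "adjugate A = (\<chi> k l. det (\<chi> i j. if j = k then axis l 1 $ i else A $ i $ j))"

lemma mult_adjugate:
  fixes A :: "real^'n^'n"
  assumes "det A = 1"
  shows "A ** adjugate A = mat 1" "adjugate A ** A = mat 1"
proof -
  have "A *v (\<chi> k. adjugate A $ k $ l) = axis l 1" for l
    using cramer[of A "\<chi> k. adjugate A $ k $ l" "axis l 1"] assms by (simp add: adjugate_def)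
  then have "(A *v (\<chi> k. adjugate A $ k $ l)) $ i = axis l 1 $ i" for l i
    by simp
  then show "A ** adjugate A = mat 1"
    by (simp add: vec_eq_iff matrix_vector_mult_def matrix_matrix_mult_def mat_def axis_def)
  then show "adjugate A ** A = mat 1"
    using matrix_left_right_inverse by blast
qed

lemma det_adjugate: "det A = 1 \<Longrightarrow> det (adjugate A) = 1"
  by (metis det_I det_mul mult_adjugate(1) mult_1)

lemma adjugate_mult:
  fixes A B :: "real^'n^'n"
  assumes "det A = 1" "det B = 1"
  shows "adjugate (A ** B) = adjugate B ** adjugate A"
proof -
  have "adjugate (A ** B) = (adjugate (A ** B) ** (A ** B)) ** (adjugate B ** adjugate A)"
    by (metis assms matrix_mul_assoc matrix_mul_rid mult_adjugate(1))
  then show ?thesis using assms by (simp add: mult_adjugate det_mul)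
qed

lemma adjugate_adjugate:
  assumes "det A = 1"
  shows "adjugate (adjugate A) = A"
  by (metis assms det_adjugate matrix_mul_assoc matrix_mul_lid matrix_mul_rid mult_adjugate(1))

lemma continuous_on_adjugate [continuous_intros]:
  fixes f :: "'a::topological_space \<Rightarrow> real^'n^'n"
  assumes "continuous_on S f"
  shows "continuous_on S (\<lambda>x. adjugate (f x))"
proof -
  have *: "continuous_on S (\<lambda>x. if b then c else f x $ i $ j)" for b c i j
    by (cases b) (auto intro!: continuous_intros assms)
  show ?thesis unfolding adjugate_def
    by (intro continuous_on_vec_lambda continuous_on_det *)
qed

lemma borel_measurable_adjugate [measurable]:
  fixes f :: "'a \<Rightarrow> real^'n^'n"
  assumes "f \<in> borel_measurable M"
  shows "(\<lambda>x. adjugate (f x)) \<in> borel_measurable M"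
  by (rule borel_measurable_continuous_on[OF _ assms]) (intro continuous_intros)

lemma SL_real_borel [measurable]: "SL_real \<in> sets borel"
proof -
  have "{g :: real^'n^'n. det g = 1} \<in> sets borel" by measurable
  then show ?thesis by (simp add: SL_real_def)
qed

section \<open>The cone construction of Haar measure\<close>

lemma det_scaleR: "det (c *\<^sub>R (g :: real^'n^'n)) = c ^ CARD('n) * det g"
proof -
  have "c *\<^sub>R g = diag_matrix (\<lambda>_. c) ** g" by (simp add: diag_matrix_mult vec_eq_iff)
  then show ?thesis by (simp add: det_mul det_diag_matrix)
qed

definition SL_cone :: "(real^'n^'n) set" where
  "SL_cone = {g. 1/2 < det g \<and> det g < 2}"

definition SL_proj :: "real^'n^'n \<Rightarrow> real^'n^'n" where
  "SL_proj g = (det g powr (- 1 / real CARD('n))) *\<^sub>R g"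

text \<open>A set of determinant-one matrices is measured by the Lebesgue volume of the cone over
  it, cut to determinants between 1/2 and 2. This shell is open and contains determinant 1, so that
  open sets meeting the group get positive mass; its determinants stay away from 0 and infinity, so
  that rescaling changes norms by a factor of at most 2 and balls get finite mass. The measure lives
  on all matrices and is carried by determinant 1.\<close>

definition SL_haar :: "(real^'n^'n) measure" where
  "SL_haar = distr (density lborel (indicator SL_cone)) borel SL_proj"

lemma open_SL_cone: "open (SL_cone :: (real^'n^'n) set)"
  unfolding SL_cone_def by (intro open_Collect_conj open_Collect_less continuous_intros)

lemma SL_cone_borel [measurable]: "SL_cone \<in> sets borel"
  by (rule borel_open[OF open_SL_cone])

lemma SL_proj_measurable [measurable]: "SL_proj \<in> borel_measurable borel"
  unfolding SL_proj_def[abs_def] by measurable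

lemma continuous_on_SL_proj: "continuous_on SL_cone SL_proj"
  unfolding SL_proj_def by (intro continuous_intros) (auto simp: SL_cone_def)

lemma sets_SL_haar [simp, measurable_cong]: "sets SL_haar = sets borel"
  by (simp add: SL_haar_def)

lemma space_SL_haar [simp]: "space SL_haar = UNIV"
  by (simp add: SL_haar_def)

lemma det_SL_proj: "det g > 0 \<Longrightarrow> det (SL_proj g) = 1"
  by (simp add: SL_proj_def det_scaleR powr_power flip: powr_add)

lemma SL_proj_SL: "det g = 1 \<Longrightarrow> SL_proj g = g"
  by (simp add: SL_proj_def)

lemma SL_proj_mult:
  assumes "det h * det k = 1"
  shows "SL_proj (h ** g ** k) = h ** SL_proj g ** k"
proof -
  have "det (h ** g ** k) = det g * (det h * det k)" by (simp add: det_mul)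
  then show ?thesis
    using assms by (simp add: SL_proj_def vec_eq_iff matrix_matrix_mult_def sum_distrib_left mult_ac)
qed

lemma nn_integral_SL_haar:
  fixes f :: "real^'n^'n \<Rightarrow> ennreal"
  assumes [measurable]: "f \<in> borel_measurable borel"
  shows "(\<integral>\<^sup>+x. f x \<partial>SL_haar) = (\<integral>\<^sup>+g. indicator SL_cone g * f (SL_proj g) \<partial>lborel)"
  unfolding SL_haar_def by (simp add: nn_integral_distr nn_integral_density)

lemma emeasure_SL_haar:
  assumes [measurable]: "E \<in> sets borel"
  shows "emeasure SL_haar E = emeasure lborel (SL_cone \<inter> SL_proj -` E)"
proof -
  have "emeasure SL_haar E = (\<integral>\<^sup>+x. indicator E x \<partial>SL_haar)" by simp
  also have "\<dots> = (\<integral>\<^sup>+g. indicator SL_cone g * indicator E (SL_proj g) \<partial>lborel)"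
    by (rule nn_integral_SL_haar) simp
  also have "\<dots> = (\<integral>\<^sup>+g. indicator (SL_cone \<inter> SL_proj -` E) g \<partial>lborel)"
    by (intro nn_integral_cong) (simp add: indicator_def)
  also have "\<dots> = emeasure lborel (SL_cone \<inter> SL_proj -` E)"
    using measurable_sets[OF SL_proj_measurable, of E] by (intro nn_integral_indicator) auto
  finally show ?thesis .
qed

text \<open>Since det h det k = 1, the map preserves the shell and commutes with
  \<open>SL_proj\<close>, so invariance of Lebesgue measure passes down. Pairs with both
  determinants -1 are allowed; they will represent reflections acting on lattices.\<close>

lemma nn_integral_SL_haar_mult:
  fixes f :: "real^'n^'n \<Rightarrow> ennreal"
  assumes [measurable]: "f \<in> borel_measurable borel"
    and d: "\<bar>det h\<bar> = 1" "det h * det k = 1"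
  shows "(\<integral>\<^sup>+x. f (h ** x ** k) \<partial>SL_haar) = (\<integral>\<^sup>+x. f x \<partial>SL_haar)"
proof -
  have "det k \<noteq> 0" "\<bar>det k\<bar> = 1" using d by (auto simp: abs_if split: if_splits)
  have inv: "distr lborel borel (\<lambda>g :: real^'n^'n. h ** g ** k) = lborel"
  proof -
    have "distr lborel borel (\<lambda>g :: real^'n^'n. h ** g ** k) =
      distr (distr lborel borel (\<lambda>g. h ** g)) borel (\<lambda>g. g ** k)"
      by (subst distr_distr) (auto simp: o_def)
    then show ?thesis using d \<open>\<bar>det k\<bar> = 1\<close> by (simp add: lborel_left_mult lborel_right_mult)
  qed
  have "(\<integral>\<^sup>+x. f x \<partial>SL_haar) = (\<integral>\<^sup>+g. indicator SL_cone g * f (SL_proj g) \<partial>distr lborel borel (\<lambda>g. h ** g ** k))"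
    by (simp add: nn_integral_SL_haar inv)
  also have "\<dots> = (\<integral>\<^sup>+g. indicator SL_cone (h ** g ** k) * f (SL_proj (h ** g ** k)) \<partial>lborel)"
    by (subst nn_integral_distr) auto
  also have "\<dots> = (\<integral>\<^sup>+g. indicator SL_cone g * f (h ** SL_proj g ** k) \<partial>lborel)"
  proof (rule nn_integral_cong)
    fix g :: "real^'n^'n"
    have "det (h ** g ** k) = det g * (det h * det k)" by (simp add: det_mul)
    then show "indicator SL_cone (h ** g ** k) * f (SL_proj (h ** g ** k)) =
        indicator SL_cone g * f (h ** SL_proj g ** k)"
      using d by (simp add: SL_proj_mult SL_cone_def indicator_def)
  qed
  also have "\<dots> = (\<integral>\<^sup>+x. f (h ** x ** k) \<partial>SL_haar)"
    by (simp add: nn_integral_SL_haar)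
  finally show ?thesis ..
qed

lemma nn_integral_SL_haar_left:
  fixes f :: "real^'n^'n \<Rightarrow> ennreal"
  assumes "f \<in> borel_measurable borel" "det h = 1"
  shows "(\<integral>\<^sup>+x. f (h ** x) \<partial>SL_haar) = (\<integral>\<^sup>+x. f x \<partial>SL_haar)"
  using nn_integral_SL_haar_mult[of f h "mat 1"] assms by simp

lemma nn_integral_SL_haar_right:
  fixes f :: "real^'n^'n \<Rightarrow> ennreal"
  assumes "f \<in> borel_measurable borel" "det k = 1"
  shows "(\<integral>\<^sup>+x. f (x ** k) \<partial>SL_haar) = (\<integral>\<^sup>+x. f x \<partial>SL_haar)"
  using nn_integral_SL_haar_mult[of f "mat 1" k] assms by simp

lemma AE_SL_haar_det: "AE x in (SL_haar :: (real^'n^'n) measure). det x = 1"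
proof (rule AE_I)
  show "{x \<in> space SL_haar. \<not> det x = 1} \<subseteq> (- SL_real :: (real^'n^'n) set)" by (auto simp: SL_real_def)
  have "SL_cone \<inter> SL_proj -` (- SL_real) = ({} :: (real^'n^'n) set)"
    by (auto simp: SL_real_def SL_cone_def det_SL_proj)
  then show "emeasure SL_haar (- SL_real :: (real^'n^'n) set) = 0"
    by (subst emeasure_SL_haar) auto
qed auto

lemma norm_SL_proj:
  assumes "g \<in> SL_cone"
  shows "norm g \<le> 2 * norm (SL_proj g)" "norm (SL_proj g) \<le> 2 * norm g"
proof -
  let ?p = "det g powr (- 1 / real CARD('a))"
  have d: "1/2 < det g" "det g < 2" using assms by (auto simp: SL_cone_def)
  have n: "1 \<le> real CARD('a)" by (simp add: Suc_leI)
  have "1/2 \<le> ?p"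
  proof -
    have "1/2 = 2 powr (-1 :: real)" by (simp add: powr_minus)
    also have "\<dots> \<le> 2 powr (-1 / real CARD('a))" using n by (intro powr_mono) (auto simp: field_simps)
    also have "\<dots> \<le> ?p" using d by (intro powr_mono2') auto
    finally show ?thesis .
  qed
  moreover have "?p \<le> 2"
  proof -
    have "?p \<le> (1/2) powr (- 1 / real CARD('a))" using d by (intro powr_mono2') auto
    also have "\<dots> = 2 powr (1 / real CARD('a))" by (simp add: powr_minus powr_divide)
    also have "\<dots> \<le> 2 powr 1" using n by (intro powr_mono) (auto simp: field_simps)
    finally show ?thesis by simp
  qed
  moreover have "norm (SL_proj g) = ?p * norm g" by (simp add: SL_proj_def)
  ultimately show "norm g \<le> 2 * norm (SL_proj g)" "norm (SL_proj g) \<le> 2 * norm g"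
    using mult_right_mono[of "1/2" ?p "norm g"] mult_right_mono[of ?p 2 "norm g"] by auto
qed

lemma emeasure_SL_haar_cball_finite:
  "emeasure SL_haar (cball (0 :: real^'n^'n) R) < \<infinity>"
proof -
  have "SL_cone \<inter> SL_proj -` cball 0 R \<subseteq> cball (0 :: real^'n^'n) (2 * R)"
    using norm_SL_proj(1) by (fastforce simp: dist_norm)
  then have "emeasure SL_haar (cball (0 :: real^'n^'n) R) \<le> emeasure lborel (cball (0 :: real^'n^'n) (2 * R))"
    by (subst emeasure_SL_haar) (auto intro!: emeasure_mono simp del: emeasure_lborel_cbox)
  then show ?thesis using emeasure_lborel_cball_finite by (metis order_le_less_trans)
qed

lemma sigma_finite_if_cball_finite:
  fixes M :: "'a::real_normed_vector measure"
  assumes [simp]: "sets M = sets borel" "space M = UNIV" and "\<And>R. emeasure M (cball 0 R) < \<infinity>"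
  shows "sigma_finite_measure M"
proof
  show "\<exists>A. countable A \<and> A \<subseteq> sets M \<and> \<Union>A = space M \<and> (\<forall>a\<in>A. emeasure M a \<noteq> \<infinity>)"
  proof (intro exI[of _ "range (\<lambda>n::nat. cball 0 (real n))"] conjI)
    show "\<Union> (range (\<lambda>n::nat. cball 0 (real n))) = space M"
      by (auto simp: real_arch_simple)
  qed (use assms(3) in \<open>auto simp: less_top\<close>)
qed

lemma sigma_finite_SL_haar: "sigma_finite_measure SL_haar"
  by (rule sigma_finite_if_cball_finite) (use emeasure_SL_haar_cball_finite in auto)

lemma emeasure_lborel_open_pos:
  fixes S :: "'a::euclidean_space set"
  assumes "open S" "S \<noteq> {}"
  shows "emeasure lborel S > 0"
proof -
  have "\<not> negligible S" using assms by (rule open_not_negligible)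
  then show ?thesis using assms(1)
    by (auto simp: negligible_iff_emeasure0 zero_less_iff_neq_zero)
qed

lemma emeasure_SL_haar_open_pos:
  assumes "open S" "x \<in> S" "det x = 1"
  shows "emeasure SL_haar S > 0"
proof -
  have "open (SL_cone \<inter> SL_proj -` S)"
    using continuous_on_open_vimage[OF open_SL_cone] continuous_on_SL_proj assms(1)
    by (auto simp: Int_commute)
  moreover have "x \<in> SL_cone \<inter> SL_proj -` S"
    using assms by (simp add: SL_cone_def SL_proj_SL)
  ultimately show ?thesis
    using assms(1) by (subst emeasure_SL_haar) (auto intro!: emeasure_lborel_open_pos)
qed

section \<open>Uniqueness of Haar measure\<close>

lemma haar_measure_SL_space:
  assumes "haar_measure_SL m"
  shows "sets m = sets (restrict_space borel SL_real)" "space m = SL_real" "(\<lambda>x. x) \<in> measurable m borel"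
proof -
  show sm: "sets m = sets (restrict_space borel SL_real)" using assms by (simp add: haar_measure_SL_def)
  show "space m = SL_real" using sets_eq_imp_space_eq[OF sm] by (simp add: space_restrict_space)
  show "(\<lambda>x. x) \<in> measurable m borel"
    by (simp add: measurable_cong_sets[OF sm] measurable_restrict_space1)
qed

lemma nn_integral_haar_left:
  fixes f :: "real^'n^'n \<Rightarrow> ennreal"
  assumes m: "haar_measure_SL m" and f [measurable]: "f \<in> borel_measurable borel" and h: "det h = 1"
  shows "(\<integral>\<^sup>+x. f (h ** x) \<partial>m) = (\<integral>\<^sup>+x. f x \<partial>m)"
proof -
  note sm = haar_measure_SL_space(1)[OF m] and sp = haar_measure_SL_space(2)[OF m]
    and id [measurable] = haar_measure_SL_space(3)[OF m]
  have inv: "\<forall>g\<in>SL_real. \<forall>E\<in>sets m. emeasure m ((\<lambda>h. g ** h) ` E) = emeasure m E"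
    using m by (simp add: haar_measure_SL_def)
  have hm [measurable]: "(\<lambda>x. h ** x) \<in> measurable m borel" by measurable
  have "distr m borel (\<lambda>x. h ** x) = distr m borel (\<lambda>x. x)"
  proof (rule measure_eqI)
    fix E :: "(real^'n^'n) set" assume "E \<in> sets (distr m borel (\<lambda>x. h ** x))"
    then have E [measurable]: "E \<in> sets borel" by simp
    let ?E = "(\<lambda>x. h ** x) -` E \<inter> space m"
    have "(\<lambda>x. h ** x) ` ?E = E \<inter> SL_real"
    proof safe
      fix y assume y: "y \<in> E" "y \<in> SL_real"
      then have "adjugate h ** y \<in> ?E"
        using h by (simp add: sp SL_real_def det_mul det_adjugate matrix_mul_assoc mult_adjugate)
      moreover have "y = h ** (adjugate h ** y)"
        using h by (simp add: matrix_mul_assoc mult_adjugate)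
      ultimately show "y \<in> (\<lambda>x. h ** x) ` ?E" by blast
    qed (auto simp: sp SL_real_def det_mul h)
    moreover have "?E \<in> sets m" by measurable
    ultimately have "emeasure m ?E = emeasure m (E \<inter> SL_real)"
      using inv[rule_format, of h ?E] h by (simp add: SL_real_def)
    then show "emeasure (distr m borel (\<lambda>x. h ** x)) E = emeasure (distr m borel (\<lambda>x. x)) E"
      by (simp add: emeasure_distr sp)
  qed simp
  then have "(\<integral>\<^sup>+x. f x \<partial>distr m borel (\<lambda>x. h ** x)) = (\<integral>\<^sup>+x. f x \<partial>distr m borel (\<lambda>x. x))" by simp
  then show ?thesis by (simp add: nn_integral_distr)
qed

lemma compact_SL_inverse_bounded:
  "compact {x \<in> SL_real. norm x \<le> R \<and> norm (adjugate x) \<le> R}"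
proof (rule compact_eq_bounded_closed[THEN iffD2], intro conjI)
  show "bounded {x \<in> SL_real. norm x \<le> R \<and> norm (adjugate x) \<le> R}"
    by (rule boundedI[of _ R]) auto
  show "closed {x \<in> SL_real. norm x \<le> R \<and> norm (adjugate x) \<le> R}"
    unfolding SL_real_def mem_Collect_eq
    by (intro closed_Collect_conj closed_Collect_le closed_Collect_eq continuous_intros)
qed

text \<open>The double integral of 1_K(x) H(y x), with y under \<open>SL_haar\<close> and x under
  \<open>m\<close>, is evaluated in two ways. Right invariance of \<open>SL_haar\<close> gives m(K)
  times the integral of H under \<open>SL_haar\<close>. Replacing x by y^{-1} x (left invariance of
  \<open>m\<close>) and then y by x y (left invariance of \<open>SL_haar\<close>) turns 1_K into
  1_K(y^{-1}) = 1_K(y), which gives \<open>SL_haar\<close>(K) times the integral of H under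
  \<open>m\<close>. For this K must be symmetric, which is why both the matrix and its inverse are
  bounded in it.\<close>

lemma haar_measure_SL_unique:
  fixes m :: "(real^'n^'n) measure"
  assumes m: "haar_measure_SL m"
  obtains C :: ennreal where "0 < C" "C < \<infinity>"
    "\<And>E. E \<in> sets borel \<Longrightarrow> E \<subseteq> SL_real \<Longrightarrow> emeasure m E = C * emeasure SL_haar E"
proof -
  note sm = haar_measure_SL_space(1)[OF m] and sp = haar_measure_SL_space(2)[OF m]
    and id [measurable] = haar_measure_SL_space(3)[OF m]
  define K :: "real \<Rightarrow> (real^'n^'n) set" where "K R = {x \<in> SL_real. norm x \<le> R \<and> norm (adjugate x) \<le> R}" for R
  have K: "compact (K R)" "K R \<subseteq> SL_real" for R
    unfolding K_def using compact_SL_inverse_bounded by auto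
  have K_borel [measurable]: "K R \<in> sets borel" for R
    using K(1) by (simp add: compact_imp_closed)
  interpret N: sigma_finite_measure "SL_haar :: (real^'n^'n) measure" by (rule sigma_finite_SL_haar)
  interpret M: sigma_finite_measure m
  proof
    show "\<exists>A. countable A \<and> A \<subseteq> sets m \<and> \<Union>A = space m \<and> (\<forall>a\<in>A. emeasure m a \<noteq> \<infinity>)"
    proof (intro exI[of _ "range (\<lambda>n::nat. K (real n))"] conjI)
      show "range (\<lambda>n::nat. K (real n)) \<subseteq> sets m"
        using K(2) by (simp add: sm sets_restrict_space_iff image_subset_iff)
      show "\<Union> (range (\<lambda>n::nat. K (real n))) = space m"
      proof (intro antisym subsetI)
        fix x assume "x \<in> space m"
        obtain n :: nat where "max (norm x) (norm (adjugate x)) \<le> real n" using real_arch_simple by blast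
        then show "x \<in> \<Union> (range (\<lambda>n::nat. K (real n)))"
          using \<open>x \<in> space m\<close> by (auto simp: K_def sp)
      qed (auto simp: K_def sp)
      show "\<forall>a\<in>range (\<lambda>n::nat. K (real n)). emeasure m a \<noteq> \<infinity>"
        using m K by (auto simp: haar_measure_SL_def less_top)
    qed simp
  qed
  interpret P: pair_sigma_finite "SL_haar :: (real^'n^'n) measure" m ..
  \<comment> \<open>Large enough that the identity satisfies both norm bounds strictly; then
    \<open>K R\<close> contains a neighbourhood of it in the group and has positive mass.\<close>
  define R where "R = norm (mat 1 :: real^'n^'n) + norm (adjugate (mat 1 :: real^'n^'n)) + 1"
  let ?f = "indicator (K R) :: real^'n^'n \<Rightarrow> ennreal"
  define c1 where "c1 = emeasure m (K R)"
  define c2 where "c2 = emeasure SL_haar (K R)"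
  have Km: "K R \<in> sets m" using K(2) by (simp add: sm sets_restrict_space_iff)
  have det_m: "AE x in m. det x = 1" by (intro AE_I2) (simp add: sp SL_real_def)
  have key: "c1 * (\<integral>\<^sup>+y. H y \<partial>SL_haar) = c2 * (\<integral>\<^sup>+x. H x \<partial>m)"
    if H [measurable]: "H \<in> borel_measurable borel" for H :: "real^'n^'n \<Rightarrow> ennreal"
  proof -
    have Hm [measurable]: "H \<in> borel_measurable m"
      using measurable_compose[OF id H] by simp
    have "c1 * (\<integral>\<^sup>+y. H y \<partial>SL_haar) = (\<integral>\<^sup>+x. ?f x * (\<integral>\<^sup>+y. H y \<partial>SL_haar) \<partial>m)"
      using Km by (simp add: nn_integral_multc c1_def)
    also have "\<dots> = (\<integral>\<^sup>+x. (\<integral>\<^sup>+y. ?f x * H (y ** x) \<partial>SL_haar) \<partial>m)"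
    proof (rule nn_integral_cong_AE, rule AE_mp[OF det_m], intro AE_I2 impI)
      fix x :: "real^'n^'n" assume "det x = 1"
      moreover have "(\<lambda>y. y ** x) \<in> measurable (SL_haar :: (real^'n^'n) measure) borel"
        by (intro borel_measurable_matrix_mult borel_measurable_const measurable_ident_sets) simp
      then have "(\<lambda>y. H (y ** x)) \<in> borel_measurable SL_haar"
        by (rule measurable_compose[OF _ H])
      ultimately show "?f x * (\<integral>\<^sup>+y. H y \<partial>SL_haar) = (\<integral>\<^sup>+y. ?f x * H (y ** x) \<partial>SL_haar)"
        by (simp add: nn_integral_cmult nn_integral_SL_haar_right[OF H])
    qed
    also have "\<dots> = (\<integral>\<^sup>+y. (\<integral>\<^sup>+x. ?f x * H (y ** x) \<partial>m) \<partial>SL_haar)"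
      by (rule P.Fubini'[where f="\<lambda>y x. ?f x * H (y ** x)"]) measurable
    also have "\<dots> = (\<integral>\<^sup>+y. (\<integral>\<^sup>+x. ?f (adjugate y ** x) * H x \<partial>m) \<partial>SL_haar)"
    proof (rule nn_integral_cong_AE, rule AE_mp[OF AE_SL_haar_det], intro AE_I2 impI)
      fix y :: "real^'n^'n" assume y: "det y = 1"
      have "(\<integral>\<^sup>+x. ?f (adjugate y ** x) * H x \<partial>m) = (\<integral>\<^sup>+x. ?f (adjugate y ** (y ** x)) * H (y ** x) \<partial>m)"
        by (rule nn_integral_haar_left[OF m _ y, symmetric]) measurable
      then show "(\<integral>\<^sup>+x. ?f x * H (y ** x) \<partial>m) = (\<integral>\<^sup>+x. ?f (adjugate y ** x) * H x \<partial>m)"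
        using y by (simp add: matrix_mul_assoc mult_adjugate)
    qed
    also have "\<dots> = (\<integral>\<^sup>+x. (\<integral>\<^sup>+y. ?f (adjugate y ** x) * H x \<partial>SL_haar) \<partial>m)"
      by (rule P.Fubini'[symmetric, where f="\<lambda>y x. ?f (adjugate y ** x) * H x"]) measurable
    also have "\<dots> = (\<integral>\<^sup>+x. c2 * H x \<partial>m)"
    proof (rule nn_integral_cong_AE, rule AE_mp[OF det_m], intro AE_I2 impI)
      fix x :: "real^'n^'n" assume x: "det x = 1"
      have "(\<integral>\<^sup>+y. ?f (adjugate y ** x) \<partial>SL_haar) = (\<integral>\<^sup>+y. ?f (adjugate (x ** y) ** x) \<partial>SL_haar)"
        by (rule nn_integral_SL_haar_left[OF _ x, symmetric]) measurable
      also have "\<dots> = (\<integral>\<^sup>+y. ?f y \<partial>SL_haar)"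
      proof (rule nn_integral_cong_AE, rule AE_mp[OF AE_SL_haar_det], intro AE_I2 impI)
        fix y :: "real^'n^'n" assume y: "det y = 1"
        then have "adjugate (x ** y) ** x = adjugate y"
          using x by (simp add: adjugate_mult mult_adjugate flip: matrix_mul_assoc)
        then show "?f (adjugate (x ** y) ** x) = ?f y"
          using y by (simp add: K_def indicator_def SL_real_def adjugate_adjugate det_adjugate conj_commute)
      qed
      also have "\<dots> = c2" by (simp add: c2_def)
      finally have c2: "(\<integral>\<^sup>+y. ?f (adjugate y ** x) \<partial>SL_haar) = c2" .
      have "(\<lambda>y. adjugate y ** x) \<in> measurable (SL_haar :: (real^'n^'n) measure) borel"
        by (intro borel_measurable_matrix_mult borel_measurable_const borel_measurable_adjugate measurable_ident_sets) simp
      then have "(\<lambda>y. ?f (adjugate y ** x)) \<in> borel_measurable SL_haar"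
        by (rule measurable_compose[OF _ borel_measurable_indicator[OF K_borel]])
      then show "(\<integral>\<^sup>+y. ?f (adjugate y ** x) * H x \<partial>SL_haar) = c2 * H x"
        by (simp add: nn_integral_multc c2)
    qed
    also have "\<dots> = c2 * (\<integral>\<^sup>+x. H x \<partial>m)" by (simp add: nn_integral_cmult)
    finally show ?thesis .
  qed
  have c1_fin: "c1 < \<infinity>" using m K by (auto simp: c1_def haar_measure_SL_def)
  have c2_fin: "c2 < \<infinity>"
  proof -
    have "c2 \<le> emeasure SL_haar (cball (0 :: real^'n^'n) R)"
      unfolding c2_def by (rule emeasure_mono) (auto simp: K_def)
    then show ?thesis using emeasure_SL_haar_cball_finite by (rule order_le_less_trans)
  qed
  have c2_pos: "0 < c2"
  proof -
    let ?O = "{x :: real^'n^'n. norm x < R \<and> norm (adjugate x) < R}"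
    have op: "open ?O" by (intro open_Collect_conj open_Collect_less continuous_intros)
    have "mat 1 \<in> ?O" unfolding R_def
      by (auto intro: add_nonneg_pos)
    then have "0 < emeasure SL_haar ?O" using op by (intro emeasure_SL_haar_open_pos[of _ "mat 1"]) auto
    also have "\<dots> = emeasure SL_haar (?O \<inter> SL_real)"
      using AE_SL_haar_det op by (intro emeasure_eq_AE) (auto simp: SL_real_def)
    also have "\<dots> \<le> c2" unfolding c2_def by (rule emeasure_mono) (auto simp: K_def)
    finally show ?thesis .
  qed
  have c1_pos: "0 < c1"
  proof (rule ccontr)
    assume "\<not> 0 < c1"
    then have "c2 * (\<integral>\<^sup>+x. 1 \<partial>m) = 0" using key[of "\<lambda>_. 1"] by (simp del: nn_integral_const)
    then have "emeasure m (space m) = 0" using c2_pos by (auto simp: sp)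
    then show False using m by (simp add: sp haar_measure_SL_def)
  qed
  show ?thesis
  proof
    show "0 < c1 / c2" using c1_pos c2_fin by (simp add: ennreal_zero_less_divide)
    show "c1 / c2 < \<infinity>" using c1_fin c2_pos by (metis ennreal_divide_eq_top_iff infinity_ennreal_def less_irrefl top.not_eq_extremum)
    fix E :: "(real^'n^'n) set" assume E [measurable]: "E \<in> sets borel" and "E \<subseteq> SL_real"
    then have "E \<in> sets m" by (simp add: sm sets_restrict_space_iff)
    then have eq: "c1 * emeasure SL_haar E = c2 * emeasure m E" using key[of "indicator E"] by simp
    have "emeasure m E = c2 * emeasure m E / c2"
      using c2_pos c2_fin by (simp add: mult.commute[of c2] ennreal_mult_divide_eq less_top)
    also have "\<dots> = c1 / c2 * emeasure SL_haar E"
      unfolding eq[symmetric] by (simp add: divide_ennreal_def mult_ac)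
    finally show "emeasure m E = c1 / c2 * emeasure SL_haar E" .
  qed
qed

section \<open>The space of lattices\<close>

lemma SL_int_subset: "\<gamma> \<in> SL_int \<Longrightarrow> det \<gamma> = 1"
  by (simp add: SL_int_def)

lemma SL_int_adjugate:
  assumes "\<gamma> \<in> SL_int"
  shows "adjugate \<gamma> \<in> SL_int"
proof -
  have "of_int (sign p) \<in> (\<int> :: real set)" for p :: "'a \<Rightarrow> 'a" by simp
  then have "adjugate \<gamma> $ i $ j \<in> \<int>" for i j
    using assms
    by (auto simp: adjugate_def det_def SL_int_def axis_def intro!: Ints_sum Ints_mult Ints_prod)
  then show ?thesis using assms det_adjugate[of \<gamma>] by (auto simp: SL_int_def)
qed

lemma countable_int_vectors: "countable (int_vectors :: (real^'n) set)"
proof (rule countable_subset)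
  show "int_vectors \<subseteq> range (\<lambda>f :: 'n \<Rightarrow> int. (\<chi> i. of_int (f i)) :: real^'n)"
  proof
    fix v :: "real^'n" assume "v \<in> int_vectors"
    then have "\<forall>i. \<exists>k. v $ i = of_int k" by (auto simp: int_vectors_def elim!: Ints_cases)
    then obtain f where "\<And>i. v $ i = of_int (f i)" by metis
    then have "v = (\<chi> i. of_int (f i))" by (simp add: vec_eq_iff)
    then show "v \<in> range (\<lambda>f :: 'n \<Rightarrow> int. (\<chi> i. of_int (f i)) :: real^'n)" by blast
  qed
qed simp

lemma countable_SL_int: "countable (SL_int :: (real^'n^'n) set)"
proof (rule countable_subset)
  show "SL_int \<subseteq> range (\<lambda>f :: 'n \<Rightarrow> 'n \<Rightarrow> int. (\<chi> i j. of_int (f i j)) :: real^'n^'n)"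
  proof
    fix v :: "real^'n^'n" assume "v \<in> SL_int"
    then have "\<forall>i j. \<exists>k. v $ i $ j = of_int k" by (auto simp: SL_int_def elim!: Ints_cases)
    then obtain f where "\<And>i j. v $ i $ j = of_int (f i j)" by metis
    then have "v = (\<chi> i j. of_int (f i j))" by (simp add: vec_eq_iff)
    then show "v \<in> range (\<lambda>f :: 'n \<Rightarrow> 'n \<Rightarrow> int. (\<chi> i j. of_int (f i j)) :: real^'n^'n)" by blast
  qed
qed simp

lemma lattice_of_left_mult: "lattice_of (h ** g) = (\<lambda>v. h *v v) ` lattice_of g"
  by (auto simp: lattice_of_def image_image matrix_vector_mul_assoc)

lemma lattice_of_right_mult:
  fixes k k' :: "real^'n^'n"
  assumes "k ** k' = mat 1" "\<And>i j. k $ i $ j \<in> \<int>" "\<And>i j. k' $ i $ j \<in> \<int>"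
  shows "lattice_of (g ** k) = lattice_of g"
proof -
  have *: "l *v v \<in> int_vectors" if "v \<in> int_vectors" "\<And>i j. l $ i $ j \<in> \<int>" for l :: "real^'n^'n" and v
    using that by (auto simp: int_vectors_def matrix_vector_mult_def intro!: Ints_sum Ints_mult)
  have "(\<lambda>v. k *v v) ` int_vectors = int_vectors"
  proof (intro antisym subsetI)
    fix v :: "real^'n" assume "v \<in> int_vectors"
    then have "k' *v v \<in> int_vectors" "v = k *v (k' *v v)"
      using assms * by (auto simp: matrix_vector_mul_assoc)
    then show "v \<in> (\<lambda>v. k *v v) ` int_vectors" by blast
  qed (use assms * in auto)
  then show ?thesis
    by (metis (no_types) lattice_of_def lattice_of_left_mult)
qed

lemma lattice_of_mult_SL_int:
  assumes "\<gamma> \<in> SL_int"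
  shows "lattice_of (g ** \<gamma>) = lattice_of g"
  using SL_int_adjugate[OF assms] assms
  by (intro lattice_of_right_mult[of \<gamma> "adjugate \<gamma>"]) (auto simp: SL_int_def mult_adjugate)

lemma lattice_of_mult_reflection: "lattice_of (g ** reflection_matrix i) = lattice_of g"
  by (rule lattice_of_right_mult[of _ "reflection_matrix i"], simp)
    (simp_all add: reflection_matrix_def diag_matrix_def)

text \<open>The value off the special linear group is irrelevant; it only makes the map total.\<close>

definition lattice_map :: "real^'n^'n \<Rightarrow> (real^'n) set" where
  "lattice_map g = (if g \<in> SL_real then lattice_of g else lattice_of (mat 1))"

lemma lattice_map_SL [simp]: "det g = 1 \<Longrightarrow> lattice_map g = lattice_of g"
  by (simp add: lattice_map_def SL_real_def)

section \<open>Fundamental domains and unfolding\<close>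

lemma fundamental_domain_SL_borel:
  "fundamental_domain_SL F \<Longrightarrow> F \<in> sets borel" "fundamental_domain_SL F \<Longrightarrow> F \<subseteq> SL_real"
  by (auto simp: fundamental_domain_SL_def sets_restrict_space_iff)

lemma fundamental_domain_SL_E:
  assumes "fundamental_domain_SL F" "det x = 1"
  obtains \<gamma>0 where "\<And>\<gamma>. \<gamma> \<in> SL_int \<and> x ** \<gamma> \<in> F \<longleftrightarrow> \<gamma> = \<gamma>0"
proof -
  have "\<exists>!\<gamma>. \<gamma> \<in> SL_int \<and> x ** \<gamma> \<in> F"
    using assms by (simp add: fundamental_domain_SL_def SL_real_def)
  then show ?thesis using that by (metis (full_types))
qed

text \<open>Right invariance moves the translation by each element of \<open>SL_int\<close> from f
  to the domain, and every determinant-one matrix lies in exactly one translate of F. Countability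
  of \<open>SL_int\<close> permits the exchange of sum and integral.\<close>

lemma fundamental_domain_unfold:
  fixes f :: "real^'n^'n \<Rightarrow> ennreal"
  assumes F: "fundamental_domain_SL F" and f [measurable]: "f \<in> borel_measurable borel"
  shows "(\<integral>\<^sup>+x. indicator F x * (\<integral>\<^sup>+\<gamma>. f (x ** \<gamma>) \<partial>count_space SL_int) \<partial>SL_haar) = (\<integral>\<^sup>+x. f x \<partial>SL_haar)"
proof -
  note [measurable] = fundamental_domain_SL_borel(1)[OF F]
  have "(\<integral>\<^sup>+x. indicator F x * (\<integral>\<^sup>+\<gamma>. f (x ** \<gamma>) \<partial>count_space SL_int) \<partial>SL_haar) =
      (\<integral>\<^sup>+x. (\<integral>\<^sup>+\<gamma>. indicator F x * f (x ** \<gamma>) \<partial>count_space SL_int) \<partial>SL_haar)"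
    by (simp add: nn_integral_cmult)
  also have "\<dots> = (\<integral>\<^sup>+\<gamma>. (\<integral>\<^sup>+x. indicator F x * f (x ** \<gamma>) \<partial>SL_haar) \<partial>count_space SL_int)"
    by (intro nn_integral_count_space_nn_integral countable_SL_int) measurable
  also have "\<dots> = (\<integral>\<^sup>+\<gamma>. (\<integral>\<^sup>+x. indicator F (x ** adjugate \<gamma>) * f x \<partial>SL_haar) \<partial>count_space SL_int)"
  proof (rule nn_integral_cong)
    fix \<gamma> :: "real^'n^'n" assume "\<gamma> \<in> space (count_space SL_int)"
    then have g: "det \<gamma> = 1" by (simp add: SL_int_subset)
    have "(\<integral>\<^sup>+x. indicator F (x ** adjugate \<gamma>) * f x \<partial>SL_haar) =
        (\<integral>\<^sup>+x. indicator F (x ** \<gamma> ** adjugate \<gamma>) * f (x ** \<gamma>) \<partial>SL_haar)"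
      by (rule nn_integral_SL_haar_right[OF _ g, symmetric]) measurable
    then show "(\<integral>\<^sup>+x. indicator F x * f (x ** \<gamma>) \<partial>SL_haar) = (\<integral>\<^sup>+x. indicator F (x ** adjugate \<gamma>) * f x \<partial>SL_haar)"
      using g by (simp add: mult_adjugate flip: matrix_mul_assoc)
  qed
  also have "\<dots> = (\<integral>\<^sup>+x. (\<integral>\<^sup>+\<gamma>. indicator F (x ** adjugate \<gamma>) * f x \<partial>count_space SL_int) \<partial>SL_haar)"
    by (intro nn_integral_count_space_nn_integral[symmetric] countable_SL_int) measurable
  also have "\<dots> = (\<integral>\<^sup>+x. f x \<partial>SL_haar)"
  proof (rule nn_integral_cong_AE, rule AE_mp[OF AE_SL_haar_det], intro AE_I2 impI)
    fix x :: "real^'n^'n" assume x: "det x = 1"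
    have bij: "bij_betw adjugate SL_int (SL_int :: (real^'n^'n) set)"
      by (rule bij_betwI[where g=adjugate]) (auto simp: SL_int_adjugate adjugate_adjugate SL_int_subset)
    obtain \<gamma>0 where \<gamma>0: "\<And>\<gamma>. \<gamma> \<in> SL_int \<and> x ** \<gamma> \<in> F \<longleftrightarrow> \<gamma> = \<gamma>0"
      by (rule fundamental_domain_SL_E[OF F x]) (rule that)
    have "(\<integral>\<^sup>+\<gamma>. indicator F (x ** adjugate \<gamma>) \<partial>count_space SL_int) = (\<integral>\<^sup>+\<gamma>. indicator F (x ** \<gamma>) \<partial>count_space SL_int)"
      by (rule nn_integral_bij_count_space[OF bij, where f="\<lambda>\<gamma>. indicator F (x ** \<gamma>)"])
    also have "\<dots> = (\<integral>\<^sup>+\<gamma>. indicator {\<gamma>0} \<gamma> \<partial>count_space SL_int)"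
      using \<gamma>0 by (intro nn_integral_cong) (auto simp: indicator_def)
    also have "\<dots> = 1" using \<gamma>0[of \<gamma>0] by (subst nn_integral_indicator) auto
    finally show "(\<integral>\<^sup>+\<gamma>. indicator F (x ** adjugate \<gamma>) * f x \<partial>count_space SL_int) = f x"
      by (simp add: nn_integral_multc)
  qed
  finally show ?thesis .
qed

text \<open>Unfold the indicator of \<open>F1 \<inter> E\<close> along \<open>F2\<close>: for each x
  in \<open>F2\<close> exactly one translate of x meets \<open>F1\<close>, and invariance of E makes
  its contribution 1_E(x).\<close>

lemma fundamental_domain_independent:
  fixes F1 F2 E :: "(real^'n^'n) set"
  assumes F1: "fundamental_domain_SL F1" and F2: "fundamental_domain_SL F2"
    and E [measurable]: "E \<in> sets borel"
    and inv: "\<And>x \<gamma>. det x = 1 \<Longrightarrow> \<gamma> \<in> SL_int \<Longrightarrow> x ** \<gamma> \<in> E \<longleftrightarrow> x \<in> E"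
  shows "emeasure SL_haar (F1 \<inter> E) = emeasure SL_haar (F2 \<inter> E)"
proof -
  note [measurable] = fundamental_domain_SL_borel(1)[OF F1] fundamental_domain_SL_borel(1)[OF F2]
    and sub = fundamental_domain_SL_borel(2)[OF F2]
  have "emeasure SL_haar (F1 \<inter> E) = (\<integral>\<^sup>+x. indicator (F1 \<inter> E) x \<partial>SL_haar)" by simp
  also have "\<dots> = (\<integral>\<^sup>+x. indicator F2 x * (\<integral>\<^sup>+\<gamma>. indicator (F1 \<inter> E) (x ** \<gamma>) \<partial>count_space SL_int) \<partial>SL_haar)"
    by (rule fundamental_domain_unfold[OF F2, symmetric]) measurable
  also have "\<dots> = (\<integral>\<^sup>+x. indicator (F2 \<inter> E) x \<partial>SL_haar)"
  proof (rule nn_integral_cong)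
    fix x :: "real^'n^'n"
    show "indicator F2 x * (\<integral>\<^sup>+\<gamma>. indicator (F1 \<inter> E) (x ** \<gamma>) \<partial>count_space SL_int) = (indicator (F2 \<inter> E) x :: ennreal)"
    proof (cases "x \<in> F2")
      case True
      then have x: "det x = 1" using sub by (auto simp: SL_real_def)
      obtain \<gamma>0 where \<gamma>0: "\<And>\<gamma>. \<gamma> \<in> SL_int \<and> x ** \<gamma> \<in> F1 \<longleftrightarrow> \<gamma> = \<gamma>0"
        by (rule fundamental_domain_SL_E[OF F1 x]) (rule that)
      have "(\<integral>\<^sup>+\<gamma>. indicator (F1 \<inter> E) (x ** \<gamma>) \<partial>count_space SL_int) = (\<integral>\<^sup>+\<gamma>. indicator E x * indicator {\<gamma>0} \<gamma> \<partial>count_space SL_int)"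
        using \<gamma>0 inv[OF x] by (intro nn_integral_cong) (auto simp: indicator_def)
      also have "\<dots> = indicator E x" using \<gamma>0[of \<gamma>0] by (subst nn_integral_cmult_indicator) auto
      finally show ?thesis using True by (simp add: indicator_def)
    qed simp
  qed
  finally show ?thesis by simp
qed

text \<open>Here the given Haar measure has been replaced by \<open>C\<close> times the model
  \<open>SL_haar\<close>. That the total mass is finite is part of the hypothesis that
  \<open>\<mu>\<close> is a probability.\<close>

locale lattice_space = prob_space \<mu> for \<mu> :: "(real^'n) set measure" +
  fixes C :: ennreal and F :: "(real^'n^'n) set"
  assumes space_mu: "space \<mu> = unimodular_lattices"
    and sets_mu: "sets \<mu> = {U. U \<subseteq> unimodular_lattices \<and>
                 SL_real \<inter> lattice_of -` U \<in> sets (restrict_space borel SL_real)}"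
    and F: "fundamental_domain_SL F"
    and C_pos: "0 < C" and C_finite: "C < \<infinity>"
    and emeasure_mu: "\<And>U. U \<in> sets \<mu> \<Longrightarrow> emeasure \<mu> U = C * emeasure SL_haar (F \<inter> lattice_of -` U)"

lemma haar_prob_imp_lattice_space:
  fixes \<mu> :: "(real^'n) set measure"
  assumes "haar_prob_on_lattices \<mu>"
  shows "\<exists>C F. lattice_space \<mu> C F"
proof -
  from assms obtain m F where m: "haar_measure_SL m" and F: "fundamental_domain_SL F"
    and \<mu>: "prob_space \<mu>" "space \<mu> = unimodular_lattices"
     "sets \<mu> = {U. U \<subseteq> unimodular_lattices \<and> SL_real \<inter> lattice_of -` U \<in> sets (restrict_space borel SL_real)}"
     "\<And>U. U \<in> sets \<mu> \<Longrightarrow> emeasure \<mu> U = emeasure m (F \<inter> lattice_of -` U)"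
    unfolding haar_prob_on_lattices_def by auto
  obtain C :: ennreal where C: "0 < C" "C < \<infinity>"
    "\<And>E. E \<in> sets borel \<Longrightarrow> E \<subseteq> SL_real \<Longrightarrow> emeasure m E = C * emeasure SL_haar E"
    using haar_measure_SL_unique[OF m] by blast
  have "emeasure \<mu> U = C * emeasure SL_haar (F \<inter> lattice_of -` U)" if U: "U \<in> sets \<mu>" for U
  proof -
    note F' = fundamental_domain_SL_borel[OF F]
    have "SL_real \<inter> lattice_of -` U \<in> sets borel"
      using U \<mu>(3) by (auto simp: sets_restrict_space_iff)
    then have "F \<inter> (SL_real \<inter> lattice_of -` U) \<in> sets borel" using F' by blast
    also have "F \<inter> (SL_real \<inter> lattice_of -` U) = F \<inter> lattice_of -` U" using F' by auto
    finally show ?thesis using C(3)[of "F \<inter> lattice_of -` U"] \<mu>(4)[OF U] F' by auto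
  qed
  then show ?thesis
    using \<mu> F C(1,2) by (intro exI[of _ C] exI[of _ F]) (auto simp: lattice_space_def lattice_space_axioms_def)
qed

context lattice_space
begin

lemma F_borel [measurable]: "F \<in> sets borel" and F_SL: "x \<in> F \<Longrightarrow> det x = 1"
  using fundamental_domain_SL_borel[OF F] by (auto simp: SL_real_def)

lemma lattice_map_measurable [measurable]: "lattice_map \<in> measurable borel \<mu>"
proof (rule measurableI)
  show "lattice_map x \<in> space \<mu>" for x
    by (auto simp: lattice_map_def space_mu unimodular_lattices_def SL_real_def)
  fix U assume U: "U \<in> sets \<mu>"
  then have *: "SL_real \<inter> lattice_of -` U \<in> sets borel"
    by (simp add: sets_mu sets_restrict_space_iff)
  have "lattice_map -` U \<inter> space borel =
     (SL_real \<inter> lattice_of -` U) \<union> (if lattice_of (mat 1) \<in> U then - SL_real else {})"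
    by (auto simp: lattice_map_def split: if_splits)
  then show "lattice_map -` U \<inter> space borel \<in> sets borel"
    using * by auto
qed

lemma lattice_map_in_space: "lattice_map x \<in> space \<mu>"
  using measurable_space[OF lattice_map_measurable, of x] by simp

lemma space_muE:
  assumes "\<Lambda> \<in> space \<mu>"
  obtains x where "\<Lambda> = lattice_of x" "det x = 1"
  using assms by (auto simp: space_mu unimodular_lattices_def SL_real_def)

lemma mu_eq_distr: "\<mu> = distr (density SL_haar (\<lambda>x. C * indicator F x)) \<mu> lattice_map"
proof (rule measure_eqI)
  fix U assume U [measurable]: "U \<in> sets \<mu>"
  have [measurable]: "lattice_map -` U \<in> sets borel"
    using measurable_sets[OF lattice_map_measurable U] by simp
  have "emeasure (distr (density SL_haar (\<lambda>x. C * indicator F x)) \<mu> lattice_map) U =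
     (\<integral>\<^sup>+x. C * indicator F x * indicator (lattice_map -` U) x \<partial>SL_haar)"
    by (simp add: emeasure_distr emeasure_density)
  also have "\<dots> = (\<integral>\<^sup>+x. C * indicator (F \<inter> lattice_map -` U) x \<partial>SL_haar)"
    by (intro nn_integral_cong) (auto simp: indicator_def)
  also have "\<dots> = C * emeasure SL_haar (F \<inter> lattice_map -` U)"
    by (subst nn_integral_cmult_indicator) auto
  also have "F \<inter> lattice_map -` U = F \<inter> lattice_of -` U" using F_SL by auto
  finally show "emeasure \<mu> U = emeasure (distr (density SL_haar (\<lambda>x. C * indicator F x)) \<mu> lattice_map) U"
    using emeasure_mu[OF U] by simp
qed simp

lemma nn_integral_mu:
  assumes [measurable]: "f \<in> borel_measurable \<mu>"
  shows "(\<integral>\<^sup>+\<Lambda>. f \<Lambda> \<partial>\<mu>) = C * (\<integral>\<^sup>+x. indicator F x * f (lattice_map x) \<partial>SL_haar)"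
proof -
  have "(\<integral>\<^sup>+\<Lambda>. f \<Lambda> \<partial>\<mu>) = (\<integral>\<^sup>+\<Lambda>. f \<Lambda> \<partial>distr (density SL_haar (\<lambda>x. C * indicator F x)) \<mu> lattice_map)"
    using mu_eq_distr by simp
  also have "\<dots> = (\<integral>\<^sup>+x. C * indicator F x * f (lattice_map x) \<partial>SL_haar)"
    by (simp add: nn_integral_distr nn_integral_density)
  also have "\<dots> = C * (\<integral>\<^sup>+x. indicator F x * f (lattice_map x) \<partial>SL_haar)"
    by (simp add: nn_integral_cmult mult.assoc)
  finally show ?thesis .
qed

text \<open>Formula \<open>nn_integral_mu\<close> sees only matrices in F. Unfolding spreads a null
  set over the countably many translates of F, all of which have the same lattices, so null sets on
  the two sides correspond.\<close>

lemma AE_lattice_map_iff: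
  assumes [measurable]: "Measurable.pred \<mu> P"
  shows "(AE \<Lambda> in \<mu>. P \<Lambda>) \<longleftrightarrow> (AE x in SL_haar. P (lattice_map x))"
proof
  assume "AE x in SL_haar. P (lattice_map x)"
  then have "(\<integral>\<^sup>+x. indicator F x * indicator {\<Lambda> \<in> space \<mu>. \<not> P \<Lambda>} (lattice_map x) \<partial>SL_haar) = (\<integral>\<^sup>+x. 0 \<partial>(SL_haar :: (real^'n^'n) measure))"
    by (intro nn_integral_cong_AE) (auto simp: indicator_def)
  then have "emeasure \<mu> {\<Lambda> \<in> space \<mu>. \<not> P \<Lambda>} = 0"
    using nn_integral_mu[of "indicator {\<Lambda> \<in> space \<mu>. \<not> P \<Lambda>}"] by simp
  then show "AE \<Lambda> in \<mu>. P \<Lambda>" by (intro AE_I[OF subset_refl]) auto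
next
  assume P: "AE \<Lambda> in \<mu>. P \<Lambda>"
  define N where "N = {\<Lambda> \<in> space \<mu>. \<not> P \<Lambda>}"
  have N [measurable]: "N \<in> sets \<mu>" unfolding N_def by measurable
  have "emeasure \<mu> N = 0" using P by (simp add: AE_iff_measurable[OF _ refl] N_def)
  then have "C * (\<integral>\<^sup>+x. indicator F x * indicator N (lattice_map x) \<partial>SL_haar) = 0"
    using nn_integral_mu[of "indicator N"] by simp
  then have "(\<integral>\<^sup>+x. indicator F x * indicator N (lattice_map x) \<partial>SL_haar) = 0"
    using C_pos by auto
  then have 0: "AE x in SL_haar. indicator F x * indicator N (lattice_map x) = (0 :: ennreal)"
    by (subst (asm) nn_integral_0_iff_AE) auto
  have "(\<integral>\<^sup>+x. indicator N (lattice_map x) \<partial>SL_haar) =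
    (\<integral>\<^sup>+x. indicator F x * (\<integral>\<^sup>+\<gamma>. indicator N (lattice_map (x ** \<gamma>)) \<partial>count_space SL_int) \<partial>SL_haar)"
    by (rule fundamental_domain_unfold[OF F, symmetric]) measurable
  also have "\<dots> = (\<integral>\<^sup>+x. 0 \<partial>(SL_haar :: (real^'n^'n) measure))"
  proof (rule nn_integral_cong_AE, rule AE_mp[OF 0], intro AE_I2 impI)
    fix x :: "real^'n^'n"
    assume 0: "indicator F x * indicator N (lattice_map x) = (0 :: ennreal)"
    show "indicator F x * (\<integral>\<^sup>+\<gamma>. indicator N (lattice_map (x ** \<gamma>)) \<partial>count_space SL_int) = (0 :: ennreal)"
    proof (cases "x \<in> F")
      case True
      then have "(\<integral>\<^sup>+\<gamma>. indicator N (lattice_map (x ** \<gamma>)) \<partial>count_space SL_int) =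
          (\<integral>\<^sup>+\<gamma>. 0 \<partial>count_space (SL_int :: (real^'n^'n) set))"
        using 0 F_SL by (intro nn_integral_cong) (auto simp: det_mul SL_int_subset lattice_of_mult_SL_int)
      then show ?thesis by simp
    qed simp
  qed
  finally have "(\<integral>\<^sup>+x. indicator N (lattice_map x) \<partial>SL_haar) = 0" by simp
  then have "AE x in SL_haar. indicator N (lattice_map x) = (0 :: ennreal)"
    by (subst (asm) nn_integral_0_iff_AE) auto
  then show "AE x in SL_haar. P (lattice_map x)"
    using lattice_map_in_space by (auto simp: N_def indicator_def elim!: eventually_mono split: if_splits)
qed

lemma sets_muI:
  assumes "U \<subseteq> unimodular_lattices" "E \<in> sets borel" "\<And>x. det x = 1 \<Longrightarrow> lattice_of x \<in> U \<longleftrightarrow> x \<in> E"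
  shows "U \<in> sets \<mu>"
proof -
  have "SL_real \<inter> lattice_of -` U = SL_real \<inter> E" using assms(3) by (auto simp: SL_real_def)
  then show ?thesis using assms(1,2) by (auto simp: sets_mu sets_restrict_space_iff)
qed

text \<open>The quotient sigma-algebra reduces measurability on lattices to measurability on
  matrices, where \<open>g\<close> has to agree with \<open>f\<close> only at determinant 1.\<close>

lemma measurable_muI:
  assumes "g \<in> measurable borel N" "\<And>x. det x = 1 \<Longrightarrow> f (lattice_of x) = g x"
  shows "f \<in> measurable \<mu> N"
proof (rule measurableI)
  fix \<Lambda> assume "\<Lambda> \<in> space \<mu>"
  then obtain x where "\<Lambda> = lattice_of x" "det x = 1" by (rule space_muE)
  then show "f \<Lambda> \<in> space N" using assms measurable_space[OF assms(1), of x] by simp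
next
  fix A assume "A \<in> sets N"
  then have "g -` A \<in> sets borel" using measurable_sets[OF assms(1), of A] by simp
  then show "f -` A \<inter> space \<mu> \<in> sets \<mu>"
    by (rule sets_muI[rotated]) (auto simp: space_mu assms(2) unimodular_lattices_def SL_real_def)
qed

end

section \<open>Matrices of determinant 1 or -1 acting on lattices\<close>

definition lattice_act :: "real^'n^'n \<Rightarrow> (real^'n) set \<Rightarrow> (real^'n) set" where
  "lattice_act h \<Lambda> = (\<lambda>v. h *v v) ` \<Lambda>"

lemma lattice_act_lattice_of [simp]: "lattice_act h (lattice_of g) = lattice_of (h ** g)"
  by (simp add: lattice_act_def lattice_of_left_mult)

lemma lattice_act_act: "lattice_act h (lattice_act k \<Lambda>) = lattice_act (h ** k) \<Lambda>"
  by (simp add: lattice_act_def image_image matrix_vector_mul_assoc)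

text \<open>If det h = -1, then h x leaves the group, but h x k returns to it and spans the same
  lattice as h x. Conjugation by the involution k preserves \<open>SL_int\<close>, so fundamental
  domains can be carried along.\<close>

lemma integral_det_correction:
  fixes h :: "real^'n^'n"
  assumes "\<bar>det h\<bar> = 1"
  obtains k :: "real^'n^'n" where "det h * det k = 1" "k ** k = mat 1"
    "\<And>g :: real^'n^'n. lattice_of (g ** k) = lattice_of g"
    "\<And>\<gamma>. \<gamma> \<in> SL_int \<Longrightarrow> k ** \<gamma> ** k \<in> SL_int"
proof (cases "det h = 1")
  case True
  then show ?thesis using that[of "mat 1"] by simp
next
  case False
  fix i :: 'n
  have "reflection_matrix i ** \<gamma> ** reflection_matrix i \<in> SL_int" if "\<gamma> \<in> SL_int" for \<gamma> :: "real^'n^'n"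
  proof -
    have "det (reflection_matrix i ** \<gamma> ** reflection_matrix i) = 1"
      using that by (simp add: det_mul SL_int_subset)
    then show ?thesis
      using that by (auto simp: SL_int_def reflection_matrix_def mult_diag_matrix diag_matrix_mult)
  qed
  then show ?thesis
    using that[of "reflection_matrix i"] assms False lattice_of_mult_reflection
    by (auto simp: abs_if split: if_splits)
qed

context lattice_space
begin

lemma lattice_act_measurable [measurable]:
  assumes "\<bar>det h\<bar> = 1"
  shows "lattice_act h \<in> measurable \<mu> \<mu>"
proof -
  obtain k :: "real^'n^'n" where k: "det h * det k = 1"
    "\<And>g :: real^'n^'n. lattice_of (g ** k) = lattice_of g"
    using integral_det_correction[OF assms] by metis
  show ?thesis
  proof (rule measurable_muI)
    show "(\<lambda>x. lattice_map (h ** x ** k)) \<in> measurable borel \<mu>" by measurable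
    show "lattice_act h (lattice_of x) = lattice_map (h ** x ** k)" if "det x = 1" for x
      using that k by (simp add: det_mul)
  qed
qed

text \<open>The substitution x -> h x k preserves \<open>SL_haar\<close> and carries F to another
  fundamental domain, and the measure of a set of lattices does not depend on the domain
  used.\<close>

lemma distr_lattice_act:
  assumes h: "\<bar>det h\<bar> = 1"
  shows "distr \<mu> \<mu> (lattice_act h) = \<mu>"
proof (rule measure_eqI)
  obtain k :: "real^'n^'n" where k: "det h * det k = 1" "k ** k = mat 1"
    "\<And>g :: real^'n^'n. lattice_of (g ** k) = lattice_of g"
    "\<And>\<gamma>. \<gamma> \<in> SL_int \<Longrightarrow> k ** \<gamma> ** k \<in> SL_int"
    by (rule integral_det_correction[OF h]) (rule that)
  have "det h \<noteq> 0" using h by auto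
  then obtain h' where h': "h' ** h = mat 1" "h ** h' = mat 1"
    using invertible_det_nz[of h] by (auto simp: invertible_def)
  have dh': "det h' * det h = 1" using h'(1) by (metis det_I det_mul)
  then have dh'k: "det h' * det k = 1" and dk: "\<bar>det k\<bar> = 1"
    using h k(1) by (auto simp: abs_if split: if_splits)
  have dkk: "det k * det k = 1" using k(2) by (metis det_I det_mul)
  note [measurable] = lattice_act_measurable[OF h]
  fix U assume "U \<in> sets (distr \<mu> \<mu> (lattice_act h))"
  then have U [measurable]: "U \<in> sets \<mu>" by simp
  define E where "E = lattice_map -` U"
  have E [measurable]: "E \<in> sets borel"
    using measurable_sets[OF lattice_map_measurable U] by (simp add: E_def)
  \<comment> \<open>The image of F under y -> h y k, because k is an involution. If \<gamma>0 is the
    unique element bringing h' x k into F, the one bringing x into \<open>F'\<close> is k \<gamma>0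
    k.\<close>
  define F' where "F' = {x \<in> SL_real. h' ** x ** k \<in> F}"
  have F': "fundamental_domain_SL F'"
    unfolding fundamental_domain_SL_def
  proof (intro conjI ballI)
    have "{x \<in> SL_real. h' ** x ** k \<in> F} \<in> sets borel" by measurable
    then show "F' \<in> sets (restrict_space borel SL_real)"
      by (auto simp: F'_def sets_restrict_space_iff)
    fix x :: "real^'n^'n" assume "x \<in> SL_real"
    then have x: "det x = 1" by (simp add: SL_real_def)
    have "det (h' ** x ** k) = 1" using x dh'k by (simp add: det_mul mult_ac)
    then obtain \<gamma>0 where \<gamma>0: "\<And>\<gamma>. \<gamma> \<in> SL_int \<and> h' ** x ** k ** \<gamma> \<in> F \<longleftrightarrow> \<gamma> = \<gamma>0"
      by (rule fundamental_domain_SL_E[OF F]) (rule that)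
    have kgk: "h' ** x ** k ** (k ** \<gamma> ** k) = h' ** (x ** \<gamma>) ** k" for \<gamma>
      using k(2) by (metis matrix_mul_assoc matrix_mul_rid)
    have kk: "k ** (k ** \<gamma> ** k) ** k = \<gamma>" for \<gamma>
      using k(2) by (metis matrix_mul_assoc matrix_mul_rid matrix_mul_lid)
    show "\<exists>!\<gamma>. \<gamma> \<in> SL_int \<and> x ** \<gamma> \<in> F'"
    proof (rule ex1I[of _ "k ** \<gamma>0 ** k"])
      show "k ** \<gamma>0 ** k \<in> SL_int \<and> x ** (k ** \<gamma>0 ** k) \<in> F'"
        using \<gamma>0[of \<gamma>0] k(4)[of \<gamma>0] x kgk[of "k ** \<gamma>0 ** k"]
        by (simp add: kk F'_def SL_real_def det_mul SL_int_subset dkk)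
      fix \<gamma> assume "\<gamma> \<in> SL_int \<and> x ** \<gamma> \<in> F'"
      then have "k ** \<gamma> ** k = \<gamma>0"
        using \<gamma>0[of "k ** \<gamma> ** k"] k(4)[of \<gamma>] kgk[of \<gamma>] by (simp add: F'_def)
      then show "\<gamma> = k ** \<gamma>0 ** k" using kk by metis
    qed
  qed
  note [measurable] = fundamental_domain_SL_borel(1)[OF F']
  have hxk: "h' ** (h ** x ** k) ** k = x" for x
    using h'(1) k(2) by (metis matrix_mul_assoc matrix_mul_lid matrix_mul_rid)
  have "emeasure (distr \<mu> \<mu> (lattice_act h)) U = (\<integral>\<^sup>+\<Lambda>. indicator U (lattice_act h \<Lambda>) \<partial>\<mu>)"
    by (subst nn_integral_distr[symmetric, where M'=\<mu>]) auto
  also have "\<dots> = C * (\<integral>\<^sup>+x. indicator F x * indicator U (lattice_act h (lattice_map x)) \<partial>SL_haar)"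
    by (rule nn_integral_mu) measurable
  also have "(\<integral>\<^sup>+x. indicator F x * indicator U (lattice_act h (lattice_map x)) \<partial>SL_haar) =
      (\<integral>\<^sup>+x. indicator F' (h ** x ** k) * indicator E (h ** x ** k) \<partial>SL_haar)"
  proof (rule nn_integral_cong_AE, rule AE_mp[OF AE_SL_haar_det], intro AE_I2 impI)
    fix x :: "real^'n^'n" assume x: "det x = 1"
    then show "indicator F x * indicator U (lattice_act h (lattice_map x)) =
       (indicator F' (h ** x ** k) * indicator E (h ** x ** k) :: ennreal)"
      using k(1,3) by (simp add: F'_def E_def indicator_def hxk SL_real_def det_mul)
  qed
  also have "\<dots> = (\<integral>\<^sup>+x. indicator F' x * indicator E x \<partial>SL_haar)"
    by (rule nn_integral_SL_haar_mult[OF _ h k(1)]) measurable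
  also have "\<dots> = emeasure SL_haar (F' \<inter> E)"
    by (simp flip: indicator_inter_arith)
  also have "\<dots> = emeasure SL_haar (F \<inter> E)"
    by (rule fundamental_domain_independent[OF F' F E])
      (auto simp: E_def det_mul SL_int_subset lattice_of_mult_SL_int)
  also have "F \<inter> E = F \<inter> lattice_of -` U" using F_SL by (auto simp: E_def)
  finally show "emeasure (distr \<mu> \<mu> (lattice_act h)) U = emeasure \<mu> U"
    using emeasure_mu[OF U] by simp
qed simp

end

section \<open>The ergodic theorem\<close>

text \<open>\<open>birkhoff_max T g n\<close> is the maximum of the first \<open>n + 1\<close> nonempty Birkhoff sums of \<open>g\<close>.\<close>

fun birkhoff_max :: "('a \<Rightarrow> 'a) \<Rightarrow> ('a \<Rightarrow> real) \<Rightarrow> nat \<Rightarrow> 'a \<Rightarrow> real" where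
  "birkhoff_max T g 0 x = g x"
| "birkhoff_max T g (Suc n) x = g x + max 0 (birkhoff_max T g n (T x))"

lemma birkhoff_max_mono_Suc: "birkhoff_max T g n x \<le> birkhoff_max T g (Suc n) x"
proof (induction n arbitrary: x)
  case (Suc n)
  show ?case using max.mono[OF order_refl Suc[of "T x"], of 0] by simp
qed simp

lemma birkhoff_max_mono: "m \<le> n \<Longrightarrow> birkhoff_max T g m x \<le> birkhoff_max T g n x"
  by (rule lift_Suc_mono_le) (rule birkhoff_max_mono_Suc)

lemma birkhoff_sum_le_max: "(\<Sum>i<Suc n. g ((T ^^ i) x)) \<le> birkhoff_max T g n x"
proof (induction n arbitrary: x)
  case (Suc n)
  have "(\<Sum>i<Suc (Suc n). g ((T ^^ i) x)) = g x + (\<Sum>i<Suc n. g ((T ^^ i) (T x)))"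
    by (subst sum.lessThan_Suc_shift) (simp add: funpow_Suc_right del: funpow.simps sum.lessThan_Suc)
  also have "\<dots> \<le> birkhoff_max T g (Suc n) x" using Suc[of "T x"] by simp
  finally show ?case .
qed simp

context prob_space
begin

text \<open>The set where the partial maxima are unbounded is invariant, hence null or of full
  measure. Full measure is excluded as in the maximal ergodic theorem: it would exhibit the negative
  mean of g as a limit of nonnegative numbers.\<close>

lemma birkhoff_sums_bounded_above:
  fixes g :: "'a \<Rightarrow> real"
  assumes T [measurable]: "T \<in> measurable M M" and inv: "distr M M T = M"
    and ergodic: "\<And>E. E \<in> sets M \<Longrightarrow> T -` E \<inter> space M = E \<Longrightarrow> prob E = 0 \<or> prob E = 1"
    and g: "integrable M g" and neg: "expectation g < 0"
  shows "AE x in M. \<exists>B. \<forall>n. (\<Sum>i<n. g ((T ^^ i) x)) \<le> B"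
proof -
  let ?F = "birkhoff_max T g"
  have gm [measurable]: "g \<in> borel_measurable M" using g by auto
  have int_T: "integrable M (\<lambda>x. f (T x)) \<and> expectation (\<lambda>x. f (T x)) = expectation f"
    if "integrable M f" for f :: "'a \<Rightarrow> real"
  proof -
    have [measurable]: "f \<in> borel_measurable M" using that by auto
    have "integrable (distr M M T) f" using that inv by simp
    moreover have "integral\<^sup>L (distr M M T) f = expectation f" using inv by simp
    ultimately show ?thesis by (simp add: integrable_distr_eq integral_distr)
  qed
  have F_int: "integrable M (?F n)" for n
  proof (induction n)
    case (Suc n)
    have "integrable M (\<lambda>x. g x + max 0 (?F n (T x)))" using int_T[OF Suc] g by auto
    then show ?case by simp
  qed (use g in simp)
  have [measurable]: "?F n \<in> borel_measurable M" for n using F_int[of n] by auto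
  define E where "E = {x \<in> space M. \<forall>B::nat. \<exists>n. ?F n x > real B}"
  have E [measurable]: "E \<in> sets M" unfolding E_def by measurable
  have "T -` E \<inter> space M = E"
  proof (intro antisym subsetI)
    fix x assume x: "x \<in> T -` E \<inter> space M"
    show "x \<in> E" unfolding E_def
    proof (intro CollectI conjI allI)
      fix B
      obtain B' :: nat where "real B - g x \<le> real B'" using real_arch_simple by blast
      moreover obtain n where "?F n (T x) > real B'" using x by (auto simp: E_def)
      ultimately have "?F (Suc n) x > real B" by simp
      then show "\<exists>n. ?F n x > real B" by blast
    qed (use x in auto)
  next
    fix x assume x: "x \<in> E"
    then have sp: "x \<in> space M" "T x \<in> space M" using measurable_space[OF T] by (auto simp: E_def)
    have "T x \<in> E" unfolding E_def
    proof (intro CollectI conjI allI)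
      fix B
      obtain B' :: nat where B': "real B + \<bar>g x\<bar> \<le> real B'" using real_arch_simple by blast
      obtain n where n: "?F n x > real B'" using x by (auto simp: E_def)
      then have "?F (Suc n) x > real B'" using birkhoff_max_mono_Suc order_less_le_trans by metis
      then have "max 0 (?F n (T x)) > real B" using B' by simp
      then have "?F n (T x) > real B" by (simp add: less_max_iff_disj)
      then show "\<exists>n. ?F n (T x) > real B" by blast
    qed (use sp in auto)
    then show "x \<in> T -` E \<inter> space M" using sp by auto
  qed
  then have "prob E = 0 \<or> prob E = 1" using ergodic[OF E] by auto
  moreover have "prob E \<noteq> 1"
  proof
    assume "prob E = 1"
    then have AE_E: "AE x in M. x \<in> E" by (simp add: prob_eq_1)
    have AE_TE: "AE x in M. T x \<in> E" using AE_E by eventually_elim (use \<open>T -` E \<inter> space M = E\<close> in auto)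
    \<comment> \<open>By the recursion this difference is g(x) plus the negative part of F_n(T x).
      It equals g(x) once F_n(T x) > 0, and F_n >= g gives the dominating function. Its mean is
      nonnegative because T preserves the measure and F_n increases with n.\<close>
    let ?D = "\<lambda>n x. ?F (Suc n) x - ?F n (T x)"
    have "(\<lambda>n. expectation (?D n)) \<longlonglongrightarrow> expectation g"
    proof (rule integral_dominated_convergence[where w="\<lambda>x. \<bar>g x\<bar> + \<bar>g (T x)\<bar>"])
      show "integrable M (\<lambda>x. \<bar>g x\<bar> + \<bar>g (T x)\<bar>)" using g int_T[OF g] by auto
      show "AE x in M. (\<lambda>n. ?D n x) \<longlonglongrightarrow> g x" using AE_TE
      proof eventually_elim
        case (elim x)
        then obtain n0 where n0: "?F n0 (T x) > 0" by (auto simp: E_def dest: spec[of _ 0])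
        have "eventually (\<lambda>n. ?D n x = g x) sequentially"
          using eventually_ge_at_top[of n0]
        proof eventually_elim
          case (elim n)
          then have "?F n (T x) > 0" using n0 birkhoff_max_mono[of n0 n T g "T x"] by simp
          then show ?case by simp
        qed
        then show ?case by (rule tendsto_eventually)
      qed
      show "AE x in M. norm (?D n x) \<le> \<bar>g x\<bar> + \<bar>g (T x)\<bar>" for n
      proof (rule AE_I2)
        fix x
        have "g (T x) \<le> ?F n (T x)" using birkhoff_max_mono[of 0 n T g "T x"] by simp
        then show "norm (?D n x) \<le> \<bar>g x\<bar> + \<bar>g (T x)\<bar>" by (auto simp: max_def)
      qed
    qed measurable
    moreover have "0 \<le> expectation (?D n)" for n
    proof -
      have "expectation (?D n) = expectation (?F (Suc n)) - expectation (?F n)"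
        using F_int[of "Suc n"] int_T[OF F_int[of n]] by (simp del: birkhoff_max.simps)
      also have "\<dots> \<ge> 0"
        using integral_mono[OF F_int[of n] F_int[of "Suc n"]] birkhoff_max_mono_Suc[of T g n] by (simp del: birkhoff_max.simps)
      finally show ?thesis .
    qed
    ultimately have "0 \<le> expectation g" using LIMSEQ_le_const by blast
    then show False using neg by simp
  qed
  ultimately have "AE x in M. x \<notin> E" by (simp add: prob_eq_0)
  then show ?thesis using AE_space
  proof eventually_elim
    case (elim x)
    then obtain B :: nat where B: "\<And>n. ?F n x \<le> real B" by (force simp: E_def not_less)
    have "(\<Sum>i<n. g ((T ^^ i) x)) \<le> real B" for n
    proof (cases n)
      case (Suc k)
      then show ?thesis using birkhoff_sum_le_max[of g T x k] B[of k] by simp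
    qed simp
    then show ?case by blast
  qed
qed

text \<open>The preceding lemma is applied to f - E f - 1/(m+1) and to E f - f - 1/(m+1). Bounded
  sums of these say that the averages eventually differ from E f by little more than 1/(m+1) in
  either direction.\<close>

theorem birkhoff_ergodic:
  fixes f :: "'a \<Rightarrow> real"
  assumes T: "T \<in> measurable M M" and inv: "distr M M T = M"
    and ergodic: "\<And>E. E \<in> sets M \<Longrightarrow> T -` E \<inter> space M = E \<Longrightarrow> prob E = 0 \<or> prob E = 1"
    and f: "integrable M f"
  shows "AE x in M. (\<lambda>n. (\<Sum>i<n. f ((T ^^ i) x)) / real n) \<longlonglongrightarrow> expectation f"
proof -
  let ?S = "\<lambda>n x. \<Sum>i<n. f ((T ^^ i) x)"
  have up: "AE x in M. \<exists>B. \<forall>n. (\<Sum>i<n. (s * (f ((T ^^ i) x) - expectation f) - 1 / real (Suc m))) \<le> B"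
    for s :: real and m
  proof (rule birkhoff_sums_bounded_above[OF T inv ergodic])
    show "integrable M (\<lambda>x. s * (f x - expectation f) - 1 / real (Suc m))" using f by auto
    have "expectation (\<lambda>x. s * (f x - expectation f) - 1 / real (Suc m)) = - 1 / real (Suc m)"
      using f by (simp add: prob_space)
    then show "expectation (\<lambda>x. s * (f x - expectation f) - 1 / real (Suc m)) < 0" by simp
  qed
  have "AE x in M. \<forall>m. (\<exists>B. \<forall>n. (\<Sum>i<n. (1 * (f ((T ^^ i) x) - expectation f) - 1 / real (Suc m))) \<le> B) \<and>
      (\<exists>B. \<forall>n. (\<Sum>i<n. (- 1 * (f ((T ^^ i) x) - expectation f) - 1 / real (Suc m))) \<le> B)"
    unfolding AE_all_countable using up[of 1] up[of "-1"] by (intro allI AE_conjI) auto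
  then show ?thesis
  proof eventually_elim
    case (elim x)
    show ?case
    proof (rule LIMSEQ_I)
      fix e :: real assume "e > 0"
      then obtain m where m: "1 / real (Suc m) < e / 2" using nat_approx_posE[of "e/2"] by auto
      obtain B1 where B1: "\<And>n. (\<Sum>i<n. (1 * (f ((T ^^ i) x) - expectation f) - 1 / real (Suc m))) \<le> B1"
        using elim by blast
      obtain B2 where B2: "\<And>n. (\<Sum>i<n. (- 1 * (f ((T ^^ i) x) - expectation f) - 1 / real (Suc m))) \<le> B2"
        using elim by blast
      obtain N :: nat where N: "2 * (\<bar>B1\<bar> + \<bar>B2\<bar> + 1) / e < real N" using reals_Archimedean2 by blast
      show "\<exists>N. \<forall>n\<ge>N. norm (?S n x / real n - expectation f) < e"
      proof (intro exI[of _ "Suc N"] allI impI)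
        fix n assume "n \<ge> Suc N"
        then have n: "real n > 0" "2 * (\<bar>B1\<bar> + \<bar>B2\<bar> + 1) / e < real n" using N by auto
        then have nB: "\<bar>B1\<bar> + \<bar>B2\<bar> + 1 < real n * (e / 2)" using \<open>e > 0\<close> by (simp add: field_simps)
        have nm: "real n * (1 / real (Suc m)) \<le> real n * (e / 2)" using m n(1) by (intro mult_left_mono) auto
        have "?S n x - real n * expectation f - real n * (1 / real (Suc m)) \<le> B1"
          using B1[of n] by (simp add: sum_subtractf)
        moreover have "real n * expectation f - ?S n x - real n * (1 / real (Suc m)) \<le> B2"
          using B2[of n] by (simp add: sum_subtractf)
        ultimately have "\<bar>?S n x - real n * expectation f\<bar> < real n * e" using nB nm by linarith
        then have "\<bar>?S n x - real n * expectation f\<bar> / real n < e" using n(1) by (simp add: field_simps)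
        also have "\<bar>?S n x - real n * expectation f\<bar> / real n = \<bar>(?S n x - real n * expectation f) / real n\<bar>"
          using n(1) by (simp add: abs_divide)
        also have "(?S n x - real n * expectation f) / real n = ?S n x / real n - expectation f"
          using n(1) by (simp add: field_simps)
        finally show "norm (?S n x / real n - expectation f) < e" by simp
      qed
    qed
  qed
qed

end

section \<open>Ergodicity of diagonal flows\<close>

lemma transvection_add: "i \<noteq> j \<Longrightarrow> transvection i j s ** transvection i j t = transvection i j (s + t)"
  by (simp add: mult_transvection) (auto simp: transvection_def vec_eq_iff)

lemma transvection_0: "transvection i j 0 = mat 1"
  by (simp add: transvection_def mat_def vec_eq_iff)

lemma dist_transvection_mult:
  fixes g :: "real^'n^'n"
  shows "dist (transvection i j t ** g) g \<le> \<bar>t\<bar> * norm g"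
proof -
  have "transvection i j t ** g - g = t *\<^sub>R axis i (g $ j)"
    by (auto simp: transvection_mult vec_eq_iff axis_def row_def)
  then have "dist (transvection i j t ** g) g = \<bar>t\<bar> * norm (axis i (g $ j))"
    by (simp add: dist_norm)
  also have "norm (axis i (g $ j)) = norm (g $ j)" by (simp add: norm_eq_sqrt_inner inner_axis_axis)
  also have "\<dots> \<le> norm g" by (rule Finite_Cartesian_Product.norm_nth_le)
  finally show ?thesis by (simp add: mult_left_mono)
qed

section \<open>Small transvections displace little mass\<close>

lemma inner_regular_lborel_compact:
  fixes S :: "'a::euclidean_space set"
  assumes S: "S \<in> sets borel" "emeasure lborel S < \<infinity>" and e: "e > (0 :: real)"
  obtains K where "compact K" "K \<subseteq> S" "emeasure lborel (S - K) < e"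
proof -
  have "S \<in> sets lebesgue" using S by simp
  from this e obtain T where T: "closed T" "T \<subseteq> S" "emeasure lebesgue (S - T) < ennreal e"
    by (rule sets_lebesgue_inner_closed) (rule that)
  then have T': "emeasure lborel (S - T) < ennreal e" using S by simp
  let ?A = "\<lambda>n::nat. S - T \<inter> cball 0 (real n)"
  have "(\<lambda>n. emeasure lborel (?A n)) \<longlonglongrightarrow> emeasure lborel (\<Inter>n. ?A n)"
  proof (rule Lim_emeasure_decseq)
    show "range ?A \<subseteq> sets lborel" using S T by auto
    show "decseq ?A" by (auto simp: decseq_def)
    show "emeasure lborel (?A n) \<noteq> \<infinity>" for n
    proof -
      have "emeasure lborel (?A n) \<le> emeasure lborel S" using S T by (intro emeasure_mono) auto
      then show ?thesis using S(2) by (auto simp: top_unique)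
    qed
  qed
  also have "(\<Inter>n. ?A n) = S - T"
  proof -
    have "\<exists>n::nat. norm x \<le> real n" for x :: 'a by (rule real_arch_simple)
    then show ?thesis by auto
  qed
  finally have "eventually (\<lambda>n. emeasure lborel (?A n) < e) sequentially"
    using T' by (rule order_tendstoD)
  then obtain n where n: "emeasure lborel (?A n) < e" by (auto simp: eventually_sequentially)
  show ?thesis
  proof
    show "compact (T \<inter> cball 0 (real n))" using T(1) by (simp add: closed_Int_compact)
  qed (use T n in auto)
qed

lemma emeasure_lborel_vimage_left_mult:
  fixes h :: "real^'n^'n" and E :: "(real^'n^'n) set"
  assumes "\<bar>det h\<bar> = 1" "E \<in> sets borel"
  shows "emeasure lborel {g. h ** g \<in> E} = emeasure lborel E"
proof -
  have "emeasure lborel E = emeasure (distr lborel borel (\<lambda>g. h ** g)) E"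
    using lborel_left_mult[OF assms(1)] by simp
  also have "\<dots> = emeasure lborel {g. h ** g \<in> E}"
    using assms(2) by (subst emeasure_distr) (auto simp: vimage_def)
  finally show ?thesis ..
qed

text \<open>Squeeze S between a compact K and an open U. A small transvection moves a point of K by
  at most |t| times its norm, and norms are bounded on K; so a point sent into K already lies in U.
  What remains is sent into S - K or lies in U - S.\<close>

lemma lborel_transvection_continuity:
  fixes S :: "(real^'n^'n) set"
  assumes S: "S \<in> sets borel" "emeasure lborel S < \<infinity>" and e: "e > (0 :: real)" and ij: "i \<noteq> j"
  shows "\<exists>\<delta>>0. \<forall>t. \<bar>t\<bar> < \<delta> \<longrightarrow> emeasure lborel {g. transvection i j t ** g \<in> S \<and> g \<notin> S} \<le> e"
proof -
  obtain U where U: "open U" "S \<subseteq> U" "emeasure lborel (U - S) < e / 2"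
    using outer_regular_lborel[OF S(1), of "e/2"] e by auto
  obtain K where K: "compact K" "K \<subseteq> S" "emeasure lborel (S - K) < e / 2"
    using inner_regular_lborel_compact[OF S, of "e/2"] e by auto
  obtain r where r: "r > 0" "(\<Union>x\<in>K. ball x r) \<subseteq> U"
    using compact_subset_open_imp_ball_epsilon_subset[OF K(1) U(1)] K(2) U(2) by blast
  obtain R where R: "R > 0" "\<And>x. x \<in> K \<Longrightarrow> norm x \<le> R"
    using compact_imp_bounded[OF K(1)] by (auto simp: bounded_pos)
  show ?thesis
  proof (intro exI[of _ "r / R"] conjI allI impI)
    show "r / R > 0" using r R by simp
    fix t assume t: "\<bar>t\<bar> < r / R"
    let ?T = "transvection i j"
    have [measurable]: "S \<in> sets borel" "U \<in> sets borel" "K \<in> sets borel"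
      using S(1) U(1) K(1) by (auto simp: compact_imp_closed)
    have "{g. ?T t ** g \<in> S \<and> g \<notin> S} \<subseteq> {g. ?T t ** g \<in> S - K} \<union> (U - S)"
    proof safe
      fix g assume g: "?T t ** g \<in> S" "g \<notin> S" "g \<notin> U" "?T t ** g \<in> K"
      have "g = ?T (- t) ** (?T t ** g)"
        using ij by (simp add: matrix_mul_assoc transvection_add transvection_0)
      then have "dist g (?T t ** g) \<le> \<bar>t\<bar> * norm (?T t ** g)"
        using dist_transvection_mult[of i j "-t" "?T t ** g"] by simp
      also have "\<dots> \<le> \<bar>t\<bar> * R" using R(2)[OF g(4)] by (intro mult_left_mono) auto
      also have "\<dots> < r" using t R(1) by (simp add: field_simps)
      finally have "g \<in> (\<Union>x\<in>K. ball x r)"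
        by (intro UN_I[OF g(4)]) (simp add: dist_commute)
      then have "g \<in> U" using r(2) by blast
      then show False using g by simp
    qed
    then have "emeasure lborel {g. ?T t ** g \<in> S \<and> g \<notin> S} \<le> emeasure lborel ({g. ?T t ** g \<in> S - K} \<union> (U - S))"
      by (intro emeasure_mono) measurable
    also have "\<dots> \<le> emeasure lborel {g. ?T t ** g \<in> S - K} + emeasure lborel (U - S)"
      by (intro emeasure_subadditive) measurable
    also have "emeasure lborel {g. ?T t ** g \<in> S - K} = emeasure lborel (S - K)"
      using ij by (intro emeasure_lborel_vimage_left_mult) (auto simp: det_transvection)
    also have "emeasure lborel (S - K) + emeasure lborel (U - S) \<le> ennreal (e/2) + ennreal (e/2)"
      using K(3) U(3) by (intro add_mono) auto
    also have "\<dots> = e" using e by (simp flip: ennreal_plus)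
    finally show "emeasure lborel {g. ?T t ** g \<in> S \<and> g \<notin> S} \<le> e" .
  qed
qed

context lattice_space
begin

lemma AE_lattice_act:
  assumes "AE \<Lambda> in \<mu>. P \<Lambda>" and h: "\<bar>det h\<bar> = 1"
  shows "AE \<Lambda> in \<mu>. P (lattice_act h \<Lambda>)"
  using assms(1) lattice_act_measurable[OF h] distr_lattice_act[OF h] by (metis AE_distrD)

lemma lattice_map_left:
  assumes "det h = 1" "det x = 1"
  shows "lattice_map (h ** x) = lattice_act h (lattice_map x)"
  using assms by (simp add: det_mul)

text \<open>Only one half of the symmetric difference: the lattices that enter \<open>E\<close>. The
  inverse of h accounts for the other half.\<close>

definition displaced :: "real^'n^'n \<Rightarrow> (real^'n) set set \<Rightarrow> (real^'n) set set" where
  "displaced h E = {\<Lambda> \<in> space \<mu>. lattice_act h \<Lambda> \<in> E \<and> \<Lambda> \<notin> E}"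

lemma transvection_continuity:
  assumes E: "E \<in> sets \<mu>" and e: "e > (0 :: real)" and ij: "i \<noteq> j"
  shows "\<exists>\<delta>>0. \<forall>t. \<bar>t\<bar> < \<delta> \<longrightarrow> emeasure \<mu> (displaced (transvection i j t) E) \<le> C * ennreal e"
proof -
  define S where "S = F \<inter> lattice_map -` E"
  have [measurable]: "lattice_map -` E \<in> sets borel"
    using measurable_sets[OF lattice_map_measurable E] by simp
  then have S [measurable]: "S \<in> sets borel" by (auto simp: S_def)
  define S' where "S' = SL_cone \<inter> SL_proj -` S"
  have S' [measurable]: "S' \<in> sets borel"
    using measurable_sets[OF SL_proj_measurable S] by (auto simp: S'_def)
  have "F \<inter> lattice_of -` E = S" using F_SL by (auto simp: S_def)
  then have "C * emeasure SL_haar S \<le> 1" using emeasure_mu[OF E] by (metis measure_le_1)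
  then have "C * emeasure lborel S' \<noteq> top"
    by (auto simp: S'_def emeasure_SL_haar[OF S] top_unique)
  then have "emeasure lborel S' \<noteq> top" using C_pos by (auto simp: ennreal_mult_eq_top_iff)
  then have "emeasure lborel S' < \<infinity>" by (simp add: less_top)
  then obtain \<delta> where \<delta>: "\<delta> > 0"
    "\<And>t. \<bar>t\<bar> < \<delta> \<Longrightarrow> emeasure lborel {g. transvection i j t ** g \<in> S' \<and> g \<notin> S'} \<le> e"
    using lborel_transvection_continuity[OF S' _ e ij] by blast
  show ?thesis
  proof (intro exI[of _ \<delta>] conjI allI impI)
    fix t assume t: "\<bar>t\<bar> < \<delta>"
    let ?h = "transvection i j t :: real^'n^'n"
    have h: "det ?h = 1" using ij by (rule det_transvection)
    have [measurable]: "E \<in> sets \<mu>" "lattice_act ?h \<in> measurable \<mu> \<mu>"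
      using E h by (auto intro: lattice_act_measurable)
    define U where "U = displaced ?h E"
    have [measurable]: "U \<in> sets \<mu>" unfolding U_def displaced_def by measurable
    \<comment> \<open>If x is in F and its lattice enters E, then h x is brought back to F by some
      \<gamma>, and x \<gamma> lies in Y. So the number of translates of x in Y bounds the indicator
      of U, and unfolding turns this number into the mass of Y.\<close>
    define Y where "Y = {y. ?h ** y \<in> S \<and> y \<notin> S}"
    have Y [measurable]: "Y \<in> sets borel" unfolding Y_def by measurable
    have sub: "SL_cone \<inter> SL_proj -` Y \<subseteq> {g. ?h ** g \<in> S' \<and> g \<notin> S'}"
      using SL_proj_mult[of ?h "mat 1"] h by (auto simp: Y_def S'_def SL_cone_def det_mul)
    have S'_diff: "{g. ?h ** g \<in> S' \<and> g \<notin> S'} \<in> sets borel" by measurable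
    have "emeasure \<mu> U = C * (\<integral>\<^sup>+x. indicator F x * indicator U (lattice_map x) \<partial>SL_haar)"
      using nn_integral_mu[of "indicator U"] by simp
    also have "\<dots> \<le> C * (\<integral>\<^sup>+x. indicator F x * (\<integral>\<^sup>+\<gamma>. indicator Y (x ** \<gamma>) \<partial>count_space SL_int) \<partial>SL_haar)"
    proof (rule mult_left_mono, rule nn_integral_mono)
      fix x :: "real^'n^'n"
      show "indicator F x * indicator U (lattice_map x) \<le> indicator F x * (\<integral>\<^sup>+\<gamma>. indicator Y (x ** \<gamma>) \<partial>count_space SL_int :: ennreal)"
      proof (cases "x \<in> F \<and> lattice_map x \<in> U")
        case True
        then have x: "det x = 1" and xU: "lattice_of (?h ** x) \<in> E" "lattice_of x \<notin> E"
          using F_SL by (auto simp: U_def displaced_def)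
        have "?h ** x \<in> SL_real" using x h by (simp add: SL_real_def det_mul)
        then obtain \<gamma> where \<gamma>: "\<gamma> \<in> SL_int" "?h ** x ** \<gamma> \<in> F"
          using F unfolding fundamental_domain_SL_def by blast
        then have "x ** \<gamma> \<in> Y"
          using xU x h F_SL
          by (simp add: Y_def S_def det_mul SL_int_subset matrix_mul_assoc lattice_of_mult_SL_int)
        then have "(\<integral>\<^sup>+\<delta>. indicator {\<gamma>} \<delta> \<partial>count_space SL_int) \<le> (\<integral>\<^sup>+\<gamma>. indicator Y (x ** \<gamma>) \<partial>count_space SL_int :: ennreal)"
          by (intro nn_integral_mono) (auto simp: indicator_def)
        moreover have "(\<integral>\<^sup>+\<delta>. indicator {\<gamma>} \<delta> \<partial>count_space SL_int) = (1::ennreal)"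
          using \<gamma> by (subst nn_integral_indicator) auto
        ultimately show ?thesis using True by simp
      qed (auto simp: indicator_def)
    qed simp
    also have "\<dots> = C * (\<integral>\<^sup>+x. indicator Y x \<partial>SL_haar)"
      by (subst fundamental_domain_unfold[OF F]) auto
    also have "\<dots> = C * emeasure lborel (SL_cone \<inter> SL_proj -` Y)"
      by (simp add: emeasure_SL_haar)
    also have "\<dots> \<le> C * emeasure lborel {g. ?h ** g \<in> S' \<and> g \<notin> S'}"
      using sub S'_diff by (intro mult_left_mono emeasure_mono) auto
    also have "\<dots> \<le> C * e" using \<delta>(2)[OF t] by (intro mult_left_mono) auto
    finally show "emeasure \<mu> (displaced ?h E) \<le> C * e" by (simp add: U_def)
  qed (rule \<delta>(1))
qed

text \<open>Conjugation by the diagonal matrix multiplies the parameter t by a_j/a_i, and invariance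
  of E makes the displaced mass q(t) insensitive to this. Going forward or backward, whichever
  contracts, brings t arbitrarily close to 0, where q is arbitrarily small; hence q(t) = 0.\<close>

lemma mautner:
  assumes E: "E \<in> sets \<mu>" and inv: "\<And>\<Lambda>. \<Lambda> \<in> space \<mu> \<Longrightarrow> lattice_act (diag_matrix a) \<Lambda> \<in> E \<longleftrightarrow> \<Lambda> \<in> E"
    and a: "det (diag_matrix a) = 1" "\<And>r. a r > 0" and ij: "i \<noteq> j" "a i \<noteq> a j"
  shows "AE \<Lambda> in \<mu>. lattice_act (transvection i j t) \<Lambda> \<in> E \<longrightarrow> \<Lambda> \<in> E"
proof -
  define q where "q t = emeasure \<mu> (displaced (transvection i j t) E)" for t
  have [measurable]: "E \<in> sets \<mu>" "lattice_act (transvection i j t) \<in> measurable \<mu> \<mu>"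
      "lattice_act (diag_matrix a) \<in> measurable \<mu> \<mu>" for t
    using E ij a by (auto intro: lattice_act_measurable simp: det_transvection)
  have conj: "transvection i j t ** diag_matrix a = diag_matrix a ** transvection i j (t * (a j / a i))" for t
    using a(2)[of i] by (auto simp: mult_diag_matrix diag_matrix_mult transvection_def vec_eq_iff)
  have q_step: "q t = q (t * (a j / a i))" for t
  proof -
    let ?V = "displaced (transvection i j t) E"
    have V: "?V \<in> sets \<mu>" unfolding displaced_def by measurable
    have "q t = emeasure (distr \<mu> \<mu> (lattice_act (diag_matrix a))) ?V"
      using distr_lattice_act[of "diag_matrix a"] a(1) by (simp add: q_def)
    also have "\<dots> = emeasure \<mu> (lattice_act (diag_matrix a) -` ?V \<inter> space \<mu>)"
      by (rule emeasure_distr[OF _ V]) measurable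
    also have "lattice_act (diag_matrix a) -` ?V \<inter> space \<mu> =
      displaced (transvection i j (t * (a j / a i))) E"
    proof -
      have "lattice_act (transvection i j t) (lattice_act (diag_matrix a) \<Lambda>) \<in> E \<longleftrightarrow>
          lattice_act (transvection i j (t * (a j / a i))) \<Lambda> \<in> E" if "\<Lambda> \<in> space \<mu>" for \<Lambda>
      proof -
        have "lattice_act (transvection i j (t * (a j / a i))) \<Lambda> \<in> space \<mu>"
          using that by (rule measurable_space[rotated]) measurable
        from inv[OF this] show ?thesis by (simp only: lattice_act_act conj)
      qed
      moreover have "lattice_act (diag_matrix a) \<Lambda> \<in> space \<mu>" if "\<Lambda> \<in> space \<mu>" for \<Lambda>
        using that by (rule measurable_space[rotated]) measurable
      ultimately show ?thesis using inv by (auto simp: displaced_def)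
    qed
    finally show ?thesis by (simp add: q_def)
  qed
  have q_pow: "q t = q (t * (a j / a i) ^ k)" for t k
  proof (induction k)
    case (Suc k)
    have "t * (a j / a i) ^ k * (a j / a i) = t * (a j / a i) ^ Suc k" by simp
    then show ?case using q_step[of "t * (a j / a i) ^ k"] Suc by (metis (no_types))
  qed simp
  have q_pow': "q t = q (t * (a i / a j) ^ k)" for t k
  proof -
    have "t * (a i / a j) ^ k * (a j / a i) ^ k = t"
      using a(2)[of i] a(2)[of j] by (simp add: power_divide)
    then show ?thesis using q_pow[of "t * (a i / a j) ^ k" k] by (metis (no_types))
  qed
  have "\<exists>r. 0 \<le> r \<and> r < 1 \<and> (\<forall>t k. q t = q (t * r ^ k))"
  proof (cases "a j < a i")
    case True
    then show ?thesis using a(2)[of i] a(2)[of j]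
      by (intro exI[of _ "a j / a i"] conjI allI q_pow) (auto simp: less_eq_real_def)
  next
    case False
    then show ?thesis using a(2)[of i] a(2)[of j] ij
      by (intro exI[of _ "a i / a j"] conjI allI q_pow') (auto simp: less_eq_real_def)
  qed
  then obtain r where r: "0 \<le> r" "r < 1" "\<And>t k. q t = q (t * r ^ k)" by blast
  have small: "q t \<le> C * ennreal e" if e: "e > 0" for e
  proof -
    obtain \<delta> where \<delta>: "\<delta> > 0" "\<And>t. \<bar>t\<bar> < \<delta> \<Longrightarrow> q t \<le> C * ennreal e"
      using transvection_continuity[OF E e ij(1)] by (auto simp: q_def)
    have "(\<lambda>k. t * r ^ k) \<longlonglongrightarrow> t * 0"
      using r by (intro tendsto_mult tendsto_const LIMSEQ_power_zero) auto
    then obtain k0 where "\<forall>k\<ge>k0. norm (t * r ^ k - t * 0) < \<delta>"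
      using LIMSEQ_D[OF _ \<delta>(1)] by blast
    then obtain k where "\<bar>t * r ^ k\<bar> < \<delta>" by auto
    then show ?thesis using \<delta>(2)[of "t * r ^ k"] by (subst r(3)[of t k]) simp
  qed
  have "q t = 0"
  proof (rule ccontr)
    assume "q t \<noteq> 0"
    have fin: "q t < \<infinity>"
      by (simp add: q_def less_top[symmetric])
    define c where "c = enn2real C"
    have Cc: "C = ennreal c" "c > 0"
      using C_pos C_finite by (auto simp: c_def enn2real_positive_iff)
    define b where "b = enn2real (q t)"
    have qb: "q t = ennreal b" "b > 0"
      using \<open>q t \<noteq> 0\<close> fin by (auto simp: b_def enn2real_positive_iff zero_less_iff_neq_zero)
    have "ennreal b \<le> ennreal (b / 2)"
      using small[of "b / (2 * c)"] Cc qb by (simp add: ennreal_mult[symmetric])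
    then show False using qb by (simp add: ennreal_le_iff)
  qed
  then show ?thesis
    unfolding q_def by (intro AE_I[where N="displaced (transvection i j t) E"]) (auto simp: displaced_def)
qed

text \<open>It suffices that one entry, at \<open>p\<close>, differs from all others:
  \<open>mautner\<close> handles the transvections that involve p, and commutators of these supply
  the rest.\<close>

lemma diagonal_ergodic:
  assumes E: "E \<in> sets \<mu>" and inv: "lattice_act (diag_matrix a) -` E \<inter> space \<mu> = E"
    and a: "det (diag_matrix a) = 1" "\<And>r. a r > 0" and p: "\<And>i. i \<noteq> p \<Longrightarrow> a i \<noteq> a p"
  shows "prob E = 0 \<or> prob E = 1"
proof -
  define Inv where "Inv h \<longleftrightarrow> (AE \<Lambda> in \<mu>. lattice_act h \<Lambda> \<in> E \<longleftrightarrow> \<Lambda> \<in> E)" for h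
  have inv': "lattice_act (diag_matrix a) \<Lambda> \<in> E \<longleftrightarrow> \<Lambda> \<in> E" if "\<Lambda> \<in> space \<mu>" for \<Lambda>
    using inv that by auto
  have Inv_mult: "Inv (h ** k)" if "Inv h" "Inv k" "det k = 1" for h k
  proof -
    have "AE \<Lambda> in \<mu>. lattice_act h (lattice_act k \<Lambda>) \<in> E \<longleftrightarrow> lattice_act k \<Lambda> \<in> E"
      using that(1,3) unfolding Inv_def by (intro AE_lattice_act) auto
    then show ?thesis using that(2) unfolding Inv_def
      by eventually_elim (simp add: lattice_act_act)
  qed
  have Inv1: "Inv (transvection i j t)" if "i \<noteq> j" "a i \<noteq> a j" for i j t
  proof -
    have m: "AE \<Lambda> in \<mu>. lattice_act (transvection i j t) \<Lambda> \<in> E \<longrightarrow> \<Lambda> \<in> E" for t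
      by (rule mautner[OF E _ a that]) (rule inv')
    have "AE \<Lambda> in \<mu>. lattice_act (transvection i j (-t)) (lattice_act (transvection i j t) \<Lambda>) \<in> E \<longrightarrow>
        lattice_act (transvection i j t) \<Lambda> \<in> E"
      using that by (intro AE_lattice_act[OF m]) (auto simp: det_transvection)
    then show ?thesis using m[of t] unfolding Inv_def
      by eventually_elim (use that in \<open>auto simp: lattice_act_act transvection_add transvection_0 lattice_act_def[of "mat 1"]\<close>)
  qed
  have Inv2: "Inv (transvection i j t)" if ij: "i \<noteq> j" for i j t
  proof (cases "i = p \<or> j = p")
    case True
    then show ?thesis using Inv1[OF ij] p ij by metis
  next
    case False
    \<comment> \<open>The commutator relation [E_ip(t), E_pj(1)] = E_ij(t), with i, j, p
      distinct.\<close>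
    have "transvection i p t ** transvection p j 1 ** transvection i p (-t) ** transvection p j (-1) = transvection i j t"
      unfolding mult_transvection using False ij by (auto simp: transvection_def vec_eq_iff)
    then have "transvection i j t = transvection i p t ** (transvection p j 1 ** (transvection i p (-t) ** transvection p j (-1)))"
      by (simp add: matrix_mul_assoc)
    moreover have "a i \<noteq> a p" "a p \<noteq> a j" using False p[of i] p[of j] by auto
    ultimately show ?thesis
      using False by (auto intro!: Inv_mult Inv1 simp: det_mul det_transvection)
  qed
  have Inv_SL: "Inv h" if "det h = 1" for h
  proof -
    have "transvection_product h" using that by (simp add: transvection_product_iff_det_1)
    then show ?thesis
    proof induction
      case one
      then show ?case by (simp add: Inv_def lattice_act_def)
    next
      case (step i j g x)
      then show ?case by (auto intro!: Inv_mult Inv2 simp: det_transvection_product)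
    qed
  qed
  have Em [measurable]: "E \<in> sets \<mu>" by (rule E)
  define X where "X = lattice_map -` E"
  have X [measurable]: "X \<in> sets borel"
    using measurable_sets[OF lattice_map_measurable E] by (simp add: X_def)
  interpret N: sigma_finite_measure "SL_haar :: (real^'n^'n) measure" by (rule sigma_finite_SL_haar)
  interpret P: pair_sigma_finite "SL_haar :: (real^'n^'n) measure" "SL_haar :: (real^'n^'n) measure" ..
  \<comment> \<open>The exceptional null set of lattices depends on h, and there are uncountably
    many h. Fubini reverses the quantifiers, so that a single x serves for almost every h; right
    translation by x then shows that membership in X is almost everywhere constant.\<close>
  have "AE h in SL_haar. AE x in SL_haar. h ** x \<in> X \<longleftrightarrow> x \<in> X"
    using AE_SL_haar_det
  proof eventually_elim
    case (elim h)
    have [measurable]: "lattice_act h \<in> measurable \<mu> \<mu>" using elim by (auto intro: lattice_act_measurable)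
    have "AE x in SL_haar. lattice_act h (lattice_map x) \<in> E \<longleftrightarrow> lattice_map x \<in> E"
      using Inv_SL[OF elim] unfolding Inv_def by (subst (asm) AE_lattice_map_iff) auto
    then show ?case using AE_SL_haar_det
      by eventually_elim (use elim in \<open>auto simp: X_def lattice_map_left\<close>)
  qed
  then have "AE x in SL_haar. AE h in SL_haar. h ** x \<in> X \<longleftrightarrow> x \<in> X"
    by (subst (asm) P.AE_commute) measurable
  then have AE_x: "AE x in SL_haar. det x = 1 \<and> (AE h in SL_haar. h ** x \<in> X \<longleftrightarrow> x \<in> X)"
    using AE_SL_haar_det by eventually_elim auto
  have "emeasure SL_haar (UNIV :: (real^'n^'n) set) > 0"
    by (rule emeasure_SL_haar_open_pos[of _ "mat 1"]) auto
  then have nonzero: "\<not> (AE x in (SL_haar :: (real^'n^'n) measure). False)"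
    by (auto simp: AE_iff_measurable[OF _ refl])
  have "\<exists>x :: real^'n^'n. det x = 1 \<and> (AE h in SL_haar. h ** x \<in> X \<longleftrightarrow> x \<in> X)"
  proof (rule ccontr)
    assume none: "\<not> ?thesis"
    from AE_x have "AE x in (SL_haar :: (real^'n^'n) measure). False"
      by (rule eventually_mono) (use none in blast)
    then show False using nonzero by simp
  qed
  then obtain x :: "real^'n^'n" where x: "det x = 1" "AE h in SL_haar. h ** x \<in> X \<longleftrightarrow> x \<in> X"
    by blast
  have "(\<integral>\<^sup>+h. indicator {h. \<not> (h \<in> X \<longleftrightarrow> x \<in> X)} (h ** x) \<partial>SL_haar) = (\<integral>\<^sup>+h. 0 \<partial>(SL_haar :: (real^'n^'n) measure))"
    using x(2) by (intro nn_integral_cong_AE) (auto simp: indicator_def)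
  moreover have "(\<integral>\<^sup>+h. indicator {h. \<not> (h \<in> X \<longleftrightarrow> x \<in> X)} (h ** x) \<partial>SL_haar) =
      (\<integral>\<^sup>+h. indicator {h. \<not> (h \<in> X \<longleftrightarrow> x \<in> X)} h \<partial>SL_haar)"
    by (rule nn_integral_SL_haar_right[OF _ x(1)]) measurable
  ultimately have "(\<integral>\<^sup>+h. indicator {h. \<not> (h \<in> X \<longleftrightarrow> x \<in> X)} h \<partial>SL_haar) = 0" by simp
  then have AE: "AE h in SL_haar. h \<in> X \<longleftrightarrow> x \<in> X"
    by (subst (asm) nn_integral_0_iff_AE) (measurable, auto simp: indicator_def split: if_splits)
  show ?thesis
  proof (cases "x \<in> X")
    case True
    then have "AE h in SL_haar. lattice_map h \<in> E" using AE by (simp add: X_def)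
    then have "AE \<Lambda> in \<mu>. \<Lambda> \<in> E" by (subst AE_lattice_map_iff) auto
    then show ?thesis by (simp add: prob_eq_1)
  next
    case False
    then have "AE h in SL_haar. lattice_map h \<notin> E" using AE by (simp add: X_def)
    then have "AE \<Lambda> in \<mu>. \<Lambda> \<notin> E" by (subst AE_lattice_map_iff) auto
    then show ?thesis by (simp add: prob_eq_0)
  qed
qed

end

section \<open>Counting lattice points\<close>

lemma finite_int_vectors_bounded:
  fixes R :: real
  assumes "R \<ge> 0"
  defines "Z \<equiv> {z :: real^'n \<in> int_vectors. \<forall>i. \<bar>z $ i\<bar> \<le> R}"
  shows "finite Z" "real (card Z) \<le> (2 * R + 1) ^ CARD('n)"
proof -
  let ?I = "{- \<lfloor>R\<rfloor>..\<lfloor>R\<rfloor>}"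
  let ?P = "(UNIV :: 'n set) \<rightarrow>\<^sub>E ?I"
  have sub: "Z \<subseteq> (\<lambda>f. \<chi> i. of_int (f i)) ` ?P"
  proof
    fix z assume z: "z \<in> Z"
    then have "\<forall>i. \<exists>k. z $ i = of_int k" by (auto simp: Z_def int_vectors_def elim!: Ints_cases)
    then obtain f where f: "\<And>i. z $ i = of_int (f i)" by metis
    have "f i \<in> ?I" for i
    proof -
      have "\<bar>of_int (f i)\<bar> \<le> R" using z by (simp add: Z_def flip: f)
      then have "f i \<le> \<lfloor>R\<rfloor>" "- f i \<le> \<lfloor>R\<rfloor>" by (auto simp: le_floor_iff)
      then show ?thesis by auto
    qed
    then have "f \<in> ?P" by auto
    moreover have "z = (\<chi> i. of_int (f i))" using f by (simp add: vec_eq_iff)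
    ultimately show "z \<in> (\<lambda>f. \<chi> i. of_int (f i)) ` ?P" by blast
  qed
  have fin: "finite ?P" by (simp add: finite_PiE)
  show "finite Z" using sub fin finite_surj by blast
  have "card Z \<le> card ?P" using sub fin by (rule surj_card_le[rotated])
  also have "card ?P = nat (2 * \<lfloor>R\<rfloor> + 1) ^ CARD('n)" by (simp add: card_PiE)
  finally have "real (card Z) \<le> real (nat (2 * \<lfloor>R\<rfloor> + 1)) ^ CARD('n)"
    by (metis of_nat_le_iff of_nat_power)
  also have "\<dots> \<le> (2 * R + 1) ^ CARD('n)"
    using assms(1) of_int_floor_le[of R] by (intro power_mono) auto
  finally show "real (card Z) \<le> (2 * R + 1) ^ CARD('n)" .
qed

lemma finite_lattice_bounded:
  assumes "det g = 1" "bounded B"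
  shows "finite (lattice_of g \<inter> B)"
proof -
  obtain R where R: "\<And>v. v \<in> B \<Longrightarrow> norm v \<le> R" using assms(2) by (auto simp: bounded_iff)
  define R' where "R' = onorm ((*v) (adjugate g)) * \<bar>R\<bar>"
  have "R' \<ge> 0" unfolding R'_def by (simp add: onorm_pos_le)
  have "lattice_of g \<inter> B \<subseteq> (\<lambda>v. g *v v) ` {z \<in> int_vectors. \<forall>i. \<bar>z $ i\<bar> \<le> R'}"
  proof
    fix v assume v: "v \<in> lattice_of g \<inter> B"
    then obtain z where z: "z \<in> int_vectors" "v = g *v z" by (auto simp: lattice_of_def)
    have "z = adjugate g *v v" using assms(1) z by (simp add: matrix_vector_mul_assoc mult_adjugate)
    then have "norm z \<le> onorm ((*v) (adjugate g)) * norm v"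
      using onorm[OF matrix_vector_mul_bounded_linear, of "adjugate g" v] by simp
    also have "\<dots> \<le> R'" unfolding R'_def using R[of v] v
      by (intro mult_left_mono) (auto simp: onorm_pos_le)
    finally have "\<bar>z $ i\<bar> \<le> R'" for i using component_le_norm_cart[of z i] by linarith
    then show "v \<in> (\<lambda>v. g *v v) ` {z \<in> int_vectors. \<forall>i. \<bar>z $ i\<bar> \<le> R'}" using z by blast
  qed
  then show ?thesis using finite_int_vectors_bounded(1)[OF \<open>R' \<ge> 0\<close>] finite_surj by blast
qed

lemma inj_matrix_vector_mult: "det g = 1 \<Longrightarrow> inj ((*v) (g :: real^'n^'n))"
  by (rule inj_on_inverseI[of _ "(*v) (adjugate g)"]) (simp add: matrix_vector_mul_assoc mult_adjugate)

text \<open>The Siegel transform of the indicator of B. Summing over integer vectors rather than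
  lattice points keeps the index set fixed and countable while g varies, which makes Tonelli's
  theorem available.\<close>

abbreviation orbit_count :: "(real^'n) set \<Rightarrow> real^'n^'n \<Rightarrow> ennreal" where
  "orbit_count B g \<equiv> \<integral>\<^sup>+z. indicator B (g *v z) \<partial>count_space int_vectors"

lemma card_lattice_eq_nn_integral:
  assumes g: "det g = 1" and B: "bounded B"
  shows "ennreal (real (card (lattice_of g \<inter> B))) = orbit_count B g"
proof -
  let ?Z = "{z \<in> int_vectors. g *v z \<in> B}"
  have inj: "inj_on ((*v) g) ?Z" using inj_matrix_vector_mult[OF g] by (rule inj_on_subset) simp
  have img: "(*v) g ` ?Z = lattice_of g \<inter> B" by (auto simp: lattice_of_def)
  then have fin: "finite ?Z" using finite_lattice_bounded[OF g B] finite_image_iff[OF inj] by simp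
  have "orbit_count B g = (\<integral>\<^sup>+z. indicator ?Z z \<partial>count_space int_vectors)"
    by (intro nn_integral_cong) (auto simp: indicator_def)
  also have "\<dots> = ennreal (real (card ?Z))"
    using fin by (subst nn_integral_indicator) (auto simp: emeasure_count_space_finite ennreal_of_nat_eq_real_of_nat)
  also have "card ?Z = card (lattice_of g \<inter> B)" using card_image[OF inj] img by simp
  finally show ?thesis ..
qed

lemma borel_measurable_lattice_count:
  assumes [measurable]: "B \<in> sets borel"
  shows "orbit_count (B :: (real^'n) set) \<in> borel_measurable borel"
proof (cases "finite (int_vectors :: (real^'n) set)")
  case True
  then show ?thesis by (simp add: nn_integral_count_space_finite)
next
  case False
  then have "bij_betw (from_nat_into int_vectors) UNIV (int_vectors :: (real^'n) set)"
    by (rule bij_betw_from_nat_into[OF countable_int_vectors])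
  then have "orbit_count B g =
     (\<Sum>n. indicator B (g *v from_nat_into int_vectors n) :: ennreal)" for g :: "real^'n^'n"
    by (subst nn_integral_bij_count_space[symmetric]) (auto simp: nn_integral_count_space_nat)
  then show ?thesis by simp
qed

lemma (in lattice_space) lattice_count_measurable [measurable]:
  assumes "B \<in> sets borel" "bounded B"
  shows "(\<lambda>\<Lambda>. real (card (\<Lambda> \<inter> B))) \<in> borel_measurable \<mu>"
proof (rule measurable_muI)
  show "(\<lambda>g :: real^'n^'n. enn2real (orbit_count B g)) \<in> borel_measurable borel"
    using borel_measurable_lattice_count[OF assms(1)] by measurable
  show "real (card (lattice_of x \<inter> B)) = enn2real (orbit_count B x)"
    if "det x = 1" for x
    by (simp flip: card_lattice_eq_nn_integral[OF that assms(2)])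
qed

lemma matrix_prod_Basis: "(\<Prod>b\<in>Basis. f b) = (\<Prod>i\<in>UNIV. \<Prod>k\<in>UNIV. f (axis i (axis k 1) :: real^'n^'m))"
proof -
  have B: "(Basis :: (real^'n^'m) set) = (\<lambda>(i, k). axis i (axis k 1)) ` (UNIV \<times> UNIV)"
    by (auto simp: Basis_vec_def)
  show ?thesis
    unfolding B
    by (subst prod.reindex) (auto simp: inj_on_def axis_eq_axis prod.cartesian_product case_prod_unfold)
qed

lemma mem_cbox_matrix:
  "(g :: real^'n^'m) \<in> cbox a b \<longleftrightarrow> (\<forall>i k. a $ i $ k \<le> g $ i $ k \<and> g $ i $ k \<le> b $ i $ k)"
  by (auto simp: mem_box Basis_vec_def)

text \<open>Replacing the column of \<open>g\<close> at the largest coordinate of \<open>z\<close> by \<open>g z\<close> is a right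
  multiplication by a matrix of determinant \<open>1\<close>, up to a scalar.\<close>

lemma emeasure_matrices_mapping_into_box:
  fixes z :: "real^'n" and r :: "'n \<Rightarrow> real"
  assumes zk: "z $ k \<noteq> 0" and r: "\<And>i. r i \<ge> 0"
    and E: "E \<in> sets borel" "\<And>g i l. g \<in> E \<Longrightarrow> \<bar>g $ i $ l\<bar> \<le> 2" "\<And>g i. g \<in> E \<Longrightarrow> \<bar>(g *v z) $ i\<bar> \<le> r i"
  shows "emeasure lborel (E :: (real^'n^'n) set) \<le>
     ennreal (\<Prod>i\<in>UNIV. 2 * r i / \<bar>z $ k\<bar> * 4 ^ (CARD('n) - 1))"
proof -
  define S :: "real^'n^'n" where "S = (\<chi> i j. if j = k then z $ i / z $ k else if i = j then 1 else 0)"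
  have "det (\<chi> i j. if j = k then (mat 1 *v ((1 / z $ k) *\<^sub>R z)) $ i else mat 1 $ i $ j) =
      ((1 / z $ k) *\<^sub>R z) $ k * det (mat 1 :: real^'n^'n)"
    by (rule cramer_lemma)
  also have "(\<chi> i j. if j = k then (mat 1 *v ((1 / z $ k) *\<^sub>R z)) $ i else mat 1 $ i $ j) = S"
    unfolding matrix_vector_mul_lid by (auto simp: S_def vec_eq_iff mat_def)
  finally have detS: "det S = 1" using zk by simp
  have gS: "(g ** S) $ i $ j = (if j = k then (g *v z) $ i / z $ k else g $ i $ j)" for g :: "real^'n^'n" and i j
    by (auto simp: S_def matrix_matrix_mult_def matrix_vector_mult_def sum_divide_distrib
        if_distrib[where f="\<lambda>y. _ * y"] sum.delta cong: if_cong)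
  define B :: "real^'n^'n" where "B = (\<chi> i j. if j = k then r i / \<bar>z $ k\<bar> else 2)"
  have "E \<subseteq> (\<lambda>g. g ** S) -` cbox (- B) B"
  proof
    fix g assume g: "g \<in> E"
    have "\<bar>(g *v z) $ i / z $ k\<bar> \<le> r i / \<bar>z $ k\<bar>" for i
      using E(3)[OF g, of i] by (simp add: abs_divide divide_right_mono)
    then have "\<bar>(g ** S) $ i $ j\<bar> \<le> B $ i $ j" for i j
      using E(2)[OF g, of i j] by (simp add: gS B_def)
    then have "- B $ i $ j \<le> (g ** S) $ i $ j \<and> (g ** S) $ i $ j \<le> B $ i $ j" for i j
      by (simp add: abs_le_iff minus_le_iff)
    then show "g \<in> (\<lambda>g. g ** S) -` cbox (- B) B" by (simp add: mem_cbox_matrix)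
  qed
  moreover have meas: "(\<lambda>g. g ** S) \<in> borel_measurable borel" by measurable
  ultimately have "emeasure lborel E \<le> emeasure lborel ((\<lambda>g. g ** S) -` cbox (- B) B)"
    using measurable_sets[OF meas, of "cbox (- B) B"] by (intro emeasure_mono) auto
  also have "\<dots> = emeasure (distr lborel borel (\<lambda>g. g ** S)) (cbox (- B) B)"
    by (subst emeasure_distr) auto
  also have "\<dots> = emeasure lborel (cbox (- B) B)"
    using detS by (subst lborel_right_mult) auto
  also have "\<dots> = ennreal (\<Prod>b\<in>Basis. (B - (- B)) \<bullet> b)"
  proof (rule emeasure_lborel_cbox)
    fix b :: "real^'n^'n" assume "b \<in> Basis"
    then obtain i j where "b = axis i (axis j 1)" by (auto simp: Basis_vec_def)
    then show "- B \<bullet> b \<le> B \<bullet> b" using r[of i] by (auto simp: B_def intro: order_trans[of _ 0])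
  qed
  also have "(\<Prod>b\<in>Basis. (B - (- B)) \<bullet> b) = (\<Prod>i\<in>UNIV. \<Prod>j\<in>UNIV. 2 * B $ i $ j)"
    by (simp add: matrix_prod_Basis)
  also have "\<dots> = (\<Prod>i\<in>UNIV. 2 * r i / \<bar>z $ k\<bar> * 4 ^ (CARD('n) - 1))"
  proof (rule prod.cong)
    fix i :: 'n
    have "(\<Prod>j\<in>UNIV. 2 * B $ i $ j) = 2 * B $ i $ k * (\<Prod>j\<in>UNIV-{k}. 2 * B $ i $ j)"
      by (simp add: prod.remove[of _ k])
    also have "(\<Prod>j\<in>UNIV-{k}. 2 * B $ i $ j) = (\<Prod>j\<in>UNIV-{k}. 4)"
      by (intro prod.cong) (auto simp: B_def)
    also have "\<dots> = 4 ^ (CARD('n) - 1)" by (simp add: card_Diff_singleton)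
    finally show "(\<Prod>j\<in>UNIV. 2 * B $ i $ j) = 2 * r i / \<bar>z $ k\<bar> * 4 ^ (CARD('n) - 1)"
      by (simp add: B_def)
  qed simp
  finally show ?thesis .
qed

section \<open>The flow renormalising the cusp region\<close>

definition flow_entry :: "('d::finite) option \<Rightarrow> real" where
  "flow_entry = case_option (1 / 2) (\<lambda>_. root CARD('d) 2)"

definition flow_matrix :: "nat \<Rightarrow> real^('d::finite option)^('d option)" where
  "flow_matrix j = diag_matrix (\<lambda>r. flow_entry r ^ j)"

lemma flow_entry_simps [simp]:
  "flow_entry None = 1 / 2" "flow_entry (Some (i :: 'd::finite)) = root CARD('d) 2"
  by (simp_all add: flow_entry_def)

lemma root_CARD_power [simp]: "x \<ge> 0 \<Longrightarrow> root CARD('d::finite) x ^ CARD('d) = x"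
  by (simp add: real_root_pow_pos2)

lemma prod_UNIV_option: "(\<Prod>r\<in>UNIV. f r) = f None * (\<Prod>i\<in>UNIV. f (Some (i :: 'd::finite)))"
  by (simp add: UNIV_option_conv prod.reindex)

lemma det_flow_matrix [simp]: "det (flow_matrix j :: real^('d::finite option)^('d option)) = 1"
  by (simp add: flow_matrix_def det_diag_matrix prod_UNIV_option power_divide flip: power_mult)
    (simp add: mult.commute[of j] power_mult)

lemma flow_matrix_mult: "flow_matrix i ** flow_matrix j = flow_matrix (i + j)"
  by (auto simp: flow_matrix_def mult_diag_matrix power_add) (simp add: diag_matrix_def vec_eq_iff)

lemma funpow_lattice_act_flow:
  fixes \<Lambda> :: "(real^('d::finite option)) set"
  shows "(lattice_act (flow_matrix 1) ^^ j) \<Lambda> = lattice_act (flow_matrix j) \<Lambda>"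
proof (induction j)
  case 0
  have "flow_matrix 0 = (mat 1 :: real^('d option)^('d option))" by (simp add: flow_matrix_def diag_matrix_def mat_def vec_eq_iff)
  then show ?case by (simp add: lattice_act_def)
next
  case (Suc j)
  then show ?case by (simp add: lattice_act_act flow_matrix_mult)
qed

lemma first_part_flow: "first_part (flow_matrix j *v v) = root CARD('d::finite) 2 ^ j *\<^sub>R first_part (v :: real^('d option))"
  and last_coord_flow: "last_coord (flow_matrix j *v v) = (1 / 2) ^ j * last_coord v"
  by (auto simp: first_part_def last_coord_def flow_matrix_def diag_matrix_def matrix_vector_mult_def vec_eq_iff
      if_distrib[where f="\<lambda>y. y * _"] sum.delta cong: if_cong)

lemma P_dir_set_UNIV: "P_dir_set c UNIV T = P_set c T"
  by (simp add: P_dir_set_def)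

text \<open>The flow leaves both ||v_1||^d v_2 and the direction of v_1 unchanged and divides v_2 by
  2^j. Hence it carries the layer 2^j < v_2 <= 2^(j+1) onto the layer 1 < v_2 <= 2.\<close>

lemma flow_mem_P_dir_set:
  fixes v :: "real^('d::finite option)"
  shows "flow_matrix j *v v \<in> P_dir_set c D 2 \<longleftrightarrow> v \<in> P_dir_set c D (2 ^ Suc j) \<and> 2 ^ j < last_coord v"
proof -
  let ?s = "root CARD('d) 2 ^ j"
  have s: "?s > 0" by simp
  have sd: "?s ^ CARD('d) = 2 ^ j"
    by (metis mult.commute power_mult root_CARD_power zero_le_numeral)
  have e1: "norm (?s *\<^sub>R first_part v) ^ CARD('d) * ((1 / 2) ^ j * last_coord v) =
      norm (first_part v) ^ CARD('d) * last_coord v"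
    using s by (simp add: power_mult_distrib sd power_divide)
  have e2: "(?s *\<^sub>R first_part v) /\<^sub>R norm (?s *\<^sub>R first_part v) = first_part v /\<^sub>R norm (first_part v)"
    using s by simp
  have e3: "1 < (1 / 2) ^ j * last_coord v \<longleftrightarrow> 2 ^ j < last_coord v"
    by (simp add: power_divide field_simps)
  have e4: "(1 / 2) ^ j * last_coord v \<le> 2 \<longleftrightarrow> last_coord v \<le> 2 ^ Suc j"
    by (simp add: power_divide field_simps)
  have e5: "2 ^ j < last_coord v \<Longrightarrow> 1 < last_coord v"
    by (rule le_less_trans[of _ "2 ^ j"]) auto
  show ?thesis
    unfolding P_dir_set_def P_set_def mem_Collect_eq first_part_flow last_coord_flow e1 e2 e3 e4
    using e5 by blast
qed

lemma borel_measurable_first_part [measurable]: "first_part \<in> borel_measurable borel"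
  unfolding first_part_def[abs_def]
  by (intro borel_measurable_continuous_onI continuous_on_vec_lambda continuous_intros)

lemma borel_measurable_last_coord [measurable]: "last_coord \<in> borel_measurable borel"
  unfolding last_coord_def[abs_def] by (intro borel_measurable_continuous_onI continuous_intros)

lemma P_dir_set_borel [measurable]:
  assumes [measurable]: "D \<in> sets borel"
  shows "P_dir_set c D T \<in> sets borel"
  unfolding P_dir_set_def P_set_def by measurable

text \<open>From v_2 > 1 follows ||v_1||^d <= c; the crude bound 1 + |c| avoids taking a
  root.\<close>

lemma norm_first_part_le:
  assumes "v \<in> P_set c T"
  shows "norm (first_part (v :: real^('d::finite option))) \<le> 1 + \<bar>c\<bar>"
proof (rule ccontr)
  assume "\<not> ?thesis"
  then have gt: "norm (first_part v) > 1 + \<bar>c\<bar>" by simp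
  then have "norm (first_part v) ^ 1 \<le> norm (first_part v) ^ CARD('d)"
    by (intro power_increasing) (auto simp: Suc_leI)
  also have "\<dots> \<le> norm (first_part v) ^ CARD('d) * last_coord v"
    using assms mult_left_mono[of 1 "last_coord v" "norm (first_part v) ^ CARD('d)"] by (simp add: P_set_def)
  also have "\<dots> \<le> c" using assms by (simp add: P_set_def)
  finally show False using gt by simp
qed

lemma bounded_P_dir_set: "bounded (P_dir_set c D T :: (real^('d::finite option)) set)"
proof (rule boundedI)
  fix v :: "real^('d option)" assume v: "v \<in> P_dir_set c D T"
  have "\<bar>v $ r\<bar> \<le> 1 + \<bar>c\<bar> + \<bar>T\<bar>" for r
  proof (cases r)
    case None
    then show ?thesis using v by (auto simp: P_dir_set_def P_set_def last_coord_def)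
  next
    case (Some i)
    have "\<bar>first_part v $ i\<bar> \<le> norm (first_part v)" by (rule component_le_norm_cart)
    also have "\<dots> \<le> 1 + \<bar>c\<bar>" using v by (intro norm_first_part_le) (auto simp: P_dir_set_def)
    finally show ?thesis using Some by (simp add: first_part_def)
  qed
  then have "(\<Sum>r\<in>UNIV. \<bar>v $ r\<bar>) \<le> (\<Sum>r\<in>(UNIV :: 'd option set). 1 + \<bar>c\<bar> + \<bar>T\<bar>)"
    by (intro sum_mono)
  then show "norm v \<le> (\<Sum>r\<in>(UNIV :: 'd option set). 1 + \<bar>c\<bar> + \<bar>T\<bar>)"
    using norm_le_l1_cart[of v] by linarith
qed

lemma P_set_borel [measurable]: "P_set c T \<in> sets borel"
  using P_dir_set_borel[of UNIV c T] by (simp add: P_dir_set_UNIV)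

lemma bounded_P_set: "bounded (P_set c T :: (real^('d::finite option)) set)"
  using bounded_P_dir_set[of c UNIV T] by (simp add: P_dir_set_UNIV)

lemma card_lattice_act_Int:
  assumes "det h = 1"
  shows "card (lattice_act h \<Lambda> \<inter> B) = card {v \<in> \<Lambda>. h *v v \<in> B}"
proof -
  have "lattice_act h \<Lambda> \<inter> B = (*v) h ` {v \<in> \<Lambda>. h *v v \<in> B}" by (auto simp: lattice_act_def)
  then show ?thesis
    using card_image[OF inj_on_subset[OF inj_matrix_vector_mult[OF assms] subset_UNIV], of "{v \<in> \<Lambda>. h *v v \<in> B}"] by simp
qed

lemma N_dir_count_eq_birkhoff_sum:
  fixes g :: "real^('d::finite option)^('d option)"
  assumes g: "det g = 1"
  shows "N_dir_count c (lattice_of g) (2 ^ k) D =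
    (\<Sum>j<k. card ((lattice_act (flow_matrix 1) ^^ j) (lattice_of g) \<inter> P_dir_set c D 2))"
proof (induction k)
  case 0
  \<comment> \<open>The layers start at 2^0 = 1, and the strict inequality 1 < v_2 leaves nothing
    below the first one.\<close>
  have "P_dir_set c D 1 = {}" by (auto simp: P_dir_set_def P_set_def)
  then show ?case by (simp add: N_dir_count_def)
next
  case (Suc k)
  let ?A = "lattice_of g \<inter> P_dir_set c D (2 ^ k)"
  let ?B = "{v \<in> lattice_of g. flow_matrix k *v v \<in> P_dir_set c D 2}"
  have fin: "finite (lattice_of g \<inter> P_dir_set c D T)" for T
    by (rule finite_lattice_bounded[OF g bounded_P_dir_set])
  have eq: "lattice_of g \<inter> P_dir_set c D (2 ^ Suc k) = ?A \<union> ?B"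
  proof -
    have "last_coord v \<le> 2 ^ k \<Longrightarrow> last_coord v \<le> 2 ^ Suc k" for v :: "real^('d option)"
      by (rule order_trans[of _ "2 ^ k"]) auto
    then show ?thesis
      unfolding flow_mem_P_dir_set by (auto simp: P_dir_set_def P_set_def not_less)
  qed
  have "?A \<inter> ?B = {}" unfolding flow_mem_P_dir_set by (auto simp: P_dir_set_def P_set_def)
  moreover have "finite (?A \<union> ?B)" using fin[of "2 ^ Suc k"] unfolding eq .
  then have "finite ?A" "finite ?B" by auto
  ultimately have "card (lattice_of g \<inter> P_dir_set c D (2 ^ Suc k)) = card ?A + card ?B"
    unfolding eq by (intro card_Un_disjoint)
  then show ?case
    using Suc card_lattice_act_Int[OF det_flow_matrix, of k "lattice_of g" "P_dir_set c D 2"]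
    by (simp add: N_dir_count_def funpow_lattice_act_flow del: lattice_act_lattice_of One_nat_def)
qed

section \<open>Uniform bounds for the counts near the identity\<close>

lemma SL_proj_eq_scaleR:
  assumes "g \<in> SL_cone"
  obtains s where "SL_proj g = s *\<^sub>R g" "1 / 2 \<le> s" "s \<le> 2"
proof
  let ?s = "det g powr (- 1 / real CARD('a))"
  show p: "SL_proj g = ?s *\<^sub>R g" by (simp add: SL_proj_def)
  have "det g \<noteq> 0" using assms by (auto simp: SL_cone_def)
  then have "g \<noteq> 0" using det_scaleR[of 0 g] by (auto simp: power_0_left)
  then show "1 / 2 \<le> ?s" "?s \<le> 2" using norm_SL_proj[OF assms] by (auto simp: p)
qed

text \<open>With radius 1/(4n), multiplication by g changes each coordinate of z by at most a
  quarter of its largest coordinate, see \<open>identity_nbhd_mult\<close>. Staying in the shell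
  keeps the scaling factor of \<open>SL_proj\<close> between 1/2 and 2.\<close>

definition identity_nbhd :: "(real^'n^'n) set" where
  "identity_nbhd = SL_cone \<inter> ball (mat 1) (1 / (4 * real CARD('n)))"

lemma open_identity_nbhd: "open identity_nbhd"
  by (simp add: identity_nbhd_def open_SL_cone open_Int)

lemma identity_nbhd_borel [measurable]: "identity_nbhd \<in> sets borel"
  by (rule borel_open[OF open_identity_nbhd])

lemma mat_1_in_identity_nbhd: "mat 1 \<in> identity_nbhd"
  by (simp add: identity_nbhd_def SL_cone_def)

lemma identity_nbhd_entry:
  fixes g :: "real^'n^'n"
  assumes "g \<in> identity_nbhd"
  shows "\<bar>g $ i $ l - mat 1 $ i $ l\<bar> \<le> 1 / (4 * real CARD('n))" "\<bar>g $ i $ l\<bar> \<le> 2"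
proof -
  have "\<bar>(g - mat 1) $ i $ l\<bar> \<le> norm ((g - mat 1) $ i)" by (rule component_le_norm_cart)
  also have "\<dots> \<le> norm (g - mat 1)" by (rule Finite_Cartesian_Product.norm_nth_le)
  also have "\<dots> \<le> 1 / (4 * real CARD('n))"
    using assms by (simp add: identity_nbhd_def dist_norm norm_minus_commute)
  finally show *: "\<bar>g $ i $ l - mat 1 $ i $ l\<bar> \<le> 1 / (4 * real CARD('n))" by simp
  also have "\<dots> \<le> 1" by (simp add: field_simps) (metis One_nat_def Suc_leI mult_le_mono zero_less_card_finite one_le_numeral of_nat_1 of_nat_le_iff mult_1 of_nat_mult of_nat_numeral)
  finally show "\<bar>g $ i $ l\<bar> \<le> 2" by (auto simp: mat_def abs_le_iff split: if_splits)
qed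

lemma identity_nbhd_mult:
  fixes g :: "real^'n^'n" and z :: "real^'n"
  assumes g: "g \<in> identity_nbhd" and z: "\<And>l. \<bar>z $ l\<bar> \<le> q"
  shows "\<bar>(g *v z) $ i - z $ i\<bar> \<le> q / 4"
proof -
  have "(g *v z) $ i - z $ i = ((g - mat 1) *v z) $ i"
    by (simp add: matrix_vector_mult_diff_rdistrib)
  also have "\<dots> = (\<Sum>l\<in>UNIV. (g $ i $ l - mat 1 $ i $ l) * z $ l)"
    by (simp add: matrix_vector_mult_def)
  also have "\<bar>\<dots>\<bar> \<le> (\<Sum>l\<in>UNIV. \<bar>(g $ i $ l - mat 1 $ i $ l) * z $ l\<bar>)" by (rule sum_abs)
  also have "\<dots> \<le> (\<Sum>l\<in>(UNIV :: 'n set). 1 / (4 * real CARD('n)) * q)"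
    unfolding abs_mult using identity_nbhd_entry(1)[OF g] z by (intro sum_mono mult_mono) auto
  also have "\<dots> = q / 4" by simp
  finally show ?thesis .
qed

text \<open>An integer vector z contributes only if its largest coordinate is comparable to 2^j, so
  about 2^(jn) vectors matter. For each of them the matrices g sending z into the pulled-back region
  have volume of order 2^(-jn), because that region has sides of order 2^j in one direction and
  2^(-j/d) in d directions, so its volume stays bounded, and the column replacement divides by the
  n-th power of the largest coordinate of z. The two factors cancel.\<close>

lemma flow_count_integral_bounded:
  fixes c :: real
  assumes c: "c > 0"
  shows "\<exists>B::real. \<forall>j. (\<integral>\<^sup>+g. indicator identity_nbhd g *
     orbit_count (P_set c 2) (flow_matrix j ** SL_proj g)
       \<partial>(lborel :: (real^('d::finite option)^('d option)) measure)) \<le> ennreal B"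
proof -
  let ?n = "CARD('d option)" and ?d = "CARD('d)"
  have n: "?n = Suc ?d" by simp
  let ?K = "identity_nbhd :: (real^('d option)^('d option)) set"
  let ?P = "P_set c 2 :: (real^('d option)) set"
  \<comment> \<open>Twice the bound on the sides \<open>r i\<close> in units of 2^j; a relevant
    integer vector has coordinates of at most \<beta> 2^j.\<close>
  define \<beta> where "\<beta> = 2 * (4 + 2 * root ?d c)"
  have root_c: "root ?d c \<ge> 0" using c by simp
  then have \<beta>: "\<beta> \<ge> 0" by (simp add: \<beta>_def)
  \<comment> \<open>The factor 8 * 4^d * c is the product of the sides 2 \<open>r i\<close>, from
    which j drops out. The power of 4^(n-1) comes from the entries outside the replaced column, each
    confined to an interval of length 4, and the last 4^n from the lower bound 2^j/4 for the largest
    coordinate of z.\<close>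
  define M where "M = 8 * 4 ^ ?d * c * (4 ^ (?n - 1)) ^ ?n * 4 ^ ?n"
  have M: "M \<ge> 0" using c by (simp add: M_def)
  have "(\<integral>\<^sup>+g. indicator ?K g *
     orbit_count ?P (flow_matrix j ** SL_proj g) \<partial>lborel)
       \<le> ennreal (M * (2 * \<beta> + 1) ^ ?n)" for j
  proof -
    define W where "W z = {g \<in> ?K. (flow_matrix j ** SL_proj g) *v z \<in> ?P}" for z :: "real^('d option)"
    have W_borel [measurable]: "W z \<in> sets borel" for z unfolding W_def by measurable
    let ?b = "root ?d (c / 2 ^ j)"
    have b_nonneg: "?b \<ge> 0" using c by simp
    have b_pow: "?b ^ ?d = c / 2 ^ j" using c by simp
    have b_le: "?b \<le> root ?d c * 2 ^ j"
    proof -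
      have "?b \<le> root ?d c" using c by (simp add: divide_le_eq)
      also have "\<dots> \<le> root ?d c * 2 ^ j" using root_c by (simp add: mult_le_cancel_left1)
      finally show ?thesis .
    qed
    \<comment> \<open>The pulled-back region has last coordinate at most 2 * 2^j and first part of
      norm at most \<open>?b\<close>. Both bounds are doubled because passing from
      \<open>SL_proj g\<close> back to g may cost a factor 2.\<close>
    define r where "r = case_option (4 * 2 ^ j) (\<lambda>_ :: 'd. 2 * ?b)"
    have r_nonneg: "r i \<ge> 0" for i using b_nonneg by (cases i) (auto simp: r_def)
    have r_le: "r i \<le> (4 + 2 * root ?d c) * 2 ^ j" for i
    proof (cases i)
      case None
      then show ?thesis using root_c by (simp add: r_def distrib_right)
    next
      case (Some k)
      have "(0::real) \<le> 4 * 2 ^ j" by simp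
      moreover have "r i = 2 * ?b" using Some by (simp add: r_def)
      ultimately show ?thesis using b_le by (simp only: distrib_right mult.assoc)
    qed
    have in_W: "\<bar>(g *v z) $ i\<bar> \<le> r i" "2 ^ j / 2 \<le> \<bar>(g *v z) $ None\<bar>" if g: "g \<in> W z" for g z i
    proof -
      have gK: "g \<in> SL_cone" using g by (auto simp: W_def identity_nbhd_def)
      obtain s where s: "SL_proj g = s *\<^sub>R g" "1 / 2 \<le> s" "s \<le> 2" by (rule SL_proj_eq_scaleR[OF gK])
      define v where "v = s *\<^sub>R (g *v z)"
      have "flow_matrix j *v v \<in> P_dir_set c UNIV 2"
        using g by (simp add: W_def P_dir_set_UNIV v_def s(1) matrix_vector_mul_assoc[symmetric] scaleR_matrix_vector_assoc)
      then have v: "v \<in> P_set c (2 ^ Suc j)" "2 ^ j < last_coord v"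
        unfolding flow_mem_P_dir_set by (auto simp: P_dir_set_UNIV)
      have vN: "2 ^ j < v $ None" "v $ None \<le> 2 * 2 ^ j"
        using v by (auto simp: P_set_def last_coord_def)
      have vs: "\<bar>v $ i\<bar> \<le> ?b" if i: "i \<noteq> None" for i
      proof -
        obtain k where k: "i = Some k" using i by auto
        have "norm (first_part v) ^ ?d * 2 ^ j \<le> norm (first_part v) ^ ?d * last_coord v"
          using v(2) by (intro mult_left_mono) auto
        also have "\<dots> \<le> c" using v(1) by (simp add: P_set_def)
        finally have "norm (first_part v) ^ ?d \<le> c / 2 ^ j" by (simp add: field_simps)
        then have "root ?d (norm (first_part v) ^ ?d) \<le> ?b" by simp
        then have "norm (first_part v) \<le> ?b" by (simp add: real_root_power_cancel)
        then show ?thesis using component_le_norm_cart[of "first_part v" k] by (simp add: k first_part_def)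
      qed
      have w: "\<bar>v $ i\<bar> = s * \<bar>(g *v z) $ i\<bar>" for i using s(2) by (simp add: v_def abs_mult)
      have w_le: "\<bar>(g *v z) $ i\<bar> \<le> 2 * \<bar>v $ i\<bar>" for i
        using mult_right_mono[OF s(2), of "\<bar>(g *v z) $ i\<bar>"] by (simp add: w)
      show "\<bar>(g *v z) $ i\<bar> \<le> r i"
        using w_le[of i] vN vs[of i] by (cases i) (auto simp: r_def)
      show "2 ^ j / 2 \<le> \<bar>(g *v z) $ None\<bar>"
        using mult_right_mono[OF s(3), of "\<bar>(g *v z) $ None\<bar>"] w[of None] vN by simp
    qed
    define Z where "Z = {z :: real^('d option) \<in> int_vectors. \<forall>i. \<bar>z $ i\<bar> \<le> \<beta> * 2 ^ j}"
    have Z: "finite Z" "real (card Z) \<le> (2 * (\<beta> * 2 ^ j) + 1) ^ ?n"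
      unfolding Z_def by (rule finite_int_vectors_bounded; use \<beta> in simp)+
    have W_bound: "emeasure lborel (W z) \<le> ennreal (M / (2 ^ j) ^ ?n) * indicator Z z" if z: "z \<in> int_vectors" for z
    proof (cases "W z = {}")
      case False
      then obtain g0 where g0: "g0 \<in> W z" by auto
      then have g0K: "g0 \<in> identity_nbhd" by (auto simp: W_def)
      have "Max (range (\<lambda>i. \<bar>z $ i\<bar>)) \<in> range (\<lambda>i. \<bar>z $ i\<bar>)" by (rule Max_in) auto
      then obtain k where k: "Max (range (\<lambda>i. \<bar>z $ i\<bar>)) = \<bar>z $ k\<bar>" by blast
      \<comment> \<open>The largest coordinate q is comparable to 2^j: the last coordinate of g0 z
        is at least 2^j/2 in absolute value and at most 2q, while coordinate k of g0 z is at least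
        3q/4 and is bounded by the box.\<close>
      define q where "q = \<bar>z $ k\<bar>"
      have zq: "\<bar>z $ i\<bar> \<le> q" for i
        unfolding q_def k[symmetric] by (rule Max_ge) auto
      note near = identity_nbhd_mult[OF g0K zq]
      have "\<bar>(g0 *v z) $ None\<bar> \<le> 2 * q" using near[of None] zq[of None] by linarith
      then have q_lower: "2 ^ j / 4 \<le> q" using in_W(2)[OF g0] by linarith
      then have q_pos: "q > 0" by (rule less_le_trans[rotated]) simp
      have "q \<le> 2 * \<bar>(g0 *v z) $ k\<bar>" using near[of k] unfolding q_def by linarith
      also have "\<dots> \<le> 2 * r k" using in_W(1)[OF g0, of k] by simp
      also have "\<dots> \<le> \<beta> * 2 ^ j" using r_le[of k] unfolding \<beta>_def mult.assoc by linarith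
      finally have "\<bar>z $ i\<bar> \<le> \<beta> * 2 ^ j" for i using zq[of i] by linarith
      then have zZ: "z \<in> Z" using z by (simp add: Z_def)
      have "emeasure lborel (W z) \<le> ennreal (\<Prod>i\<in>UNIV. 2 * r i / \<bar>z $ k\<bar> * 4 ^ (?n - 1))"
      proof (rule emeasure_matrices_mapping_into_box)
        show "z $ k \<noteq> 0" using q_pos by (simp add: q_def)
        show "\<bar>g $ i $ l\<bar> \<le> 2" if "g \<in> W z" for g i l
          using that by (intro identity_nbhd_entry) (auto simp: W_def)
      qed (use r_nonneg in_W(1) in auto)
      also have "(\<Prod>i\<in>UNIV. 2 * r i / \<bar>z $ k\<bar> * 4 ^ (?n - 1)) \<le> M / (2 ^ j) ^ ?n"
      proof -
        have "(\<Prod>i\<in>UNIV. 2 * r i / \<bar>z $ k\<bar> * 4 ^ (?n - 1)) = (\<Prod>i\<in>UNIV. 2 * r i) / q ^ ?n * (4 ^ (?n - 1)) ^ ?n"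
          by (simp only: prod.distrib prod_dividef prod_constant q_def)
        also have "(\<Prod>i\<in>UNIV. 2 * r i) = 8 * 4 ^ ?d * c"
          by (simp only: prod_UNIV_option r_def option.case prod_constant) (simp add: power_mult_distrib b_pow)
        also have "8 * 4 ^ ?d * c / q ^ ?n * (4 ^ (?n - 1)) ^ ?n \<le> 8 * 4 ^ ?d * c / (2 ^ j / 4) ^ ?n * (4 ^ (?n - 1)) ^ ?n"
          using q_lower q_pos c
          by (intro mult_right_mono divide_left_mono power_mono mult_pos_pos zero_less_power) auto
        also have "\<dots> = M / (2 ^ j) ^ ?n" by (simp add: M_def power_divide)
        finally show ?thesis .
      qed
      finally show ?thesis using zZ by (simp add: ennreal_leI)
    qed simp
    have "(\<integral>\<^sup>+g. indicator ?K g *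
      orbit_count ?P (flow_matrix j ** SL_proj g) \<partial>lborel)
      = (\<integral>\<^sup>+g. (\<integral>\<^sup>+z. indicator (W z) g \<partial>count_space int_vectors) \<partial>lborel)"
      by (intro nn_integral_cong) (simp add: nn_integral_cmult[symmetric] W_def indicator_def if_distrib)
    also have "\<dots> = (\<integral>\<^sup>+z. (\<integral>\<^sup>+g. indicator (W z) g \<partial>lborel) \<partial>count_space int_vectors)"
      by (intro nn_integral_count_space_nn_integral countable_int_vectors) measurable
    also have "\<dots> \<le> (\<integral>\<^sup>+z. ennreal (M / (2 ^ j) ^ ?n) * indicator Z z \<partial>count_space int_vectors)"
      using W_bound by (intro nn_integral_mono) auto
    also have "\<dots> = ennreal (M / (2 ^ j) ^ ?n) * real (card Z)"
      using Z(1) by (subst nn_integral_cmult_indicator)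
        (auto simp: Z_def emeasure_count_space_finite ennreal_of_nat_eq_real_of_nat)
    also have "\<dots> = ennreal (M / (2 ^ j) ^ ?n * real (card Z))"
      using M by (intro ennreal_mult[symmetric]) auto
    also have "\<dots> \<le> ennreal (M * (2 * \<beta> + 1) ^ ?n)"
    proof (rule ennreal_leI)
      have "2 * (\<beta> * 2 ^ j) + 1 \<le> (2 * \<beta> + 1) * 2 ^ j" by (simp add: distrib_right)
      then have "(2 * (\<beta> * 2 ^ j) + 1) ^ ?n \<le> ((2 * \<beta> + 1) * 2 ^ j) ^ ?n"
        using \<beta> by (intro power_mono) auto
      with Z(2) have "real (card Z) \<le> ((2 * \<beta> + 1) * 2 ^ j) ^ ?n" by linarith
      then have "M / (2 ^ j) ^ ?n * real (card Z) \<le> M / (2 ^ j) ^ ?n * ((2 * \<beta> + 1) * 2 ^ j) ^ ?n"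
        using M by (intro mult_left_mono) auto
      also have "\<dots> = M * (2 * \<beta> + 1) ^ ?n" by (simp add: power_mult_distrib)
      finally show "M / (2 ^ j) ^ ?n * real (card Z) \<le> M * (2 * \<beta> + 1) ^ ?n" .
    qed
    finally show ?thesis .
  qed
  then show ?thesis by blast
qed

section \<open>Integrability of the counting functions\<close>

text \<open>This form covers predicates whose measurability is not at hand, such as convergence of
  averages.\<close>

lemma (in lattice_space) AE_lattice_map:
  assumes "AE \<Lambda> in \<mu>. P \<Lambda>"
  shows "AE x in SL_haar. P (lattice_map x)"
proof -
  obtain N where N: "N \<in> null_sets \<mu>" "{\<Lambda> \<in> space \<mu>. \<not> P \<Lambda>} \<subseteq> N"
    using assms by (auto elim!: AE_E simp: null_sets_def)
  have [measurable]: "N \<in> sets \<mu>" using N(1) by auto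
  have "AE x in SL_haar. lattice_map x \<notin> N"
    using AE_not_in[OF N(1)] by (subst (asm) AE_lattice_map_iff) auto
  then show ?thesis
    by eventually_elim (use N(2) lattice_map_in_space in blast)
qed

lemma liminf_le_bound:
  fixes u :: "nat \<Rightarrow> ennreal"
  assumes "\<And>n. u n \<le> B"
  shows "liminf u \<le> B"
  using assms by (intro order_trans[OF Liminf_le_Limsup Limsup_bounded]) auto

lemma AE_SL_proj:
  assumes "AE x in SL_haar. Q x"
  shows "AE g in lborel. g \<in> SL_cone \<longrightarrow> Q (SL_proj g)"
proof -
  have "AE g in density lborel (indicator SL_cone). Q (SL_proj g)"
    using assms unfolding SL_haar_def by (rule AE_distrD[rotated]) simp
  then show ?thesis by (subst (asm) AE_density) (auto simp: indicator_def)
qed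

locale flow_space = lattice_space \<mu> C F
  for \<mu> :: "(real^('d::finite option)) set measure" and C F
begin

abbreviation flow :: "(real^('d option)) set \<Rightarrow> (real^('d option)) set" where
  "flow \<equiv> lattice_act (flow_matrix 1)"

lemma flow_measurable [measurable]: "flow \<in> measurable \<mu> \<mu>"
  by (rule lattice_act_measurable) simp

lemma birkhoff_flow:
  fixes f :: "(real^('d option)) set \<Rightarrow> real"
  assumes "integrable \<mu> f"
  shows "AE \<Lambda> in \<mu>. (\<lambda>n. (\<Sum>i<n. f ((flow ^^ i) \<Lambda>)) / real n) \<longlonglongrightarrow> expectation f"
proof (rule birkhoff_ergodic[OF flow_measurable _ _ assms])
  show "distr \<mu> \<mu> flow = \<mu>" by (rule distr_lattice_act) simp
  fix E assume E: "E \<in> sets \<mu>" "flow -` E \<inter> space \<mu> = E"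
  have flow1: "flow_matrix 1 = (diag_matrix flow_entry :: real^('d option)^('d option))"
    by (simp add: flow_matrix_def)
  show "prob E = 0 \<or> prob E = 1"
  proof (rule diagonal_ergodic[OF E(1), of flow_entry None])
    show "lattice_act (diag_matrix flow_entry) -` E \<inter> space \<mu> = E" using E(2) by (simp only: flow1)
    show "det (diag_matrix (flow_entry :: 'd option \<Rightarrow> real)) = 1"
      using det_flow_matrix[of 1, where 'd='d] by (simp only: flow1)
    show "flow_entry r > 0" for r :: "'d option" by (cases r) auto
    fix i :: "'d option" assume "i \<noteq> None"
    then obtain k where k: "i = Some k" by auto
    have "root CARD('d) 2 \<ge> 1" by simp
    then show "flow_entry i \<noteq> flow_entry None" unfolding k flow_entry_simps by linarith
  qed
qed

lemma funpow_flow_lattice_map: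
  "det x = 1 \<Longrightarrow> (flow ^^ i) (lattice_map x) = lattice_of (flow_matrix i ** x)"
  unfolding funpow_lattice_act_flow by simp

lemma funpow_flow_measurable [measurable]: "flow ^^ i \<in> measurable \<mu> \<mu>"
  by (induction i) (auto intro: measurable_comp)

text \<open>Birkhoff's theorem asks for integrability, which is what is to be shown; so it is
  applied to truncated counts. Their averages tend to the constant mean for almost every g near the
  identity, and Fatou's lemma bounds this mean by the uniform bound for the untruncated counts,
  divided by the volume of the neighbourhood. The result is independent of M.\<close>

lemma expectation_truncated_count_le:
  fixes c :: real
  assumes c: "c > 0"
  shows "\<exists>B::real. \<forall>M::nat. expectation (\<lambda>\<Lambda>. min (real (card (\<Lambda> \<inter> P_set c 2))) (real M)) \<le> B"
proof -
  let ?P = "P_set c 2 :: (real^('d option)) set"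
  let ?K = "identity_nbhd :: (real^('d option)^('d option)) set"
  note P = P_set_borel[of c 2, where 'a='d] and bP = bounded_P_set[of c 2, where 'd='d]
  obtain B where B: "\<And>j. (\<integral>\<^sup>+g. indicator ?K g *
     orbit_count ?P (flow_matrix j ** SL_proj g) \<partial>lborel) \<le> ennreal B"
    using flow_count_integral_bounded[OF c] by blast
  define l where "l = measure lborel ?K"
  have K_fin: "emeasure lborel ?K < \<infinity>"
  proof -
    have "emeasure lborel ?K \<le> emeasure lborel (ball (mat 1 :: real^('d option)^('d option)) (1 / (4 * real CARD('d option))))"
      by (rule emeasure_mono) (auto simp: identity_nbhd_def)
    then show ?thesis using emeasure_lborel_ball_finite by (rule order_le_less_trans)
  qed
  have Kl: "emeasure lborel ?K = ennreal l"
    using K_fin by (simp add: l_def emeasure_eq_ennreal_measure less_top[symmetric])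
  have l_pos: "l > 0"
    using emeasure_lborel_open_pos[OF open_identity_nbhd] mat_1_in_identity_nbhd Kl
    by (metis empty_iff ennreal_0 ennreal_less_zero_iff ennreal_neg linorder_not_less order_less_irrefl)
  have "expectation (\<lambda>\<Lambda>. min (real (card (\<Lambda> \<inter> ?P))) (real M)) \<le> \<bar>B\<bar> / l" for M :: nat
  proof -
    define f where "f \<Lambda> = min (real (card (\<Lambda> \<inter> ?P))) (real M)" for \<Lambda>
    have f_meas [measurable]: "f \<in> borel_measurable \<mu>"
      unfolding f_def using lattice_count_measurable[OF P bP] by measurable
    have f_nonneg: "f \<Lambda> \<ge> 0" for \<Lambda> by (simp add: f_def)
    have "integrable \<mu> f"
      by (rule integrable_const_bound[of _ "real M"]) (auto simp: f_def)
    note conv = AE_SL_proj[OF AE_lattice_map[OF birkhoff_flow[OF this]]]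
    define u where "u n g = indicator ?K g * ennreal ((\<Sum>i<n. f ((flow ^^ i) (lattice_map (SL_proj g)))) / real n)"
      for n and g :: "real^('d option)^('d option)"
    have u_meas [measurable]: "u n \<in> borel_measurable borel" for n
      unfolding u_def by measurable
    have E_nonneg: "expectation f \<ge> 0" using f_nonneg by (simp add: integral_nonneg_AE)
    have u_int: "(\<integral>\<^sup>+g. u n g \<partial>lborel) \<le> ennreal \<bar>B\<bar>" for n
    proof -
      have "(\<integral>\<^sup>+g. u n g \<partial>lborel) \<le>
        (\<integral>\<^sup>+g. ennreal (1 / real n) * (\<Sum>i<n. indicator ?K g *
          orbit_count ?P (flow_matrix i ** SL_proj g)) \<partial>lborel)"
      proof (rule nn_integral_mono)
        fix g :: "real^('d option)^('d option)"
        show "u n g \<le> ennreal (1 / real n) * (\<Sum>i<n. indicator ?K g *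
          orbit_count ?P (flow_matrix i ** SL_proj g))"
        proof (cases "g \<in> ?K")
          case True
          then have g: "det (SL_proj g) = 1" by (intro det_SL_proj) (auto simp: identity_nbhd_def SL_cone_def)
          have "ennreal (f ((flow ^^ i) (lattice_map (SL_proj g)))) \<le>
             orbit_count ?P (flow_matrix i ** SL_proj g)" for i
          proof -
            have "ennreal (f ((flow ^^ i) (lattice_map (SL_proj g)))) \<le> ennreal (real (card (lattice_of (flow_matrix i ** SL_proj g) \<inter> ?P)))"
              unfolding funpow_flow_lattice_map[OF g] f_def by (intro ennreal_leI) simp
            also have "\<dots> = orbit_count ?P (flow_matrix i ** SL_proj g)"
              by (rule card_lattice_eq_nn_integral[OF _ bP]) (simp add: det_mul g)
            finally show ?thesis .
          qed
          then have "(\<Sum>i<n. ennreal (f ((flow ^^ i) (lattice_map (SL_proj g))))) \<le>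
            (\<Sum>i<n. orbit_count ?P (flow_matrix i ** SL_proj g))"
            by (intro sum_mono)
          moreover have "u n g = ennreal (1 / real n) * (\<Sum>i<n. ennreal (f ((flow ^^ i) (lattice_map (SL_proj g)))))"
            using True f_nonneg by (simp add: u_def sum_ennreal sum_nonneg flip: ennreal_mult)
          ultimately show ?thesis using True by (simp add: mult_left_mono)
        qed (simp add: u_def)
      qed
      also have "\<dots> = ennreal (1 / real n) * (\<Sum>i<n. \<integral>\<^sup>+g. indicator ?K g *
          orbit_count ?P (flow_matrix i ** SL_proj g) \<partial>lborel)"
      proof -
        let ?h = "\<lambda>i g. indicator ?K g * orbit_count ?P (flow_matrix i ** SL_proj g)"
        have [measurable]: "(\<lambda>g. orbit_count ?P (flow_matrix i ** SL_proj g)) \<in> borel_measurable borel" for i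
          by (rule measurable_compose[OF _ borel_measurable_lattice_count[OF P]]) measurable
        have m: "?h i \<in> borel_measurable lborel" for i by measurable
        have "(\<lambda>g. \<Sum>i<n. ?h i g) \<in> borel_measurable lborel" using m by (rule borel_measurable_sum)
        then have "(\<integral>\<^sup>+g. ennreal (1 / real n) * (\<Sum>i<n. ?h i g) \<partial>lborel) = ennreal (1 / real n) * (\<integral>\<^sup>+g. (\<Sum>i<n. ?h i g) \<partial>lborel)"
          by (rule nn_integral_cmult)
        also have "(\<integral>\<^sup>+g. (\<Sum>i<n. ?h i g) \<partial>lborel) = (\<Sum>i<n. \<integral>\<^sup>+g. ?h i g \<partial>lborel)"
          using m by (rule nn_integral_sum)
        finally show ?thesis .
      qed
      also have "\<dots> \<le> ennreal (1 / real n) * (\<Sum>i<n. ennreal \<bar>B\<bar>)"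
        by (intro mult_left_mono sum_mono order_trans[OF B] ennreal_leI) auto
      also have "\<dots> = ennreal (1 / real n * (real n * \<bar>B\<bar>))"
        unfolding sum_constant card_lessThan ennreal_of_nat_eq_real_of_nat by (simp only: ennreal_mult[symmetric] abs_ge_zero of_nat_0_le_iff zero_le_divide_1_iff mult_nonneg_nonneg)
      also have "\<dots> \<le> ennreal \<bar>B\<bar>" by (intro ennreal_leI) auto
      finally show ?thesis .
    qed
    have "ennreal (expectation f) * ennreal l = (\<integral>\<^sup>+g. ennreal (expectation f) * indicator ?K g \<partial>lborel)"
      by (simp add: nn_integral_cmult_indicator Kl)
    \<comment> \<open>On the neighbourhood, u n g tends to the mean of f for almost every g; off it,
      both sides vanish.\<close>
    also have "\<dots> \<le> (\<integral>\<^sup>+g. liminf (\<lambda>n. u n g) \<partial>lborel)"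
    proof (rule nn_integral_mono_AE, use conv in eventually_elim)
      case (elim g)
      show ?case
      proof (cases "g \<in> ?K")
        case True
        then have "(\<lambda>n. (\<Sum>i<n. f ((flow ^^ i) (lattice_map (SL_proj g)))) / real n) \<longlonglongrightarrow> expectation f"
          using elim by (auto simp: identity_nbhd_def)
        then have "(\<lambda>n. u n g) \<longlonglongrightarrow> ennreal (expectation f)"
          using True by (simp add: u_def tendsto_ennrealI)
        then have "liminf (\<lambda>n. u n g) = ennreal (expectation f)" by (intro lim_imp_Liminf) auto
        then show ?thesis using True by simp
      qed simp
    qed
    also have "\<dots> \<le> liminf (\<lambda>n. \<integral>\<^sup>+g. u n g \<partial>lborel)" by (rule nn_integral_liminf) simp
    also have "\<dots> \<le> ennreal \<bar>B\<bar>"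
      using u_int by (rule liminf_le_bound)
    finally have "expectation f * l \<le> \<bar>B\<bar>"
      using E_nonneg l_pos by (simp add: ennreal_le_iff flip: ennreal_mult)
    then show ?thesis using l_pos by (simp add: f_def[abs_def] field_simps)
  qed
  then show ?thesis by blast
qed

text \<open>Letting the truncation level grow, Fatou's lemma gives integrability for all directions
  together; a smaller set of directions is dominated by it.\<close>

lemma integrable_count:
  fixes c :: real
  assumes c: "c > 0" and D: "D \<in> sets borel"
  shows "integrable \<mu> (\<lambda>\<Lambda>. real (card (\<Lambda> \<inter> P_dir_set c D 2)))"
proof -
  let ?P = "P_set c 2 :: (real^('d option)) set"
  note P = P_set_borel[of c 2, where 'a='d] and bP = bounded_P_set[of c 2, where 'd='d]
  have [measurable]: "(\<lambda>\<Lambda>. real (card (\<Lambda> \<inter> ?P))) \<in> borel_measurable \<mu>"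
    by (rule lattice_count_measurable[OF P bP])
  obtain B :: real where B: "\<And>M::nat. expectation (\<lambda>\<Lambda>. min (real (card (\<Lambda> \<inter> ?P))) (real M)) \<le> B"
    using expectation_truncated_count_le[OF c] by blast
  have "(\<integral>\<^sup>+\<Lambda>. ennreal (real (card (\<Lambda> \<inter> ?P))) \<partial>\<mu>) \<le>
     (\<integral>\<^sup>+\<Lambda>. liminf (\<lambda>M. ennreal (min (real (card (\<Lambda> \<inter> ?P))) (real M))) \<partial>\<mu>)"
  proof (rule nn_integral_mono)
    fix \<Lambda>
    have "eventually (\<lambda>M. ennreal (min (real (card (\<Lambda> \<inter> ?P))) (real M)) = ennreal (real (card (\<Lambda> \<inter> ?P)))) sequentially"
      using eventually_ge_at_top[of "card (\<Lambda> \<inter> ?P)"] by eventually_elim simp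
    then have "(\<lambda>M. ennreal (min (real (card (\<Lambda> \<inter> ?P))) (real M))) \<longlonglongrightarrow> ennreal (real (card (\<Lambda> \<inter> ?P)))"
      by (rule tendsto_eventually)
    then have "liminf (\<lambda>M. ennreal (min (real (card (\<Lambda> \<inter> ?P))) (real M))) = ennreal (real (card (\<Lambda> \<inter> ?P)))"
      by (rule lim_imp_Liminf[OF sequentially_bot])
    then show "ennreal (real (card (\<Lambda> \<inter> ?P))) \<le> liminf (\<lambda>M. ennreal (min (real (card (\<Lambda> \<inter> ?P))) (real M)))"
      by simp
  qed
  also have "\<dots> \<le> liminf (\<lambda>M. \<integral>\<^sup>+\<Lambda>. ennreal (min (real (card (\<Lambda> \<inter> ?P))) (real M)) \<partial>\<mu>)"
    by (rule nn_integral_liminf) measurable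
  also have "\<dots> \<le> ennreal B"
  proof (rule liminf_le_bound)
    fix M :: nat
    have "integrable \<mu> (\<lambda>\<Lambda>. min (real (card (\<Lambda> \<inter> ?P))) (real M))"
      by (rule integrable_const_bound[of _ "real M"]) auto
    then show "(\<integral>\<^sup>+\<Lambda>. ennreal (min (real (card (\<Lambda> \<inter> ?P))) (real M)) \<partial>\<mu>) \<le> ennreal B"
      using B[of M] by (subst nn_integral_eq_integral) (auto simp: ennreal_leI)
  qed
  finally have "(\<integral>\<^sup>+\<Lambda>. ennreal (real (card (\<Lambda> \<inter> ?P))) \<partial>\<mu>) < \<infinity>"
    by (rule order_le_less_trans) simp
  then have int: "integrable \<mu> (\<lambda>\<Lambda>. real (card (\<Lambda> \<inter> ?P)))"
    by (intro integrableI_nonneg) auto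
  have meas: "(\<lambda>\<Lambda>. real (card (\<Lambda> \<inter> P_dir_set c D 2))) \<in> borel_measurable \<mu>"
    by (rule lattice_count_measurable[OF P_dir_set_borel[OF D] bounded_P_dir_set])
  show ?thesis
  proof (rule Bochner_Integration.integrable_bound[OF int meas], rule AE_I2)
    fix \<Lambda> assume "\<Lambda> \<in> space \<mu>"
    then obtain x where "\<Lambda> = lattice_of x" "det x = 1" by (rule space_muE)
    then have "finite (\<Lambda> \<inter> ?P)" using finite_lattice_bounded bP by blast
    then have "card (\<Lambda> \<inter> P_dir_set c D 2) \<le> card (\<Lambda> \<inter> ?P)"
      by (rule card_mono) (auto simp: P_dir_set_def)
    then show "norm (real (card (\<Lambda> \<inter> P_dir_set c D 2))) \<le> norm (real (card (\<Lambda> \<inter> ?P)))" by simp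
  qed
qed

end

section \<open>Uniqueness of the rotation-invariant measure on the sphere\<close>

lemma borel_measurable_orthogonal_transformation:
  fixes R :: "real^'d \<Rightarrow> real^'d"
  assumes "orthogonal_transformation R"
  shows "R \<in> borel_measurable borel"
proof -
  have "linear R" using assms by (simp add: orthogonal_transformation_def)
  then show ?thesis
    by (intro borel_measurable_continuous_onI linear_continuous_on) (simp add: linear_conv_bounded_linear)
qed

text \<open>Measures on the sphere are represented on the whole space and carried by the sphere.
  Balls of the ambient space and pushforwards under linear maps can then be used directly.\<close>

locale rotation_invariant_prob = prob_space M for M :: "(real^'d) measure" +
  assumes sets_M: "sets M = sets borel" and sphere: "AE x in M. norm x = 1"
    and rot: "\<And>R. orthogonal_transformation R \<Longrightarrow> distr M borel R = M"
begin

lemma emeasure_ball_const: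
  assumes xy: "norm x = 1" "norm y = 1"
  shows "emeasure M (ball x r) = emeasure M (ball y r)"
proof -
  obtain R where R: "orthogonal_transformation R" "R x = y"
    using orthogonal_transformation_exists[of x y] xy by metis
  have lin: "linear R" using R(1) by (simp add: orthogonal_transformation_def)
  have Rm: "R \<in> measurable M borel"
    using borel_measurable_orthogonal_transformation[OF R(1)] sets_M by (simp cong: measurable_cong_sets)
  have "emeasure M (ball y r) = emeasure (distr M borel R) (ball y r)" using rot[OF R(1)] by simp
  also have "\<dots> = emeasure M (R -` ball y r \<inter> space M)" using Rm by (rule emeasure_distr) simp
  also have "R -` ball y r \<inter> space M = ball x r"
  proof -
    have "dist y (R z) = dist x z" for z
      using orthogonal_transformation_norm[OF R(1), of "x - z"] linear_diff[OF lin, of x z] R(2) by (simp add: dist_norm)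
    moreover have "space M = UNIV" using sets_eq_imp_space_eq[OF sets_M] by simp
    ultimately show ?thesis by auto
  qed
  finally show ?thesis by simp
qed

text \<open>Finitely many balls of radius r cover the sphere, and all have the same mass; were it 0,
  the whole mass would be 0.\<close>

lemma emeasure_ball_pos:
  assumes x: "norm x = 1" and r: "r > 0"
  shows "emeasure M (ball x r) > 0"
proof (rule ccontr)
  assume "\<not> ?thesis"
  then have 0: "emeasure M (ball y r) = 0" if "norm y = 1" for y
    using emeasure_ball_const[OF x that] by simp
  have "compact (sphere (0::real^'d) 1)" by (rule compact_sphere)
  moreover have "sphere (0::real^'d) 1 \<subseteq> (\<Union>y\<in>sphere 0 1. ball y r)" using r by auto
  ultimately obtain T where T: "T \<subseteq> sphere 0 1" "finite T" "sphere (0::real^'d) 1 \<subseteq> (\<Union>y\<in>T. ball y r)"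
    using compactE_image[of "sphere (0::real^'d) 1" "sphere 0 1" "\<lambda>y. ball y r"] by auto
  have "ball y r \<in> null_sets M" if "y \<in> T" for y using that T(1) 0[of y] sets_M by (auto simp: null_sets_def)
  then have "(\<Union>y\<in>T. ball y r) \<in> null_sets M" using T(2) by (intro null_sets.finite_UN) auto
  then have "AE x in M. x \<notin> (\<Union>y\<in>T. ball y r)" by (rule AE_not_in)
  then have "AE x in M. False" using sphere by eventually_elim (use T(3) in auto)
  then show False by simp
qed

end

text \<open>The product measure of the pairs at distance less than r, integrated in either order, is
  the mass of one ball under M or under N.\<close>

lemma emeasure_ball_eq_of_rotation_invariant:
  fixes M N :: "(real^'d) measure"
  assumes "rotation_invariant_prob M" "rotation_invariant_prob N"
    and x: "norm x = 1"
  shows "emeasure M (ball x r) = emeasure N (ball x r)"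
proof -
  interpret M: rotation_invariant_prob M by fact
  interpret N: rotation_invariant_prob N by fact
  interpret P: pair_sigma_finite M N ..
  note [measurable_cong] = M.sets_M N.sets_M
  have ind: "indicator (ball y r) z = (indicator (ball z r) y :: ennreal)" for y z :: "real^'d"
    by (simp add: indicator_def dist_commute)
  have meas: "(\<lambda>(z, y). indicator (ball y r) z :: ennreal) \<in> borel_measurable (M \<Otimes>\<^sub>M N)"
    unfolding ball_def mem_Collect_eq indicator_def by measurable
  have "emeasure M (ball x r) = (\<integral>\<^sup>+y. emeasure M (ball x r) \<partial>N)"
    by (simp add: N.emeasure_space_1)
  also have "\<dots> = (\<integral>\<^sup>+y. (\<integral>\<^sup>+z. indicator (ball y r) z \<partial>M) \<partial>N)"
    using N.sphere by (intro nn_integral_cong_AE, eventually_elim)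
      (simp add: M.sets_M M.emeasure_ball_const[OF x])
  also have "\<dots> = (\<integral>\<^sup>+z. (\<integral>\<^sup>+y. indicator (ball y r) z \<partial>N) \<partial>M)"
    by (rule P.Fubini'[OF meas])
  also have "\<dots> = (\<integral>\<^sup>+z. emeasure N (ball x r) \<partial>M)"
    using M.sphere by (intro nn_integral_cong_AE, eventually_elim)
      (simp add: ind N.sets_M N.emeasure_ball_const[OF x])
  also have "\<dots> = emeasure N (ball x r)" by (simp add: M.emeasure_space_1)
  finally show ?thesis .
qed

text \<open>Christensen's argument: two measures giving all balls of equal radius the same mass are
  compared by differentiating one along the other and using Fatou's lemma.\<close>

lemma emeasure_open_le_of_rotation_invariant:
  fixes M N :: "(real^'d) measure"
  assumes "rotation_invariant_prob M" "rotation_invariant_prob N"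
    and U: "open U"
  shows "emeasure M U \<le> emeasure N U"
proof -
  interpret M: rotation_invariant_prob M by fact
  interpret N: rotation_invariant_prob N by fact
  interpret P: pair_sigma_finite M N ..
  note [measurable_cong] = M.sets_M N.sets_M
  have [measurable]: "U \<in> sets borel" using U by simp
  obtain e :: "real^'d" where e: "norm e = 1" using vector_choose_size[of 1] by auto
  define r where "r n = 1 / real (Suc n)" for n
  have r_pos: "r n > 0" for n by (simp add: r_def)
  define h where "h n = emeasure N (ball e (r n))" for n
  have h_pos: "h n > 0" for n unfolding h_def by (rule N.emeasure_ball_pos[OF e r_pos])
  have h_fin: "h n < \<infinity>" for n by (simp add: h_def less_top[symmetric])
  have hN: "emeasure N (ball x (r n)) = h n" if "norm x = 1" for x n
    unfolding h_def by (rule N.emeasure_ball_const[OF that e])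
  have hM: "emeasure M (ball x (r n)) = h n" if "norm x = 1" for x n
    using hN[OF that] emeasure_ball_eq_of_rotation_invariant[OF assms(1,2) that] by simp
  \<comment> \<open>The density of U in the ball of radius r_n around x, measured by N. On the
    sphere it is eventually 1 at each point of U, since U is open.\<close>
  define u where "u n x = indicator U x * (\<integral>\<^sup>+y. indicator U y * indicator (ball x (r n)) y \<partial>N) / h n" for n x
  have ball_meas [measurable]: "(\<lambda>(x, y). indicator (ball x (r n)) y :: ennreal) \<in> borel_measurable (M \<Otimes>\<^sub>M N)" for n
    unfolding ball_def mem_Collect_eq indicator_def by measurable
  have u_meas [measurable]: "u n \<in> borel_measurable M" for n
    unfolding u_def by measurable
  have "emeasure M U = (\<integral>\<^sup>+x. indicator U x \<partial>M)" using M.sets_M by simp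
  also have "\<dots> \<le> (\<integral>\<^sup>+x. liminf (\<lambda>n. u n x) \<partial>M)"
  proof (rule nn_integral_mono_AE, use M.sphere in eventually_elim)
    case (elim x)
    show ?case
    proof (cases "x \<in> U")
      case True
      then obtain d where d: "d > 0" "ball x d \<subseteq> U" using U open_contains_ball by blast
      obtain n0 where n0: "r n0 < d" using nat_approx_posE[OF d(1)] by (auto simp: r_def)
      have "eventually (\<lambda>n. u n x = 1) sequentially" using eventually_ge_at_top[of n0]
      proof eventually_elim
        case (elim n)
        have "r n \<le> r n0" using elim by (simp add: r_def frac_le)
        then have "ball x (r n) \<subseteq> U" using d n0 by (auto simp: subset_iff)
        then have "(\<integral>\<^sup>+y. indicator U y * indicator (ball x (r n)) y \<partial>N) = (\<integral>\<^sup>+y. indicator (ball x (r n)) y \<partial>N)"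
          by (intro nn_integral_cong) (auto simp: indicator_def)
        also have "\<dots> = h n" using hN[OF \<open>norm x = 1\<close>] by (simp add: N.sets_M)
        finally show ?case using True h_pos[of n] h_fin[of n] by (simp add: u_def ennreal_divide_self)
      qed
      then have "(\<lambda>n. u n x) \<longlonglongrightarrow> 1" by (rule tendsto_eventually)
      then have "liminf (\<lambda>n. u n x) = 1" by (rule lim_imp_Liminf[OF sequentially_bot])
      then show ?thesis by (simp add: indicator_def)
    qed simp
  qed
  also have "\<dots> \<le> liminf (\<lambda>n. \<integral>\<^sup>+x. u n x \<partial>M)" by (rule nn_integral_liminf) simp
  also have "\<dots> \<le> emeasure N U"
  proof -
    have "(\<integral>\<^sup>+x. u n x \<partial>M) \<le> emeasure N U" for n
    proof -
      have "(\<integral>\<^sup>+x. u n x \<partial>M) = (\<integral>\<^sup>+x. (\<integral>\<^sup>+y. indicator U x * indicator U y * indicator (ball x (r n)) y / h n \<partial>N) \<partial>M)"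
        unfolding u_def divide_ennreal_def
        by (intro nn_integral_cong) (simp add: nn_integral_cmult[symmetric] nn_integral_multc[symmetric] mult_ac)
      also have "\<dots> = (\<integral>\<^sup>+y. (\<integral>\<^sup>+x. indicator U x * indicator U y * indicator (ball x (r n)) y / h n \<partial>M) \<partial>N)"
        by (rule P.Fubini'[symmetric]) measurable
      \<comment> \<open>After the exchange the inner integral is at most M(ball y r_n) / h n, which
        is 1 because M and N give this ball the same mass h n.\<close>
      also have "\<dots> \<le> (\<integral>\<^sup>+y. indicator U y \<partial>N)"
      proof (rule nn_integral_mono_AE, use N.sphere in eventually_elim)
        case (elim y)
        have "(\<integral>\<^sup>+x. indicator U x * indicator U y * indicator (ball x (r n)) y / h n \<partial>M) \<le>
            (\<integral>\<^sup>+x. (indicator U y / h n) * indicator (ball y (r n)) x \<partial>M)"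
          by (intro nn_integral_mono) (auto simp: indicator_def dist_commute)
        also have "\<dots> = indicator U y / h n * h n"
          using hM[OF elim, of n] by (simp add: nn_integral_cmult_indicator M.sets_M)
        also have "\<dots> = indicator U y"
          using h_pos[of n] h_fin[of n] by (simp add: ennreal_divide_times mult_divide_eq_ennreal)
        finally show ?case .
      qed
      also have "\<dots> = emeasure N U" by (simp add: N.sets_M)
      finally show ?thesis .
    qed
    then show ?thesis by (intro order_trans[OF Liminf_le_Limsup Limsup_bounded]) auto
  qed
  finally show ?thesis .
qed

lemma rotation_invariant_unique:
  fixes M N :: "(real^'d) measure"
  assumes "rotation_invariant_prob M" "rotation_invariant_prob N"
  shows "M = N"
proof (rule measure_eqI_generator_eq[where E="{S. open S}" and \<Omega>=UNIV and A="\<lambda>_. UNIV"])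
  interpret M: rotation_invariant_prob M by fact
  interpret N: rotation_invariant_prob N by fact
  show "emeasure M X = emeasure N X" if "X \<in> {S. open S}" for X
    using that emeasure_open_le_of_rotation_invariant[OF assms] emeasure_open_le_of_rotation_invariant[OF assms(2,1)]
    by (auto intro: antisym)
  show "Int_stable {S :: (real^'d) set. open S}" by (auto simp: Int_stable_def)
  show "sets M = sigma_sets UNIV {S. open S}" "sets N = sigma_sets UNIV {S. open S}"
    using M.sets_M N.sets_M by (auto simp: borel_def)
  show "emeasure M UNIV \<noteq> \<infinity>" by simp
qed auto

section \<open>Equidistribution of directions\<close>

text \<open>For 2^k <= T <= 2^(k+1), monotonicity puts a T / b T between a(2^k) / b(2^(k+1)) and
  a(2^(k+1)) / b(2^k). Since both counts are normalised by k, the shift of index costs only the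
  factor (k+1)/k.\<close>

lemma tendsto_ratio_of_dyadic:
  fixes a b :: "real \<Rightarrow> real"
  assumes mono: "\<And>s t. s \<le> t \<Longrightarrow> a s \<le> a t" "\<And>s t. s \<le> t \<Longrightarrow> b s \<le> b t"
    and nonneg: "\<And>t. 0 \<le> a t" and \<kappa>: "\<kappa> > 0"
    and a: "(\<lambda>k. a (2 ^ k) / real k) \<longlonglongrightarrow> \<kappa> * \<alpha>" and b: "(\<lambda>k. b (2 ^ k) / real k) \<longlonglongrightarrow> \<kappa>"
  shows "((\<lambda>T. a T / b T) \<longlongrightarrow> \<alpha>) at_top"
proof -
  have Suc_ratio: "(\<lambda>k. real (Suc k) / real k) \<longlonglongrightarrow> 1"
    using LIMSEQ_Suc_n_over_n by (simp add: add.commute)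
  have shift: "(\<lambda>k. f (2 ^ Suc k) / real k) \<longlonglongrightarrow> l" if "(\<lambda>k. f (2 ^ k) / real k) \<longlonglongrightarrow> l"
    for f :: "real \<Rightarrow> real" and l
  proof -
    have "(\<lambda>k. f (2 ^ Suc k) / real (Suc k) * (real (Suc k) / real k)) \<longlonglongrightarrow> l * 1"
      using LIMSEQ_Suc[OF that] Suc_ratio by (rule tendsto_mult)
    moreover have "f (2 ^ Suc k) / real (Suc k) * (real (Suc k) / real k) = f (2 ^ Suc k) / real k" for k
      by (simp del: of_nat_Suc)
    ultimately show ?thesis by simp
  qed
  have "(\<lambda>k. (a (2 ^ k) / real k) / (b (2 ^ Suc k) / real k)) \<longlonglongrightarrow> \<kappa> * \<alpha> / \<kappa>"
    using a shift[OF b] \<kappa> by (intro tendsto_divide) auto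
  then have "(\<lambda>k. (a (2 ^ k) / real k) / (b (2 ^ Suc k) / real k)) \<longlonglongrightarrow> \<alpha>" using \<kappa> by simp
  then have lower: "(\<lambda>k. a (2 ^ k) / b (2 ^ Suc k)) \<longlonglongrightarrow> \<alpha>"
    by (rule Lim_transform_eventually) (use eventually_gt_at_top[of 0] in \<open>eventually_elim, simp\<close>)
  have "(\<lambda>k. (a (2 ^ Suc k) / real k) / (b (2 ^ k) / real k)) \<longlonglongrightarrow> \<kappa> * \<alpha> / \<kappa>"
    using b shift[OF a] \<kappa> by (intro tendsto_divide) auto
  then have "(\<lambda>k. (a (2 ^ Suc k) / real k) / (b (2 ^ k) / real k)) \<longlonglongrightarrow> \<alpha>" using \<kappa> by simp
  then have upper: "(\<lambda>k. a (2 ^ Suc k) / b (2 ^ k)) \<longlonglongrightarrow> \<alpha>"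
    by (rule Lim_transform_eventually) (use eventually_gt_at_top[of 0] in \<open>eventually_elim, simp\<close>)
  define k where "k T = nat \<lfloor>log 2 T\<rfloor>" for T
  have k_lim: "filterlim k at_top at_top"
    unfolding filterlim_at_top
  proof
    fix j :: nat
    show "eventually (\<lambda>T. j \<le> k T) at_top" using eventually_ge_at_top[of "2 ^ j"]
    proof eventually_elim
      case (elim T)
      have "(0::real) < 2 ^ j" by simp
      then have "T > 0" using elim by linarith
      then have "real j \<le> log 2 T" using elim by (simp add: le_log_iff powr_realpow)
      then show ?case by (simp add: k_def le_nat_iff le_floor_iff)
    qed
  qed
  have k_bounds: "2 ^ k T \<le> T" "T \<le> 2 ^ Suc (k T)" if "T \<ge> 1" for T
  proof -
    have l0: "log 2 T \<ge> 0" using that by simp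
    then have k_eq: "real (k T) = of_int \<lfloor>log 2 T\<rfloor>" by (simp add: k_def)
    have "2 ^ k T = 2 powr real (k T)" by (simp add: powr_realpow)
    also have "\<dots> \<le> 2 powr log 2 T" unfolding k_eq by (intro powr_mono) auto
    finally show "2 ^ k T \<le> T" using that by simp
    have "T = 2 powr log 2 T" using that by simp
    also have "\<dots> \<le> 2 powr (real (Suc (k T)))" using k_eq by (intro powr_mono) (auto, linarith)
    also have "\<dots> = 2 ^ Suc (k T)" by (simp add: powr_realpow del: of_nat_Suc)
    finally show "T \<le> 2 ^ Suc (k T)" .
  qed
  have "eventually (\<lambda>j. b (2 ^ j) / real j > 0) sequentially" using b \<kappa> by (rule order_tendstoD)
  then have "eventually (\<lambda>j. b (2 ^ j) > 0) sequentially"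
    by (rule eventually_mono) (simp add: zero_less_divide_iff)
  then have ev: "eventually (\<lambda>T. b (2 ^ k T) > 0) at_top"
    using k_lim by (rule eventually_compose_filterlim)
  show ?thesis
  proof (rule tendsto_sandwich)
    show "((\<lambda>T. a (2 ^ k T) / b (2 ^ Suc (k T))) \<longlongrightarrow> \<alpha>) at_top"
      by (rule filterlim_compose[OF lower k_lim])
    show "((\<lambda>T. a (2 ^ Suc (k T)) / b (2 ^ k T)) \<longlongrightarrow> \<alpha>) at_top"
      by (rule filterlim_compose[OF upper k_lim])
    show "eventually (\<lambda>T. a (2 ^ k T) / b (2 ^ Suc (k T)) \<le> a T / b T) at_top"
      using ev eventually_ge_at_top[of 1]
    proof eventually_elim
      case (elim T)
      note bd = k_bounds[OF elim(2)]
      have "b T > 0" using elim(1) mono(2)[OF bd(1)] by linarith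
      then show ?case using mono(1)[OF bd(1)] mono(2)[OF bd(2)] nonneg by (intro frac_le) auto
    qed
    show "eventually (\<lambda>T. a T / b T \<le> a (2 ^ Suc (k T)) / b (2 ^ k T)) at_top"
      using ev eventually_ge_at_top[of 1]
    proof eventually_elim
      case (elim T)
      note bd = k_bounds[OF elim(2)]
      show ?case using mono(1)[OF bd(2)] mono(2)[OF bd(1)] nonneg elim(1) by (intro frac_le) auto
    qed
  qed
qed

text \<open>The block matrix diag(R, 1), which rotates directions and keeps the last
  coordinate.\<close>

definition rotation_block :: "(real^'d \<Rightarrow> real^'d) \<Rightarrow> real^('d::finite option)^('d option)" where
  "rotation_block R = matrix (\<lambda>v. \<chi> r. case r of None \<Rightarrow> v $ None | Some i \<Rightarrow> R (first_part v) $ i)"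

lemma sum_UNIV_option: "(\<Sum>r\<in>UNIV. f r) = f None + (\<Sum>i\<in>UNIV. f (Some (i :: 'd::finite)))"
  by (simp add: UNIV_option_conv sum.reindex)

lemma rotation_block:
  fixes R :: "real^'d::finite \<Rightarrow> real^'d"
  assumes R: "orthogonal_transformation R"
  shows "first_part (rotation_block R *v v) = R (first_part v)"
    and "last_coord (rotation_block R *v v) = last_coord v"
    and "\<bar>det (rotation_block R)\<bar> = 1"
proof -
  let ?f = "\<lambda>v :: real^('d option). (\<chi> r. case r of None \<Rightarrow> v $ None | Some i \<Rightarrow> R (first_part v) $ i) :: real^('d option)"
  have lin_R: "linear R" using R by (simp add: orthogonal_transformation_def)
  have lin: "linear ?f"
  proof (rule linearI)
    fix x y :: "real^('d option)" and c :: real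
    have fp: "first_part (x + y) = first_part x + first_part y" "first_part (c *\<^sub>R x) = c *\<^sub>R first_part x"
      by (auto simp: first_part_def vec_eq_iff)
    show "?f (x + y) = ?f x + ?f y" "?f (c *\<^sub>R x) = c *\<^sub>R ?f x"
      unfolding fp linear_add[OF lin_R] linear_cmul[OF lin_R] by (auto simp: vec_eq_iff split: option.split)
  qed
  have f: "rotation_block R *v v = ?f v" for v
    unfolding rotation_block_def by (rule matrix_works) (use lin in \<open>simp add: linear_matrix_vector_mul_eq\<close>)
  show "first_part (rotation_block R *v v) = R (first_part v)"
    by (simp add: f) (simp add: first_part_def vec_eq_iff)
  show "last_coord (rotation_block R *v v) = last_coord v"
    by (simp add: f last_coord_def)
  have inner: "x \<bullet> y = x $ None * y $ None + first_part x \<bullet> first_part y" for x y :: "real^('d option)"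
    by (simp add: inner_vec_def sum_UNIV_option first_part_def)
  have "first_part (?f v) = R (first_part v)" for v by (simp add: first_part_def vec_eq_iff)
  then have "?f v \<bullet> ?f w = v \<bullet> w" for v w
    using R by (simp add: inner orthogonal_transformation_def)
  then have "orthogonal_transformation ?f" using lin by (simp add: orthogonal_transformation_def)
  then have "orthogonal_matrix (rotation_block R)"
    unfolding rotation_block_def by (simp add: orthogonal_transformation_matrix)
  then show "\<bar>det (rotation_block R)\<bar> = 1" using det_orthogonal_matrix by fastforce
qed

context flow_space
begin

lemma finite_P_dir:
  assumes "\<Lambda> \<in> space \<mu>"
  shows "finite (\<Lambda> \<inter> P_dir_set c D T)"
proof -
  obtain x where "\<Lambda> = lattice_of x" "det x = 1" using assms by (rule space_muE)
  then show ?thesis using finite_lattice_bounded bounded_P_dir_set by blast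
qed

lemma count_measurable [measurable]:
  "D \<in> sets borel \<Longrightarrow> (\<lambda>\<Lambda>. real (card (\<Lambda> \<inter> P_dir_set c D T))) \<in> borel_measurable \<mu>"
  by (rule lattice_count_measurable[OF P_dir_set_borel bounded_P_dir_set])

section \<open>The mean count as a measure on directions\<close>

definition mean_count :: "real \<Rightarrow> (real^'d) set \<Rightarrow> real" where
  "mean_count c D = expectation (\<lambda>\<Lambda>. real (card (\<Lambda> \<inter> P_dir_set c D 2)))"

lemma mean_count_nonneg: "mean_count c D \<ge> 0"
  by (simp add: mean_count_def)

lemma mean_count_rotation:
  assumes R: "orthogonal_transformation R" and D: "D \<in> sets borel"
  shows "mean_count c (R -` D) = mean_count c D"
proof -
  let ?h = "rotation_block R"
  note h = rotation_block[OF R]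
  have [measurable]: "lattice_act ?h \<in> measurable \<mu> \<mu>" by (rule lattice_act_measurable[OF h(3)])
  have "?h *v v \<in> P_dir_set c D 2 \<longleftrightarrow> v \<in> P_dir_set c (R -` D) 2" for v
  proof -
    have "linear R" using R by (simp add: orthogonal_transformation_def)
    then show ?thesis
      by (simp add: P_dir_set_def P_set_def h orthogonal_transformation_norm[OF R] linear_cmul)
  qed
  then have "lattice_act ?h \<Lambda> \<inter> P_dir_set c D 2 = (*v) ?h ` (\<Lambda> \<inter> P_dir_set c (R -` D) 2)" for \<Lambda>
    by (auto simp: lattice_act_def)
  moreover have "inj ((*v) ?h)"
  proof -
    have "det ?h \<noteq> 0" using h(3) by auto
    then obtain h' where "h' ** ?h = mat 1" using invertible_det_nz[of ?h] by (auto simp: invertible_def)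
    then show ?thesis
      by (intro inj_on_inverseI[of _ "(*v) h'"]) (simp add: matrix_vector_mul_assoc)
  qed
  ultimately have card: "card (lattice_act ?h \<Lambda> \<inter> P_dir_set c D 2) = card (\<Lambda> \<inter> P_dir_set c (R -` D) 2)" for \<Lambda>
    by (simp add: card_image inj_on_subset)
  have "mean_count c D = integral\<^sup>L (distr \<mu> \<mu> (lattice_act ?h)) (\<lambda>\<Lambda>. real (card (\<Lambda> \<inter> P_dir_set c D 2)))"
    by (simp add: mean_count_def distr_lattice_act[OF h(3)])
  also have "\<dots> = expectation (\<lambda>\<Lambda>. real (card (lattice_act ?h \<Lambda> \<inter> P_dir_set c D 2)))"
    using D by (intro integral_distr) auto
  also have "\<dots> = mean_count c (R -` D)" by (simp add: mean_count_def card)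
  finally show ?thesis ..
qed

text \<open>Only a vector with vanishing first part has a direction off the sphere, namely 0 by the
  convention for division by zero. Such vectors count in \<open>N_count\<close> but not for A, so
  they must be negligible: for each of the countably many nonzero integer z, the matrices x with
  coordinate \<open>Some i\<close> of x z equal to 0 form a hyperplane.\<close>

lemma mean_count_off_sphere: "mean_count c (- sphere 0 1) = 0"
proof -
  have D: "- sphere 0 1 \<in> sets (borel :: (real^'d) measure)" by simp
  fix i :: 'd
  have "AE x in SL_haar. (x *v z) $ Some i \<noteq> 0" if z: "z \<noteq> 0" for z :: "real^('d option)"
  proof (rule AE_I')
    let ?E = "{x :: real^('d option)^('d option). (x *v z) $ Some i = 0}"
    have [measurable]: "?E \<in> sets borel" by measurable
    have inner: "(x *v z) $ Some i = axis (Some i) z \<bullet> x" for x :: "real^('d option)^('d option)"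
    proof -
      have "axis (Some i) z \<bullet> x = x $ Some i \<bullet> z" by (simp add: inner_commute[of "axis (Some i) z"] inner_axis)
      then show ?thesis by (simp add: matrix_vector_mult_def inner_vec_def)
    qed
    have "axis (Some i) z \<noteq> (0 :: real^('d option)^('d option))" using z by (simp add: axis_eq_0_iff)
    then have "negligible ?E" unfolding inner by (intro negligible_hyperplane) auto
    then have 0: "emeasure lborel ?E = 0" by (simp add: negligible_iff_emeasure0)
    \<comment> \<open>\<open>SL_proj\<close> only rescales, so the cone over the hyperplane stays in
      the hyperplane.\<close>
    have "SL_cone \<inter> SL_proj -` ?E \<subseteq> ?E"
    proof
      fix g assume g: "g \<in> SL_cone \<inter> SL_proj -` ?E"
      obtain s where s: "SL_proj g = s *\<^sub>R g" "1 / 2 \<le> s" by (rule SL_proj_eq_scaleR[of g]) (use g in auto)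
      have "(SL_proj g *v z) $ Some i = s * (g *v z) $ Some i"
        unfolding s(1) by (simp flip: scaleR_matrix_vector_assoc)
      then show "g \<in> ?E" using g s(2) by auto
    qed
    then have "emeasure lborel (SL_cone \<inter> SL_proj -` ?E) \<le> emeasure lborel ?E" by (rule emeasure_mono) simp
    then show "?E \<in> null_sets SL_haar" using 0 by (intro null_setsI) (auto simp: emeasure_SL_haar)
  qed auto
  then have "AE x in SL_haar. \<forall>z\<in>int_vectors - {0 :: real^('d option)}. (x *v z) $ Some i \<noteq> 0"
    by (subst AE_ball_countable) (auto intro: countable_subset[OF _ countable_int_vectors])
  then have "AE x in (SL_haar :: (real^('d option)^('d option)) measure).
      real (card (lattice_map x \<inter> P_dir_set c (- sphere 0 1) 2)) = 0"
    using AE_SL_haar_det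
  proof eventually_elim
    case (elim x)
    have "lattice_of x \<inter> P_dir_set c (- sphere 0 1) 2 = {}"
    proof (rule equals0I)
      fix v assume v: "v \<in> lattice_of x \<inter> P_dir_set c (- sphere 0 1) 2"
      then obtain z where z: "z \<in> int_vectors" "v = x *v z" by (auto simp: lattice_of_def)
      have "first_part v = 0"
      proof (rule ccontr)
        assume "first_part v \<noteq> 0"
        then have "norm (first_part v /\<^sub>R norm (first_part v)) = 1" by simp
        then show False using v by (simp add: P_dir_set_def)
      qed
      then have "v $ Some i = 0" by (simp add: first_part_def vec_eq_iff)
      moreover have "v \<noteq> 0" using v by (auto simp: P_dir_set_def P_set_def last_coord_def)
      then have "z \<noteq> 0" using z by auto
      ultimately show False using elim(1) z by auto
    qed
    then show ?case using elim(2) by simp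
  qed
  then have "AE \<Lambda> in \<mu>. real (card (\<Lambda> \<inter> P_dir_set c (- sphere 0 1) 2)) = 0"
    by (subst AE_lattice_map_iff) (use count_measurable[OF D] in measurable)
  then have "mean_count c (- sphere 0 1) = expectation (\<lambda>_. 0)"
    unfolding mean_count_def by (intro integral_cong_AE) (auto intro: count_measurable D)
  then show ?thesis by simp
qed

text \<open>If the mean were 0, almost no lattice would meet the region. But the matrices whose
  column \<open>None\<close> lies in its interior form an open set that meets the group and hence
  has positive mass.\<close>

lemma mean_count_UNIV_pos:
  assumes c: "c > 0"
  shows "mean_count c UNIV > 0"
proof (rule ccontr)
  assume "\<not> ?thesis"
  then have "mean_count c UNIV = 0" using mean_count_nonneg[of c UNIV] by linarith
  then have "AE \<Lambda> in \<mu>. real (card (\<Lambda> \<inter> P_dir_set c UNIV 2)) = 0"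
    unfolding mean_count_def
    by (subst (asm) integral_nonneg_eq_0_iff_AE) (auto intro: integrable_count[OF c])
  from AE_lattice_map[OF this]
  have AE0: "AE x in (SL_haar :: (real^('d option)^('d option)) measure). real (card (lattice_map x \<inter> P_dir_set c UNIV 2)) = 0" .
  let ?e = "axis None 1 :: real^('d option)"
  let ?O = "{x :: real^('d option)^('d option). norm (first_part (x *v ?e)) ^ CARD('d) * last_coord (x *v ?e) < c \<and>
     1 < last_coord (x *v ?e) \<and> last_coord (x *v ?e) < 2}"
  have "continuous_on UNIV (\<lambda>x :: real^('d option)^('d option). first_part (x *v ?e))"
    unfolding first_part_def by (intro continuous_on_vec_lambda continuous_intros)
  then have "open ?O" unfolding last_coord_def
    by (intro open_Collect_conj open_Collect_less continuous_intros)
  \<comment> \<open>A determinant-one witness whose column \<open>None\<close> lies on the last axis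
    at height 3/2, midway between 1 and 2.\<close>
  moreover define x0 :: "real^('d option)^('d option)" where
    "x0 = diag_matrix (case_option (3 / 2) (\<lambda>_. root CARD('d) (2 / 3)))"
  have x0e: "x0 *v ?e = axis None (3 / 2)"
    by (auto simp: x0_def diag_matrix_def matrix_vector_mult_def vec_eq_iff axis_def
        if_distrib[where f="\<lambda>y. _ * y"] sum.delta cong: if_cong)
  have "first_part (axis None (3 / 2) :: real^('d option)) = 0" "last_coord (axis None (3 / 2) :: real^('d option)) = 3 / 2"
    by (simp_all add: first_part_def last_coord_def axis_def vec_eq_iff)
  then have "x0 \<in> ?O" unfolding mem_Collect_eq x0e using c by (simp add: power_0_left)
  moreover have "det x0 = 1" by (simp add: x0_def det_diag_matrix prod_UNIV_option)
  ultimately have pos: "emeasure SL_haar ?O > 0" by (rule emeasure_SL_haar_open_pos)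
  have "AE x in SL_haar. x \<notin> ?O" using AE0 AE_SL_haar_det
  proof eventually_elim
    case (elim x)
    show ?case
    proof
      assume x: "x \<in> ?O"
      have "?e \<in> int_vectors" by (simp add: int_vectors_def axis_def)
      then have "x *v ?e \<in> lattice_of x" by (auto simp: lattice_of_def)
      moreover have "x *v ?e \<in> P_dir_set c UNIV 2" using x by (auto simp: P_dir_set_def P_set_def)
      moreover have "finite (lattice_of x \<inter> P_dir_set c UNIV 2)"
        by (rule finite_lattice_bounded[OF elim(2) bounded_P_dir_set])
      ultimately have "card (lattice_of x \<inter> P_dir_set c UNIV 2) \<noteq> 0" by auto
      then show False using elim by simp
    qed
  qed
  moreover have "?O \<in> sets SL_haar" using \<open>open ?O\<close> by (simp only: sets_SL_haar borel_open)
  ultimately have "?O \<in> null_sets SL_haar" using AE_iff_null_sets by blast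
  then have "emeasure SL_haar ?O = 0" by (rule null_setsD1)
  with pos show False by (simp only: less_irrefl)
qed

text \<open>For a fixed lattice the finite counts are values of counting measure, so additivity
  holds pointwise and is then integrated.\<close>

lemma mean_count_suminf:
  assumes c: "c > 0" and D: "range D \<subseteq> sets borel" "disjoint_family D"
  shows "(\<Sum>n. ennreal (mean_count c (D n))) = ennreal (mean_count c (\<Union>n. D n))"
proof -
  have Dm: "D n \<in> sets borel" "(\<Union>n. D n) \<in> sets borel" for n using D(1) by auto
  have nn: "ennreal (mean_count c E) = (\<integral>\<^sup>+\<Lambda>. ennreal (real (card (\<Lambda> \<inter> P_dir_set c E 2))) \<partial>\<mu>)"
    if "E \<in> sets borel" for E
    unfolding mean_count_def using integrable_count[OF c that] by (intro nn_integral_eq_integral[symmetric]) auto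
  have "(\<Sum>n. ennreal (mean_count c (D n))) = (\<Sum>n. \<integral>\<^sup>+\<Lambda>. ennreal (real (card (\<Lambda> \<inter> P_dir_set c (D n) 2))) \<partial>\<mu>)"
    using Dm by (simp add: nn)
  also have "\<dots> = (\<integral>\<^sup>+\<Lambda>. (\<Sum>n. ennreal (real (card (\<Lambda> \<inter> P_dir_set c (D n) 2)))) \<partial>\<mu>)"
    using count_measurable[OF Dm(1)] by (intro nn_integral_suminf[symmetric]) auto
  also have "\<dots> = (\<integral>\<^sup>+\<Lambda>. ennreal (real (card (\<Lambda> \<inter> P_dir_set c (\<Union>n. D n) 2))) \<partial>\<mu>)"
  proof (rule nn_integral_cong)
    fix \<Lambda> assume \<Lambda>: "\<Lambda> \<in> space \<mu>"
    have em: "ennreal (real (card (\<Lambda> \<inter> P_dir_set c E 2))) = emeasure (count_space UNIV) (\<Lambda> \<inter> P_dir_set c E 2)" for E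
      using finite_P_dir[OF \<Lambda>] by (simp add: emeasure_count_space_finite ennreal_of_nat_eq_real_of_nat)
    have "(\<Sum>n. emeasure (count_space UNIV) (\<Lambda> \<inter> P_dir_set c (D n) 2)) =
        emeasure (count_space UNIV) (\<Union>n. \<Lambda> \<inter> P_dir_set c (D n) 2)"
      using D(2) by (intro suminf_emeasure) (auto simp: disjoint_family_on_def P_dir_set_def)
    also have "(\<Union>n. \<Lambda> \<inter> P_dir_set c (D n) 2) = \<Lambda> \<inter> P_dir_set c (\<Union>n. D n) 2"
      by (auto simp: P_dir_set_def)
    finally show "(\<Sum>n. ennreal (real (card (\<Lambda> \<inter> P_dir_set c (D n) 2)))) =
        ennreal (real (card (\<Lambda> \<inter> P_dir_set c (\<Union>n. D n) 2)))" by (simp only: em)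
  qed
  also have "\<dots> = ennreal (mean_count c (\<Union>n. D n))" using nn[OF Dm(2)] by simp
  finally show ?thesis .
qed

text \<open>Both the normalised mean count and \<open>vol\<close>, moved to the whole space, are
  rotation-invariant probabilities carried by the sphere, hence equal. The constant is identified by
  the total mass alone.\<close>

lemma mean_count_eq_vol:
  assumes c: "c > 0" and vol: "rotation_invariant_prob_on_sphere vol" and A: "A \<in> sets vol"
  shows "mean_count c A = mean_count c UNIV * measure vol A"
proof -
  let ?\<kappa> = "mean_count c UNIV"
  have \<kappa>: "?\<kappa> > 0" by (rule mean_count_UNIV_pos[OF c])
  define N where "N = measure_of UNIV (sets (borel :: (real^'d) measure)) (\<lambda>D. ennreal (mean_count c D / ?\<kappa>))"
  have sets_N: "sets N = sets borel" unfolding N_def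
    by (metis sets.sigma_sets_eq sets_measure_of space_borel top_greatest Pow_UNIV)
  have em_N: "emeasure N D = ennreal (mean_count c D / ?\<kappa>)" if D: "D \<in> sets borel" for D
  proof (rule emeasure_measure_of[OF N_def])
    show "positive (sets N) (\<lambda>D. ennreal (mean_count c D / ?\<kappa>))"
      by (simp add: positive_def mean_count_def P_dir_set_def)
    show "countably_additive (sets N) (\<lambda>D. ennreal (mean_count c D / ?\<kappa>))"
    proof (rule countably_additiveI)
      fix E :: "nat \<Rightarrow> (real^'d) set" assume E: "range E \<subseteq> sets N" "disjoint_family E"
      have "(\<Sum>n. ennreal (mean_count c (E n) / ?\<kappa>)) = (\<Sum>n. ennreal (mean_count c (E n)) * ennreal (1 / ?\<kappa>))"
        using \<kappa> mean_count_nonneg by (simp flip: ennreal_mult)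
      also have "\<dots> = (\<Sum>n. ennreal (mean_count c (E n))) * ennreal (1 / ?\<kappa>)" by simp
      also have "\<dots> = ennreal (mean_count c (\<Union>n. E n)) * ennreal (1 / ?\<kappa>)"
        using mean_count_suminf[OF c _ E(2)] E(1) sets_N by simp
      also have "\<dots> = ennreal (mean_count c (\<Union>n. E n) / ?\<kappa>)"
        using \<kappa> mean_count_nonneg by (simp flip: ennreal_mult)
      finally show "(\<Sum>n. ennreal (mean_count c (E n) / ?\<kappa>)) = ennreal (mean_count c (\<Union>n. E n) / ?\<kappa>)" .
    qed
  qed (use D sets_N in auto)
  have space_N: "space N = UNIV" using sets_eq_imp_space_eq[OF sets_N] by simp
  define M where "M = distr vol borel (\<lambda>x. x)"
  have vol': "prob_space vol" "sets vol = sets (restrict_space borel (sphere 0 1))"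
    and vol_rot: "\<And>R E. orthogonal_transformation R \<Longrightarrow> E \<in> sets vol \<Longrightarrow> emeasure vol (R ` E) = emeasure vol E"
    using vol by (auto simp: rotation_invariant_prob_on_sphere_def)
  have space_vol: "space vol = sphere 0 1"
    using sets_eq_imp_space_eq[OF vol'(2)] by (simp add: space_restrict_space)
  have id: "(\<lambda>x. x) \<in> measurable vol borel"
    by (simp add: measurable_cong_sets[OF vol'(2)] measurable_restrict_space1)
  note R_meas = borel_measurable_orthogonal_transformation
  have "rotation_invariant_prob M"
  proof (intro rotation_invariant_prob.intro rotation_invariant_prob_axioms.intro)
    show "prob_space M" unfolding M_def by (rule prob_space.prob_space_distr[OF vol'(1) id])
    show "sets M = sets borel" by (simp add: M_def)
    show "AE x in M. norm x = 1"
      unfolding M_def by (subst AE_distr_iff[OF id]) (auto simp: space_vol)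
  next
    fix R :: "real^'d \<Rightarrow> real^'d" assume R: "orthogonal_transformation R"
    show "distr M borel R = M"
    proof (rule measure_eqI)
      fix E assume "E \<in> sets (distr M borel R)"
      then have E: "E \<in> sets borel" by simp
      have RE: "R -` E \<in> sets borel" using measurable_sets[OF R_meas[OF R] E] by simp
      then have REv: "R -` E \<inter> sphere 0 1 \<in> sets vol" by (auto simp: vol'(2) sets_restrict_space_iff)
      have nR: "norm (R x) = norm x" for x by (rule orthogonal_transformation_norm[OF R])
      have "R ` (R -` E \<inter> sphere 0 1) = E \<inter> sphere 0 1"
      proof (intro antisym subsetI)
        fix y assume y: "y \<in> E \<inter> sphere 0 1"
        obtain x where "R x = y" using orthogonal_transformation_surj[OF R] by (metis surjD)
        then show "y \<in> R ` (R -` E \<inter> sphere 0 1)" using y nR[of x] by (intro image_eqI[of _ _ x]) auto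
      qed (auto simp: nR)
      then have eq: "emeasure vol (R -` E \<inter> sphere 0 1) = emeasure vol (E \<inter> sphere 0 1)"
        using vol_rot[OF R REv] by simp
      have Rm: "R \<in> measurable M borel" using R_meas[OF R] by (simp add: M_def)
      show "emeasure (distr M borel R) E = emeasure M E"
        using E RE eq by (simp add: emeasure_distr[OF Rm]) (simp add: M_def emeasure_distr[OF id] space_vol)
    qed (simp add: M_def)
  qed
  moreover have "rotation_invariant_prob N"
  proof (intro rotation_invariant_prob.intro rotation_invariant_prob_axioms.intro)
    show "prob_space N"
      by (rule prob_spaceI) (use \<kappa> in \<open>simp add: space_N em_N\<close>)
    show "sets N = sets borel" by (rule sets_N)
    show "AE x in N. norm x = 1"
    proof (rule AE_I')
      show "- sphere 0 1 \<in> null_sets N"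
        by (rule null_setsI) (auto simp: em_N mean_count_off_sphere sets_N)
    qed auto
  next
    fix R :: "real^'d \<Rightarrow> real^'d" assume R: "orthogonal_transformation R"
    show "distr N borel R = N"
    proof (rule measure_eqI)
      fix E assume "E \<in> sets (distr N borel R)"
      then have E: "E \<in> sets borel" by simp
      have Rm: "R \<in> measurable N borel" using R_meas[OF R] by (simp add: measurable_cong_sets[OF sets_N])
      have RE: "R -` E \<in> sets borel" using measurable_sets[OF R_meas[OF R] E] by simp
      show "emeasure (distr N borel R) E = emeasure N E"
        using E RE by (simp add: emeasure_distr[OF Rm] space_N em_N mean_count_rotation[OF R E])
    qed (simp add: sets_N)
  qed
  ultimately have "M = N" by (rule rotation_invariant_unique)
  have Ab: "A \<in> sets borel" "A \<subseteq> sphere 0 1" using A by (auto simp: vol'(2) sets_restrict_space_iff)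
  have "emeasure vol A = emeasure M A"
    using Ab by (simp add: M_def emeasure_distr[OF id] space_vol Int_absorb2)
  also have "\<dots> = ennreal (mean_count c A / ?\<kappa>)" using \<open>M = N\<close> em_N[OF Ab(1)] by simp
  finally have "measure vol A = mean_count c A / ?\<kappa>"
    using \<kappa> mean_count_nonneg[of c A] by (simp add: measure_def)
  then show ?thesis using \<kappa> by simp
qed

lemma N_dir_count_asymptotic:
  assumes c: "c > 0" and D: "D \<in> sets borel"
  shows "AE \<Lambda> in \<mu>. (\<lambda>k. real (N_dir_count c \<Lambda> (2 ^ k) D) / real k) \<longlonglongrightarrow> mean_count c D"
  using birkhoff_flow[OF integrable_count[OF c D]] AE_space
proof eventually_elim
  case (elim \<Lambda>)
  obtain x where "\<Lambda> = lattice_of x" "det x = 1" using elim(2) by (rule space_muE)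
  then have "real (N_dir_count c \<Lambda> (2 ^ k) D) = (\<Sum>i<k. real (card ((flow ^^ i) \<Lambda> \<inter> P_dir_set c D 2)))" for k
    using N_dir_count_eq_birkhoff_sum[of x c k D] by simp
  then show ?case using elim(1) by (simp add: mean_count_def)
qed

lemma N_dir_count_mono:
  assumes "\<Lambda> \<in> space \<mu>" "s \<le> t" "D \<subseteq> E"
  shows "N_dir_count c \<Lambda> s D \<le> N_dir_count c \<Lambda> t E"
  unfolding N_dir_count_def
  by (rule card_mono[OF finite_P_dir[OF assms(1)]]) (use assms in \<open>auto simp: P_dir_set_def P_set_def\<close>)

lemma N_count_eq: "N_count c \<Lambda> T = N_dir_count c \<Lambda> T UNIV"
  by (simp add: N_count_def N_dir_count_def P_dir_set_UNIV)

lemma direction_equidistribution: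
  assumes c: "c > 0" and vol: "rotation_invariant_prob_on_sphere vol" and A: "A \<in> sets vol"
  shows "AE \<Lambda> in \<mu>. ((\<lambda>T. real (N_dir_count c \<Lambda> T A) / real (N_count c \<Lambda> T)) \<longlongrightarrow> measure vol A) at_top"
proof -
  have Ab: "A \<in> sets borel"
    using A vol by (auto simp: rotation_invariant_prob_on_sphere_def sets_restrict_space_iff)
  show ?thesis
    using N_dir_count_asymptotic[OF c Ab] N_dir_count_asymptotic[OF c, of UNIV, simplified] AE_space
  proof eventually_elim
    case (elim \<Lambda>)
    show ?case
      unfolding N_count_eq
    proof (rule tendsto_ratio_of_dyadic[OF _ _ _ mean_count_UNIV_pos[OF c]])
      show "(\<lambda>k. real (N_dir_count c \<Lambda> (2 ^ k) A) / real k) \<longlonglongrightarrow> mean_count c UNIV * measure vol A"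
        using elim(1) mean_count_eq_vol[OF c vol A] by simp
    qed (use elim N_dir_count_mono in auto)
  qed
qed

end

theorem theorem2:
  fixes c :: real
    and A :: "(real^'d::finite) set"
    and vol :: "(real^'d) measure"
    and \<mu> :: "(real^(('d::finite) option)) set measure"
  assumes "c > 0"
    and "rotation_invariant_prob_on_sphere vol"
    and "A \<in> sets (completion vol)"
    and "haar_prob_on_lattices \<mu>"
  shows "AE \<Lambda> in \<mu>.
    ((\<lambda>T. real (N_dir_count c \<Lambda> T A) / real (N_count c \<Lambda> T))
      \<longlongrightarrow> measure (completion vol) A) at_top"
proof -
  obtain C F where "lattice_space \<mu> C F" using haar_prob_imp_lattice_space[OF assms(4)] by blast
  then interpret flow_space \<mu> C F by (simp add: flow_space_def)
  \<comment> \<open>A is measurable only for the completion. It is enclosed between two sets of the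
    sigma-algebra of \<open>vol\<close> with the same measure, and the counts are monotone in the
    set of directions.\<close>
  obtain A2 where A2: "A \<subseteq> A2" "A2 \<in> sets vol" "emeasure (completion vol) A = emeasure vol A2"
    using completion_upper[OF assms(3)] by metis
  define A1 where "A1 = main_part vol A"
  have A1: "A1 \<subseteq> A" "A1 \<in> sets vol" "emeasure (completion vol) A = emeasure vol A1"
    unfolding A1_def using assms(3) main_part_null_part_Un[OF assms(3)]
    by (blast, simp, simp add: emeasure_completion)
  have m: "measure vol A1 = measure (completion vol) A" "measure vol A2 = measure (completion vol) A"
    using A1(3) A2(3) by (simp_all add: measure_def)
  show ?thesis
    using direction_equidistribution[OF assms(1,2) A1(2)] direction_equidistribution[OF assms(1,2) A2(2)] AE_space
  proof eventually_elim
    case (elim \<Lambda>)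
    show ?case
    proof (rule tendsto_sandwich[OF _ _ elim(1)[unfolded m] elim(2)[unfolded m]])
      show "\<forall>\<^sub>F T in at_top. real (N_dir_count c \<Lambda> T A1) / real (N_count c \<Lambda> T) \<le>
          real (N_dir_count c \<Lambda> T A) / real (N_count c \<Lambda> T)"
        using N_dir_count_mono[OF elim(3) order_refl A1(1)] by (intro always_eventually allI divide_right_mono) auto
      show "\<forall>\<^sub>F T in at_top. real (N_dir_count c \<Lambda> T A) / real (N_count c \<Lambda> T) \<le>
          real (N_dir_count c \<Lambda> T A2) / real (N_count c \<Lambda> T)"
        using N_dir_count_mono[OF elim(3) order_refl A2(1)] by (intro always_eventually allI divide_right_mono) auto
    qed
  qed
qed

end
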